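(* Let $K$ be a field and let $I\subset S=K[X_1,\ldots,X_m,Y_1,\ldots,Y_n]$ be a squarefree monomial ideal, with the natural $\mathbb{Z}^m\times\mathbb{Z}^n$-bigrading. Let $R=S/I=K[\Delta]$, where $\Delta$ is the corresponding simplicial complex on $V\cup W$, $V=\{v_1,\dots,v_m\}$, $W=\{w_1,\dots,w_n\}$, and let $P=(y_1,\dots,y_n)\subset R$ be the ideal generated by the residue classes of $Y_1,\dots,Y_n$. Then for every $i$ the Hilbert series of the local cohomology module $H^i_P(K[\Delta])$ with respect to the $\mathbb{Z}^m\times\mathbb{Z}^n$-bigrading is $$H_{H_{P}^i(K[\Delta])}(\mathbf{s},\mathbf{t})=\sum_{F\in \Delta_W}\ \sum_{G\subseteq V}\dim_K \widetilde{H}_{i-|F|-1}\bigl((\operatorname{lk}(F\cup G))_W;K\bigr)\prod_{v_p\in G}\frac{s_p}{1-s_p}\prod_{w_q\in F}\frac{t_q^{-1}}{1-t_q^{-1}},$$ where $\mathbf{s}=(s_1,\dots,s_m)$ and $\mathbf{t}=(t_1,\dots,t_n)$.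
   Context: $\Delta$ is the simplicial complex on the vertex set $V\cup W$ (with $v_p$ corresponding to $X_p$ and $w_q$ to $Y_q$) whose faces are the subsets for which the product of the corresponding variables does not lie in $I$; a singleton need not be a face. The bigrading: the degree of the class of $X_p$ is the $p$-th unit vector of $\mathbb{Z}^m$ (and $0$ in $\mathbb{Z}^n$); the degree of the class of $Y_q$ is the $q$-th unit vector of $\mathbb{Z}^n$ (and $0$ in $\mathbb{Z}^m$). The local cohomology modules $H^i_P(R)$ inherit this grading (e.g. via the Čech complex on $y_1,\dots,y_n$). For a $\mathbb{Z}^m\times\mathbb{Z}^n$-graded module $M$, its Hilbert series is $H_M(\mathbf{s},\mathbf{t})=\sum_{(a,b)\in\mathbb{Z}^m\times\mathbb{Z}^n}\dim_K M_{(a,b)}\,\mathbf{s}^a\mathbf{t}^b$. On the right-hand side, $\frac{s_p}{1-s_p}$ means $\sum_{k\ge1}s_p^k$, $\frac{t_q^{-1}}{1-t_q^{-1}}$ means $\sum_{k\ge 1}t_q^{-k}$, and empty products are $1$. For $F\subseteq V\cup W$, $\operatorname{lk}F=\{G: F\cup G\in\Delta,\ F\cap G=\emptyset\}$, which is the void complex (no faces at all) if $F\notin\Delta$. For a simplicial complex $\Gamma$, $\Gamma_W$ denotes the subcomplex of faces of $\Gamma$ contained in $W$. $\widetilde H_\bullet(\,\cdot\,;K)$ is reduced simplicial homology; the void complex has zero reduced homology in all degrees, while the complex $\{\emptyset\}$ has $\widetilde H_{-1}=K$ and zero otherwise. *)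

theory Defs
  imports
    "HOL-Library.Poly_Mapping"
    "HOL-Library.Extended_Nat"
    "HOL-Library.FuncSet"
    "HOL-Algebra.QuotRing"
    "HOL-Algebra.Module"
begin

section \<open>Vector spaces inside module records\<close>

text \<open>
  A module record is read as a vector space over the field given by the type of its scalars. The
  ring fields \<open>mult\<close> and \<open>one\<close> of a module record have no meaning for a module and are left
  \<open>undefined\<close> throughout, except for localizations, which are rings.
\<close>

definition lin_comb :: "('k, 'a) module \<Rightarrow> 'a set \<Rightarrow> ('a \<Rightarrow> 'k) \<Rightarrow> 'a" where
  "lin_comb M B c = finsum M (\<lambda>x. c x \<odot>\<^bsub>M\<^esub> x) B"

definition finite_basis :: "('k::field, 'a) module \<Rightarrow> 'a set \<Rightarrow> bool" where
  "finite_basis M B \<longleftrightarrow> finite B \<and> B \<subseteq> carrier M \<and>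
     (\<forall>c. lin_comb M B c = \<zero>\<^bsub>M\<^esub> \<longrightarrow> (\<forall>x\<in>B. c x = 0)) \<and>
     (\<forall>v\<in>carrier M. \<exists>c. v = lin_comb M B c)"

definition vs_dim :: "('k::field, 'a) module \<Rightarrow> enat" where
  "vs_dim M = (if \<exists>B. finite_basis M B then enat (card (SOME B. finite_basis M B)) else \<infinity>)"

definition quot_module :: "('r, 'a) module \<Rightarrow> 'a set \<Rightarrow> ('r, 'a set) module" where
  "quot_module M N =
     \<lparr>carrier = a_rcosets\<^bsub>M\<^esub> N, mult = undefined, one = undefined, zero = N, add = set_add M,
      smult = (\<lambda>r C. \<Union>x\<in>C. N +>\<^bsub>M\<^esub> (r \<odot>\<^bsub>M\<^esub> x))\<rparr>"


section \<open>Local cohomology\<close>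

definition frac_rel :: "('a, 'z) ring_scheme \<Rightarrow> 'a set \<Rightarrow> (('a \<times> 'a) \<times> ('a \<times> 'a)) set" where
  "frac_rel R A = {((r, s), (r', s')).
     r \<in> carrier R \<and> s \<in> A \<and> r' \<in> carrier R \<and> s' \<in> A \<and>
     (\<exists>t\<in>A. t \<otimes>\<^bsub>R\<^esub> (s' \<otimes>\<^bsub>R\<^esub> r \<ominus>\<^bsub>R\<^esub> s \<otimes>\<^bsub>R\<^esub> r') = \<zero>\<^bsub>R\<^esub>)}"

definition frac :: "('a, 'z) ring_scheme \<Rightarrow> 'a set \<Rightarrow> 'a \<Rightarrow> 'a \<Rightarrow> ('a \<times> 'a) set" where
  "frac R A r s = frac_rel R A `` {(r, s)}"

definition localization ::
    "('a, 'z) ring_scheme \<Rightarrow> 'a set \<Rightarrow> ('a, ('a \<times> 'a) set) module" where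
  "localization R A =
     \<lparr>carrier = (carrier R \<times> A) // frac_rel R A,
      mult = (\<lambda>x y. \<Union>(r, s)\<in>x. \<Union>(r', s')\<in>y. frac R A (r \<otimes>\<^bsub>R\<^esub> r') (s \<otimes>\<^bsub>R\<^esub> s')),
      one = frac R A \<one>\<^bsub>R\<^esub> \<one>\<^bsub>R\<^esub>,
      zero = frac R A \<zero>\<^bsub>R\<^esub> \<one>\<^bsub>R\<^esub>,
      add = (\<lambda>x y. \<Union>(r, s)\<in>x. \<Union>(r', s')\<in>y.
               frac R A (r \<otimes>\<^bsub>R\<^esub> s' \<oplus>\<^bsub>R\<^esub> r' \<otimes>\<^bsub>R\<^esub> s) (s \<otimes>\<^bsub>R\<^esub> s')),
      smult = (\<lambda>a x. \<Union>(r, s)\<in>x. frac R A (a \<otimes>\<^bsub>R\<^esub> r) s)\<rparr>"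

text \<open>
  The multiplicative set of all monomials in the \<open>y j\<close>, \<open>j \<in> J\<close>; localizing at it gives the same
  ring as inverting the single element \<open>\<Prod>j\<in>J. y j\<close>.
\<close>
definition denoms :: "('a, 'z) ring_scheme \<Rightarrow> (nat \<Rightarrow> 'a) \<Rightarrow> nat set \<Rightarrow> 'a set" where
  "denoms R y J = {finprod R (\<lambda>j. y j [^]\<^bsub>R\<^esub> a j) J |a :: nat \<Rightarrow> nat. True}"

abbreviation loc_at :: "('a, 'z) ring_scheme \<Rightarrow> (nat \<Rightarrow> 'a) \<Rightarrow> nat set \<Rightarrow>
    ('a, ('a \<times> 'a) set) module" where
  "loc_at R y J \<equiv> localization R (denoms R y J)"

text \<open>
  For \<open>J \<subseteq> L\<close>, the canonical map from \<open>loc_at R y J\<close> to \<open>loc_at R y L\<close>, sending \<open>r/s\<close> to \<open>r/s\<close>: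
  the image of the equivalence class \<open>x\<close> under the coarser relation is one equivalence class.
\<close>
definition loc_map :: "('a, 'z) ring_scheme \<Rightarrow> (nat \<Rightarrow> 'a) \<Rightarrow> nat set \<Rightarrow>
    ('a \<times> 'a) set \<Rightarrow> ('a \<times> 'a) set" where
  "loc_map R y L x = frac_rel R (denoms R y L) `` x"

text \<open>
  The Cech complex of \<open>R\<close> on \<open>y 1, \<dots>, y n\<close>. It is indexed by all integers; its modules in degrees
  below \<open>0\<close> and above \<open>n\<close> are zero because there are no index sets of that size.
\<close>

definition cech_index :: "nat \<Rightarrow> int \<Rightarrow> nat set set" where
  "cech_index n i = {J. J \<subseteq> {1..n} \<and> int (card J) = i}"

definition cech :: "('a, 'z) ring_scheme \<Rightarrow> (nat \<Rightarrow> 'a) \<Rightarrow> nat \<Rightarrow> int \<Rightarrow>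
    ('a, nat set \<Rightarrow> ('a \<times> 'a) set) module" where
  "cech R y n i =
     \<lparr>carrier = (\<Pi>\<^sub>E J\<in>cech_index n i. carrier (loc_at R y J)),
      mult = undefined, one = undefined,
      zero = (\<lambda>J\<in>cech_index n i. \<zero>\<^bsub>loc_at R y J\<^esub>),
      add = (\<lambda>c c'. \<lambda>J\<in>cech_index n i. c J \<oplus>\<^bsub>loc_at R y J\<^esub> c' J),
      smult = (\<lambda>r c. \<lambda>J\<in>cech_index n i. r \<odot>\<^bsub>loc_at R y J\<^esub> c J)\<rparr>"

definition cech_diff :: "('a, 'z) ring_scheme \<Rightarrow> (nat \<Rightarrow> 'a) \<Rightarrow> nat \<Rightarrow> int \<Rightarrow>
    (nat set \<Rightarrow> ('a \<times> 'a) set) \<Rightarrow> nat set \<Rightarrow> ('a \<times> 'a) set" where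
  "cech_diff R y n i c = (\<lambda>J\<in>cech_index n (i + 1).
     finsum (loc_at R y J)
       (\<lambda>j. ((\<ominus>\<^bsub>R\<^esub> \<one>\<^bsub>R\<^esub>) [^]\<^bsub>R\<^esub> card {l\<in>J. l < j}) \<odot>\<^bsub>loc_at R y J\<^esub> loc_map R y J (c (J - {j}))) J)"

definition cech_cocycles :: "('a, 'z) ring_scheme \<Rightarrow> (nat \<Rightarrow> 'a) \<Rightarrow> nat \<Rightarrow> int \<Rightarrow>
    (nat set \<Rightarrow> ('a \<times> 'a) set) set" where
  "cech_cocycles R y n i =
     {c \<in> carrier (cech R y n i). cech_diff R y n i c = \<zero>\<^bsub>cech R y n (i + 1)\<^esub>}"

definition cech_coboundaries :: "('a, 'z) ring_scheme \<Rightarrow> (nat \<Rightarrow> 'a) \<Rightarrow> nat \<Rightarrow> int \<Rightarrow>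
    (nat set \<Rightarrow> ('a \<times> 'a) set) set" where
  "cech_coboundaries R y n i = cech_diff R y n (i - 1) ` carrier (cech R y n (i - 1))"

text \<open>
  The \<open>i\<close>-th local cohomology module of the Noetherian ring \<open>R\<close> with support in the ideal
  generated by \<open>y 1, \<dots>, y n\<close>, as the \<open>R\<close>-module of Cech cohomology.
\<close>
definition local_cohomology :: "('a, 'z) ring_scheme \<Rightarrow> (nat \<Rightarrow> 'a) \<Rightarrow> nat \<Rightarrow> int \<Rightarrow>
    ('a, (nat set \<Rightarrow> ('a \<times> 'a) set) set) module" where
  "local_cohomology R y n i =
     quot_module ((cech R y n i)\<lparr>carrier := cech_cocycles R y n i\<rparr>) (cech_coboundaries R y n i)"

text \<open>
  The gradings induced by a grading \<open>gr\<close> of \<open>R\<close> for which the \<open>y j\<close> are homogeneous: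
  \<open>r/s\<close> has degree \<open>deg r - deg s\<close>, and a class in cohomology has degree \<open>d\<close> if it is represented
  by a cocycle all of whose components have degree \<open>d\<close>.
\<close>

definition loc_component ::
    "('a, 'z) ring_scheme \<Rightarrow> ('d::plus \<Rightarrow> 'a set) \<Rightarrow> 'a set \<Rightarrow> 'd \<Rightarrow> ('a \<times> 'a) set set" where
  "loc_component R gr A d = {frac R A r s |r s e. s \<in> A \<and> s \<in> gr e \<and> r \<in> gr (d + e)}"

definition cech_component :: "('a, 'z) ring_scheme \<Rightarrow> ('d::plus \<Rightarrow> 'a set) \<Rightarrow> (nat \<Rightarrow> 'a) \<Rightarrow>
    nat \<Rightarrow> int \<Rightarrow> 'd \<Rightarrow> (nat set \<Rightarrow> ('a \<times> 'a) set) set" where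
  "cech_component R gr y n i d =
     (\<Pi>\<^sub>E J\<in>cech_index n i. loc_component R gr (denoms R y J) d)"

definition local_cohomology_component :: "('a, 'z) ring_scheme \<Rightarrow> ('d::plus \<Rightarrow> 'a set) \<Rightarrow>
    (nat \<Rightarrow> 'a) \<Rightarrow> nat \<Rightarrow> int \<Rightarrow> 'd \<Rightarrow> (nat set \<Rightarrow> ('a \<times> 'a) set) set set" where
  "local_cohomology_component R gr y n i d =
     (\<lambda>c. cech_coboundaries R y n i +>\<^bsub>cech R y n i\<^esub> c) `
       (cech_cocycles R y n i \<inter> cech_component R gr y n i d)"


section \<open>Polynomials and Stanley-Reisner rings\<close>

text \<open>
  \<open>Xv p\<close> and \<open>Yv q\<close> serve both as the variables $X_p$, $Y_q$ and as the vertices $v_p$, $w_q$.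
  Only the indices \<open>1 \<le> p \<le> m\<close> and \<open>1 \<le> q \<le> n\<close> are used.
\<close>
datatype var = Xv nat | Yv nat

text \<open>The order on the vertices only serves to fix orientations of simplices.\<close>
instantiation var :: linorder
begin

fun less_eq_var :: "var \<Rightarrow> var \<Rightarrow> bool" where
  "less_eq_var (Xv p) (Xv p') \<longleftrightarrow> p \<le> p'"
| "less_eq_var (Xv p) (Yv q) \<longleftrightarrow> True"
| "less_eq_var (Yv q) (Xv p) \<longleftrightarrow> False"
| "less_eq_var (Yv q) (Yv q') \<longleftrightarrow> q \<le> q'"

definition less_var :: "var \<Rightarrow> var \<Rightarrow> bool" where
  "less_var x y \<longleftrightarrow> x \<le> y \<and> \<not> y \<le> x"

instance
proof
  fix x y z :: var
  show "x < y \<longleftrightarrow> x \<le> y \<and> \<not> y \<le> x" by (rule less_var_def)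
  show "x \<le> x" by (cases x) auto
  show "x \<le> y \<Longrightarrow> y \<le> z \<Longrightarrow> x \<le> z" by (cases x; cases y; cases z) auto
  show "x \<le> y \<Longrightarrow> y \<le> x \<Longrightarrow> x = y" by (cases x; cases y) auto
  show "x \<le> y \<or> y \<le> x" by (cases x; cases y) auto
qed

end

definition Vset :: "nat \<Rightarrow> var set" where
  "Vset m = Xv ` {1..m}"

definition Wset :: "nat \<Rightarrow> var set" where
  "Wset n = Yv ` {1..n}"

type_synonym 'k mpol = "(var \<Rightarrow>\<^sub>0 nat) \<Rightarrow>\<^sub>0 'k"

definition poly_ring :: "'k::field itself \<Rightarrow> nat \<Rightarrow> nat \<Rightarrow> 'k mpol ring" where
  "poly_ring _ m n =
     \<lparr>carrier = {f. \<forall>u\<in>Poly_Mapping.keys f. Poly_Mapping.keys u \<subseteq> Vset m \<union> Wset n},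
      mult = (*), one = 1, zero = 0, add = (+)\<rparr>"

definition indet :: "var \<Rightarrow> 'k::field mpol" where
  "indet v = Poly_Mapping.single (Poly_Mapping.single v 1) 1"

definition sqfree_monom :: "var set \<Rightarrow> 'k::field mpol" where
  "sqfree_monom F = (\<Prod>v\<in>F. indet v)"

definition squarefree_monomial_ideal :: "nat \<Rightarrow> nat \<Rightarrow> 'k::field mpol set \<Rightarrow> bool" where
  "squarefree_monomial_ideal m n I \<longleftrightarrow>
     (\<exists>\<F> \<subseteq> Pow (Vset m \<union> Wset n). I = Idl\<^bsub>poly_ring TYPE('k) m n\<^esub> (sqfree_monom ` \<F>))"

definition sr_complex :: "nat \<Rightarrow> nat \<Rightarrow> 'k::field mpol set \<Rightarrow> var set set" where
  "sr_complex m n I = {F. F \<subseteq> Vset m \<union> Wset n \<and> sqfree_monom F \<notin> I}"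

definition sr_ring :: "nat \<Rightarrow> nat \<Rightarrow> 'k::field mpol set \<Rightarrow> 'k mpol set ring" where
  "sr_ring m n I = poly_ring TYPE('k) m n Quot I"

definition residue :: "nat \<Rightarrow> nat \<Rightarrow> 'k::field mpol set \<Rightarrow> 'k mpol \<Rightarrow> 'k mpol set" where
  "residue m n I f = I +>\<^bsub>poly_ring TYPE('k) m n\<^esub> f"

text \<open>
  Degrees in $\mathbb{Z}^m \times \mathbb{Z}^n$: the coefficient of \<open>d\<close> at \<open>Xv p\<close> is the $p$-th entry
  of the first vector, the coefficient at \<open>Yv q\<close> the $q$-th entry of the second one. Degrees that
  involve other indices occur in the type but all graded components in such degrees vanish.
\<close>
type_synonym deg = "var \<Rightarrow>\<^sub>0 int"

definition poly_component :: "nat \<Rightarrow> nat \<Rightarrow> deg \<Rightarrow> 'k::field mpol set" where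
  "poly_component m n d =
     {f \<in> carrier (poly_ring TYPE('k) m n). \<forall>u\<in>Poly_Mapping.keys f. Poly_Mapping.map int u = d}"

definition sr_component :: "nat \<Rightarrow> nat \<Rightarrow> 'k::field mpol set \<Rightarrow> deg \<Rightarrow> 'k mpol set set" where
  "sr_component m n I d = residue m n I ` poly_component m n d"

text \<open>
  The component of degree \<open>d\<close> of the local cohomology module $H^i_P(S/I)$, $P = (y_1, \dots, y_n)$, as a
  vector space over \<open>'k\<close>, where scalars act through the residue classes of constant polynomials.
\<close>
definition sr_local_cohomology ::
    "nat \<Rightarrow> nat \<Rightarrow> 'k::field mpol set \<Rightarrow> int \<Rightarrow> deg \<Rightarrow>
     ('k, (nat set \<Rightarrow> ('k mpol set \<times> 'k mpol set) set) set) module" where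
  "sr_local_cohomology m n I i d =
     (let R = sr_ring m n I; y = (\<lambda>q. residue m n I (indet (Yv q)));
          H = local_cohomology R y n i
      in \<lparr>carrier = local_cohomology_component R (sr_component m n I) y n i d,
          mult = undefined, one = undefined, zero = \<zero>\<^bsub>H\<^esub>, add = add H,
          smult = (\<lambda>a h. residue m n I (Poly_Mapping.single 0 a) \<odot>\<^bsub>H\<^esub> h)\<rparr>)"


section \<open>Simplicial complexes and reduced homology\<close>

definition lk :: "'v set set \<Rightarrow> 'v set \<Rightarrow> 'v set set" where
  "lk \<Delta> F = {G. F \<union> G \<in> \<Delta> \<and> F \<inter> G = {}}"

definition induced :: "'v set set \<Rightarrow> 'v set \<Rightarrow> 'v set set" where
  "induced \<Gamma> W = {F \<in> \<Gamma>. F \<subseteq> W}"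

text \<open>The empty face spans the chains in degree \<open>-1\<close>; this makes the homology reduced.\<close>
definition chains :: "'k::field itself \<Rightarrow> 'v set set \<Rightarrow> int \<Rightarrow> ('k, 'v set \<Rightarrow>\<^sub>0 'k) module" where
  "chains _ \<Gamma> k =
     \<lparr>carrier = {c. \<forall>s\<in>Poly_Mapping.keys c. s \<in> \<Gamma> \<and> finite s \<and> int (card s) = k + 1},
      mult = undefined, one = undefined, zero = 0, add = (+),
      smult = (\<lambda>a. Poly_Mapping.map ((*) a))\<rparr>"

definition boundary :: "('v::linorder set \<Rightarrow>\<^sub>0 'k::field) \<Rightarrow> ('v set \<Rightarrow>\<^sub>0 'k)" where
  "boundary c = (\<Sum>s\<in>Poly_Mapping.keys c. \<Sum>v\<in>s.
     Poly_Mapping.single (s - {v}) ((- 1) ^ card {u\<in>s. u < v} * Poly_Mapping.lookup c s))"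

definition reduced_homology :: "'k::field itself \<Rightarrow> 'v::linorder set set \<Rightarrow> int \<Rightarrow>
    ('k, ('v set \<Rightarrow>\<^sub>0 'k) set) module" where
  "reduced_homology T \<Gamma> k =
     quot_module ((chains T \<Gamma> k)\<lparr>carrier := {c \<in> carrier (chains T \<Gamma> k). boundary c = 0}\<rparr>)
       (boundary ` carrier (chains T \<Gamma> (k + 1)))"


section \<open>Formal series in $s_1^{\pm 1}, \dots, s_m^{\pm 1}, t_1^{\pm 1}, \dots, t_n^{\pm 1}$\<close>

text \<open>
  A series is given by its coefficients. The products below are meaningful only if every
  coefficient of the product is a finite sum, as is the case for the series used here.
\<close>
type_synonym series = "deg \<Rightarrow> enat"

definition series_mult :: "series \<Rightarrow> series \<Rightarrow> series" where
  "series_mult f g d = (\<Sum>(a, b)\<in>{(a, b). a + b = d \<and> f a \<noteq> 0 \<and> g b \<noteq> 0}. f a * g b)"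

definition series_prod :: "('v \<Rightarrow> series) \<Rightarrow> 'v set \<Rightarrow> series" where
  "series_prod f A d =
     (\<Sum>a\<in>{a \<in> A \<rightarrow>\<^sub>E UNIV. (\<Sum>v\<in>A. a v) = d \<and> (\<forall>v\<in>A. f v (a v) \<noteq> 0)}. \<Prod>v\<in>A. f v (a v))"

text \<open>For a variable \<open>x\<close> (an $s_p$ or $t_q$), the series $x/(1-x)$ and $x^{-1}/(1-x^{-1})$.\<close>

definition geom_pos :: "var \<Rightarrow> series" where
  "geom_pos v d = (if \<exists>k\<ge>1. d = Poly_Mapping.single v k then 1 else 0)"

definition geom_neg :: "var \<Rightarrow> series" where
  "geom_neg v d = (if \<exists>k\<ge>1. d = Poly_Mapping.single v (- k) then 1 else 0)"

definition hilbert_series :: "(deg \<Rightarrow> ('k::field, 'a) module) \<Rightarrow> series" where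
  "hilbert_series M d = vs_dim (M d)"

end

theory Submission
  imports Defs "HOL-Library.Function_Algebras" "HOL-Algebra.Multiplicative_Group"
begin

text \<open>
  Local cohomology is computed degree by degree from the Cech complex. Write a degree \<open>d\<close> as
  \<open>pos - neg\<close> with \<open>pos\<close> and \<open>neg\<close> nonnegative of disjoint supports \<open>G\<close> and \<open>F\<close>. The localization
  at the $y_j$, \<open>j \<in> J\<close>, has in degree \<open>d\<close> a one-dimensional component if \<open>F \<subseteq> J\<close> and
  \<open>J \<union> G\<close> is a face of \<open>\<Delta>\<close>, and none otherwise. Hence, up to signs, the degree \<open>d\<close> part of the Cech
  complex is the augmented simplicial cochain complex of the sets \<open>J - F\<close>, shifted by \<open>|F| + 1\<close>.
  If \<open>G\<close> contains a vertex of \<open>W\<close>, these sets form a cone, which is acyclic; otherwise they form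
  the restriction to \<open>W\<close> of the link of \<open>F \<union> G\<close>. Over a field, cohomology and homology have the
  same dimension because a matrix and its transpose have the same rank. On the other side, the
  product of the geometric series of \<open>F\<close> and \<open>G\<close> has coefficient \<open>1\<close> at \<open>d\<close> if \<open>F\<close> and \<open>G\<close> are the
  supports of \<open>neg\<close> and \<open>pos\<close>, and \<open>0\<close> otherwise.
\<close>

section \<open>Linear algebra\<close>

text \<open>The degree \<open>d\<close> component of local cohomology consists of classes of
  homogeneous cocycles modulo all coboundaries, including those of inhomogeneous cochains.
  Describing the homogeneous cochains is therefore not enough: a homogeneous cochain that bounds has
  to bound a homogeneous one. Instead of splitting each localization into the direct sum of its
  components, the proof reads off a single coefficient. \<open>graded_coeff\<close> assigns to a
  fraction its coefficient in degree \<open>d\<close> and turns an arbitrary primitive into a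
  simplicial cochain. It is independent of the representing fraction as long as the index set
  together with the support of \<open>pos_exp\<close> is a face, because no monomial of
  \<open>I\<close> is supported on a face.

  The spaces to be measured have cosets as elements. Their dimensions are obtained by mapping a
  concrete space of functions onto them and subtracting the dimension of the kernel. The same lemma
  serves simplicial homology, so both sides reduce to ranks of incidence matrices.\<close>

context vector_space
begin

text \<open>Rank-nullity for a surjection onto a carrier known only through its operations: the laws
  of \<open>Q\<close> are inherited from \<open>Z\<close>. Extending a basis of the kernel to one of
  \<open>Z\<close>, the added vectors map to a basis of \<open>Q\<close>. Since
  \<open>vs_dim\<close> measures an arbitrarily chosen basis, the converse is needed too: any basis
  of \<open>Q\<close>, lifted to \<open>Z\<close> and joined with a kernel basis, is a basis of
  \<open>Z\<close>.\<close>

lemma vs_dim_image: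
  fixes Q :: "('a, 'c) module" and \<Psi> :: "'b \<Rightarrow> 'c"
  assumes Z: "subspace Z" and S: "finite S" "Z \<subseteq> span S"
    and carrier: "carrier Q = \<Psi> ` Z"
    and zero: "\<Psi> 0 = \<zero>\<^bsub>Q\<^esub>"
    and add: "\<And>u v. u \<in> Z \<Longrightarrow> v \<in> Z \<Longrightarrow> \<Psi> (u + v) = \<Psi> u \<oplus>\<^bsub>Q\<^esub> \<Psi> v"
    and smult: "\<And>a u. u \<in> Z \<Longrightarrow> \<Psi> (scale a u) = a \<odot>\<^bsub>Q\<^esub> \<Psi> u"
  shows "vs_dim Q = enat (dim Z - dim {u \<in> Z. \<Psi> u = \<zero>\<^bsub>Q\<^esub>})"
proof -
  define N where "N = {u \<in> Z. \<Psi> u = \<zero>\<^bsub>Q\<^esub>}"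
  interpret Q: abelian_monoid Q
  proof (rule abelian_monoidI)
    show "\<zero>\<^bsub>Q\<^esub> \<in> carrier Q"
      using carrier zero subspace_0[OF Z] by force
  next
    fix x y assume "x \<in> carrier Q" "y \<in> carrier Q"
    then obtain u v where uv: "u \<in> Z" "v \<in> Z" "x = \<Psi> u" "y = \<Psi> v" using carrier by auto
    show "x \<oplus>\<^bsub>Q\<^esub> y \<in> carrier Q"
      using uv carrier add[of u v] subspace_add[OF Z, of u v] by force
    show "x \<oplus>\<^bsub>Q\<^esub> y = y \<oplus>\<^bsub>Q\<^esub> x"
      using uv add[of u v] add[of v u] by (simp add: add.commute)
  next
    fix x y z assume "x \<in> carrier Q" "y \<in> carrier Q" "z \<in> carrier Q"
    then obtain u v w where uv: "u \<in> Z" "v \<in> Z" "w \<in> Z" "x = \<Psi> u" "y = \<Psi> v" "z = \<Psi> w"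
      using carrier by auto
    have "(\<Psi> u \<oplus>\<^bsub>Q\<^esub> \<Psi> v) \<oplus>\<^bsub>Q\<^esub> \<Psi> w = \<Psi> (u + v + w)"
      using uv add subspace_add[OF Z] by simp
    also have "\<dots> = \<Psi> u \<oplus>\<^bsub>Q\<^esub> (\<Psi> v \<oplus>\<^bsub>Q\<^esub> \<Psi> w)"
      using uv add subspace_add[OF Z] by (simp add: add.assoc)
    finally show "x \<oplus>\<^bsub>Q\<^esub> y \<oplus>\<^bsub>Q\<^esub> z = x \<oplus>\<^bsub>Q\<^esub> (y \<oplus>\<^bsub>Q\<^esub> z)" using uv by simp
  next
    fix x assume "x \<in> carrier Q"
    then obtain u where "u \<in> Z" "x = \<Psi> u" using carrier by auto
    then show "\<zero>\<^bsub>Q\<^esub> \<oplus>\<^bsub>Q\<^esub> x = x" using zero add[of 0 u] subspace_0[OF Z] by simp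
  qed
  have N: "subspace N"
  proof (rule subspaceI)
    show "0 \<in> N" using zero subspace_0[OF Z] by (simp add: N_def)
    show "x + y \<in> N" if "x \<in> N" "y \<in> N" for x y
      using that add[of x y] subspace_add[OF Z] by (auto simp: N_def)
    show "scale c x \<in> N" if "x \<in> N" for c x
    proof -
      \<comment> \<open>That scaling fixes the zero of \<open>Q\<close> is not assumed; it follows
        by writing this zero as the image of \<open>0\<close> and applying \<open>smult\<close>
        there.\<close>
      have "\<Psi> (scale c x) = c \<odot>\<^bsub>Q\<^esub> \<Psi> (scale 0 x)" using that smult zero by (auto simp: N_def)
      also have "\<dots> = \<Psi> (scale c (scale 0 x))"
        using that smult[of "scale 0 x" c] subspace_0[OF Z] by (auto simp: N_def)
      finally show ?thesis using that subspace_scale[OF Z] zero by (auto simp: N_def)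
    qed
  qed
  have diffN: "u - v \<in> N" if "u \<in> Z" "v \<in> Z" "\<Psi> u = \<Psi> v" for u v
  proof -
    have "\<Psi> (u - v) = \<Psi> u \<oplus>\<^bsub>Q\<^esub> \<Psi> (- v)" using add[of u "- v"] that subspace_neg[OF Z] by simp
    also have "\<dots> = \<Psi> (v - v)" using add[of v "- v"] that subspace_neg[OF Z] by simp
    finally show ?thesis using that zero subspace_diff[OF Z] by (simp add: N_def)
  qed
  have comb: "lin_comb Q B c = \<Psi> (\<Sum>x\<in>B. scale (c x) (p x))"
    if "finite B" "\<And>x. x \<in> B \<Longrightarrow> p x \<in> Z \<and> \<Psi> (p x) = x" for B c p
    using that
  proof (induction B)
    case empty
    then show ?case by (simp add: lin_comb_def zero)
  next
    case (insert x B)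
    have mem: "scale (c y) (p y) \<in> Z" "\<Psi> (scale (c y) (p y)) = c y \<odot>\<^bsub>Q\<^esub> y"
      if "y \<in> insert x B" for y
      using insert.prems[OF that] smult subspace_scale[OF Z] by auto
    have "lin_comb Q (insert x B) c = c x \<odot>\<^bsub>Q\<^esub> x \<oplus>\<^bsub>Q\<^esub> lin_comb Q B c"
      unfolding lin_comb_def using insert.hyps mem carrier
      by (intro Q.finsum_insert) (auto simp flip: mem(2))
    also have "\<dots> = \<Psi> (scale (c x) (p x) + (\<Sum>x\<in>B. scale (c x) (p x)))"
      using mem insert by (subst add) (auto intro!: subspace_sum[OF Z])
    finally show ?case using insert.hyps by simp
  qed
  have NZ: "N \<subseteq> Z" by (auto simp: N_def)
  obtain BN where BN: "BN \<subseteq> N" "independent BN" "N \<subseteq> span BN" "card BN = dim N"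
    using basis_exists by blast
  obtain BZ where BZ: "BN \<subseteq> BZ" "BZ \<subseteq> Z" "independent BZ" "Z \<subseteq> span BZ"
    by (rule maximal_independent_subset_extend[OF subset_trans[OF BN(1) NZ] BN(2)])
  have finZ: "finite BZ" using independent_span_bound[OF S(1) BZ(3)] BZ(2) S(2) by blast
  then have finN: "finite BN" using BZ(1) finite_subset by auto
  have dimZ: "card BZ = dim Z" using basis_card_eq_dim BZ by auto
  have spanN: "span BN = N" using BN N by (simp add: span_subspace)
  define C where "C = BZ - BN"
  have C: "finite C" "C \<subseteq> Z" using finZ BZ by (auto simp: C_def)
  have C0: "\<forall>x\<in>C. g x = 0" if g: "(\<Sum>x\<in>C. scale (g x) x) \<in> N" for g
  proof -
    obtain h where h: "(\<Sum>x\<in>C. scale (g x) x) = (\<Sum>x\<in>BN. scale (h x) x)"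
      using g spanN span_finite[OF finN] by auto
    \<comment> \<open>A combination of \<open>C\<close> in the kernel equals one of
      \<open>BN\<close>; their difference is a relation on the whole basis
      \<open>BZ\<close>.\<close>
    define f where "f x = (if x \<in> C then g x else - h x)" for x
    have "(\<Sum>x\<in>BZ. scale (f x) x) = (\<Sum>x\<in>C. scale (f x) x) + (\<Sum>x\<in>BN. scale (f x) x)"
      using BZ(1) finZ sum.subset_diff[of BN BZ "\<lambda>x. scale (f x) x"] by (simp add: C_def)
    also have "(\<Sum>x\<in>C. scale (f x) x) = (\<Sum>x\<in>C. scale (g x) x)"
      by (intro sum.cong) (auto simp: f_def)
    also have "(\<Sum>x\<in>BN. scale (f x) x) = - (\<Sum>x\<in>BN. scale (h x) x)"
      unfolding sum_negf[symmetric] by (intro sum.cong) (auto simp: f_def C_def)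
    finally have "(\<Sum>x\<in>BZ. scale (f x) x) = 0" using h by simp
    then have "f x = 0" if "x \<in> BZ" for x
      using BZ(3) finZ independent_explicit_finite_subsets[of BZ] that by blast
    then show ?thesis by (fastforce simp: f_def C_def)
  qed
  have inj: "inj_on \<Psi> C"
  proof (rule inj_onI)
    fix x y assume xy: "x \<in> C" "y \<in> C" "\<Psi> x = \<Psi> y"
    show "x = y"
    proof (rule ccontr)
      assume "x \<noteq> y"
      \<comment> \<open>These coefficients produce \<open>x - y\<close>, which lies in the kernel as
        soon as the images agree.\<close>
      define g where "g z = (if z = x then 1 else if z = y then - 1 else 0 :: 'a)" for z
      have "(\<Sum>z\<in>C. scale (g z) z) = (\<Sum>z\<in>{x, y}. scale (g z) z)"
        using xy C by (intro sum.mono_neutral_right) (auto simp: g_def)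
      also have "\<dots> = x - y" using \<open>x \<noteq> y\<close> by (simp add: g_def)
      finally have "(\<Sum>z\<in>C. scale (g z) z) \<in> N" using diffN[of x y] xy C by auto
      then have "g x = 0" using C0 xy by blast
      then show False by (simp add: g_def)
    qed
  qed
  have "finite_basis Q (\<Psi> ` C)"
    unfolding finite_basis_def
  proof (intro conjI allI impI ballI)
    show "finite (\<Psi> ` C)" using C by simp
    show "\<Psi> ` C \<subseteq> carrier Q" using C carrier by auto
  next
    fix c x assume c: "lin_comb Q (\<Psi> ` C) c = \<zero>\<^bsub>Q\<^esub>" and x: "x \<in> \<Psi> ` C"
    have "lin_comb Q (\<Psi> ` C) c = \<Psi> (\<Sum>x\<in>\<Psi> ` C. scale (c x) (inv_into C \<Psi> x))"
      using C inj by (intro comb) (auto simp: inv_into_f_f)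
    also have "(\<Sum>x\<in>\<Psi> ` C. scale (c x) (inv_into C \<Psi> x)) = (\<Sum>x\<in>C. scale (c (\<Psi> x)) x)"
      by (subst sum.reindex[OF inj]) (auto intro!: sum.cong simp: inv_into_f_f[OF inj])
    finally have "(\<Sum>x\<in>C. scale (c (\<Psi> x)) x) \<in> N"
      using c C by (auto simp: N_def intro!: subspace_sum[OF Z] subspace_scale[OF Z])
    then have "\<forall>x\<in>C. c (\<Psi> x) = 0" by (rule C0)
    then show "c x = 0" using x by auto
  next
    fix v assume "v \<in> carrier Q"
    then obtain u where u: "u \<in> Z" "v = \<Psi> u" using carrier by auto
    obtain h where h: "u = (\<Sum>x\<in>BZ. scale (h x) x)"
      using u(1) BZ(4) span_finite[OF finZ] by auto
    define w where "w = (\<Sum>x\<in>C. scale (h x) x)"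
    have wZ: "w \<in> Z" using C unfolding w_def by (intro subspace_sum[OF Z] subspace_scale[OF Z]) auto
    have uw: "u = w + (\<Sum>x\<in>BN. scale (h x) x)"
      using BZ(1) finZ sum.subset_diff[of BN BZ "\<lambda>x. scale (h x) x"] by (simp add: C_def h w_def)
    have "(\<Sum>x\<in>BN. scale (h x) x) \<in> N"
      using BN(1) by (intro subspace_sum[OF N] subspace_scale[OF N]) auto
    then have "\<Psi> u = \<Psi> w \<oplus>\<^bsub>Q\<^esub> \<zero>\<^bsub>Q\<^esub>" using uw add wZ by (auto simp: N_def)
    also have "\<dots> = \<Psi> w" using wZ carrier by simp
    also have "w = (\<Sum>x\<in>\<Psi> ` C. scale (h (inv_into C \<Psi> x)) (inv_into C \<Psi> x))"
      unfolding w_def by (subst sum.reindex[OF inj]) (auto intro!: sum.cong simp: inv_into_f_f[OF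
          inj])
    also have "\<Psi> \<dots> = lin_comb Q (\<Psi> ` C) (\<lambda>x. h (inv_into C \<Psi> x))"
      using C inj by (intro comb[symmetric]) (auto simp: inv_into_f_f)
    finally show "\<exists>c. v = lin_comb Q (\<Psi> ` C) c" using u by blast
  qed
  then have ex: "\<exists>B. finite_basis Q B" by blast
  have "card B = dim Z - dim N" if B: "finite_basis Q B" for B
  proof -
    have finB: "finite B" and BQ: "B \<subseteq> carrier Q"
      and B0: "\<And>c x. lin_comb Q B c = \<zero>\<^bsub>Q\<^esub> \<Longrightarrow> x \<in> B \<Longrightarrow> c x = 0"
      and Bsp: "\<And>v. v \<in> carrier Q \<Longrightarrow> \<exists>c. v = lin_comb Q B c"
      using B unfolding finite_basis_def by auto
    define p where "p = inv_into Z \<Psi>"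
    have p: "p x \<in> Z \<and> \<Psi> (p x) = x" if "x \<in> B" for x
      using that BQ carrier unfolding p_def by (metis f_inv_into_f inv_into_into subsetD)
    have injp: "inj_on p B" using p by (metis inj_onI)
    have pB: "p x \<notin> N" if "x \<in> B" for x
    proof
      assume "p x \<in> N"
      then have x0: "x = \<zero>\<^bsub>Q\<^esub>" using p[OF that] by (simp add: N_def)
      \<comment> \<open>If the lift of \<open>x\<close> were in the kernel, \<open>x\<close> would
        be the zero of \<open>Q\<close> and its indicator a nontrivial relation on
        \<open>B\<close>.\<close>
      define c :: "'c \<Rightarrow> 'a" where "c y = (if y = x then 1 else 0)" for y
      have "(\<Sum>y\<in>B. scale (c y) (p y)) = (\<Sum>y\<in>{x}. scale (c y) (p y))"
        using that finB by (intro sum.mono_neutral_right) (auto simp: c_def)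
      then have "lin_comb Q B c = \<zero>\<^bsub>Q\<^esub>"
        using comb[of B p c] finB p p[OF that] x0 by (simp add: c_def)
      then have "c x = 0" using B0 that by blast
      then show False by (simp add: c_def)
    qed
    have disj: "p ` B \<inter> BN = {}" using pB BN(1) by auto
    have "independent (p ` B \<union> BN)"
    proof (rule independent_if_scalars_zero)
      show "finite (p ` B \<union> BN)" using finB finN by simp
      fix f x assume f: "(\<Sum>x\<in>p ` B \<union> BN. scale (f x) x) = 0" and x: "x \<in> p ` B \<union> BN"
      have "(\<Sum>x\<in>B. scale (f (p x)) (p x)) + (\<Sum>x\<in>BN. scale (f x) x) = 0"
        using f disj finB finN by (simp add: sum.union_disjoint sum.reindex[OF injp])
      moreover have "(\<Sum>x\<in>BN. scale (f x) x) \<in> N"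
        using BN(1) by (intro subspace_sum[OF N] subspace_scale[OF N]) auto
      ultimately have "(\<Sum>x\<in>B. scale (f (p x)) (p x)) \<in> N"
        using subspace_neg[OF N] by (metis eq_neg_iff_add_eq_0)
      then have "lin_comb Q B (\<lambda>x. f (p x)) = \<zero>\<^bsub>Q\<^esub>"
        using comb[of B p "\<lambda>x. f (p x)"] finB p by (simp add: N_def)
      then have fB: "f (p y) = 0" if "y \<in> B" for y using B0 that by blast
      then have "(\<Sum>x\<in>BN. scale (f x) x) = 0"
        using \<open>(\<Sum>x\<in>B. scale (f (p x)) (p x)) + (\<Sum>x\<in>BN. scale (f x) x) = 0\<close> by simp
      then have "f y = 0" if "y \<in> BN" for y
        using BN(2) finN independent_explicit_finite_subsets[of BN] that by blast
      then show "f x = 0" using x fB by auto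
    qed
    moreover have "Z \<subseteq> span (p ` B \<union> BN)"
    proof
      fix u assume u: "u \<in> Z"
      then obtain c where "\<Psi> u = lin_comb Q B c" using Bsp carrier by blast
      then have "\<Psi> u = \<Psi> (\<Sum>x\<in>B. scale (c x) (p x))" using comb finB p by simp
      moreover have "(\<Sum>x\<in>B. scale (c x) (p x)) \<in> Z"
        using p by (intro subspace_sum[OF Z] subspace_scale[OF Z]) auto
      ultimately have "u - (\<Sum>x\<in>B. scale (c x) (p x)) \<in> span BN"
        using diffN[OF u] spanN by simp
      then have "u - (\<Sum>x\<in>B. scale (c x) (p x)) \<in> span (p ` B \<union> BN)"
        using span_mono[of BN "p ` B \<union> BN"] by auto
      moreover have "(\<Sum>x\<in>B. scale (c x) (p x)) \<in> span (p ` B \<union> BN)"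
        by (intro span_sum span_scale span_base) auto
      ultimately show "u \<in> span (p ` B \<union> BN)" using span_add by fastforce
    qed
    moreover have "p ` B \<union> BN \<subseteq> Z" using p BN(1) NZ by auto
    ultimately have "card (p ` B \<union> BN) = dim Z" by (intro basis_card_eq_dim)
    moreover have "card (p ` B \<union> BN) = card B + card BN"
      using disj finB finN by (simp add: card_Un_disjoint card_image[OF injp])
    ultimately show ?thesis using BN(4) by simp
  qed
  then have "card (SOME B. finite_basis Q B) = dim Z - dim N"
    using ex by (metis someI_ex)
  then show ?thesis using ex by (simp add: vs_dim_def N_def)
qed

end


section \<open>Functions supported on a finite set, and ranks of matrices\<close>

definition fscale :: "'k::field \<Rightarrow> ('x \<Rightarrow> 'k) \<Rightarrow> 'x \<Rightarrow> 'k" where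
  "fscale a f = (\<lambda>x. a * f x)"

lemma fscale_apply [simp]: "fscale a f x = a * f x"
  by (simp add: fscale_def)

interpretation fv: vector_space fscale
  by unfold_locales (auto simp: fscale_def fun_eq_iff algebra_simps)

text \<open>The coordinate space on \<open>S\<close>, kept inside the type of all functions so that
  one interpretation of \<open>vector_space\<close> serves every index set.\<close>

definition supp_on :: "'x set \<Rightarrow> ('x \<Rightarrow> 'k::field) set" where
  "supp_on S = {f. \<forall>x. x \<notin> S \<longrightarrow> f x = 0}"

definition unit_fun :: "'x \<Rightarrow> 'x \<Rightarrow> 'k::field" where
  "unit_fun x = (\<lambda>y. if y = x then 1 else 0)"

text \<open>The value \<open>0\<close> off \<open>T\<close> puts images into
  \<open>supp_on T\<close> and lets the kernel be described by equality with the zero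
  function.\<close>

definition mat_op :: "'t set \<Rightarrow> ('t \<Rightarrow> 's \<Rightarrow> 'k::field) \<Rightarrow> 's set \<Rightarrow> ('s \<Rightarrow> 'k) \<Rightarrow> 't \<Rightarrow> 'k" where
  "mat_op T A S f = (\<lambda>t. if t \<in> T then \<Sum>s\<in>S. A t s * f s else 0)"

lemma sum_fun_apply: "(\<Sum>x\<in>A. f x) y = (\<Sum>x\<in>A. f x y)"
  by (induction A rule: infinite_finite_induct) auto

lemma subspace_supp_on: "fv.subspace (supp_on S)"
  by (auto simp: supp_on_def intro!: fv.subspaceI)

lemma supp_on_subset_span:
  assumes "finite S"
  shows "supp_on S \<subseteq> fv.span (unit_fun ` S)"
proof
  fix f :: "'a \<Rightarrow> 'b" assume f: "f \<in> supp_on S"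
  have "f = (\<Sum>x\<in>S. fscale (f x) (unit_fun x))"
    using f assms
    by (auto simp: fun_eq_iff sum_fun_apply unit_fun_def supp_on_def if_distrib cong: if_cong)
  also have "\<dots> \<in> fv.span (unit_fun ` S)"
    by (intro fv.span_sum fv.span_scale fv.span_base) auto
  finally show "f \<in> fv.span (unit_fun ` S)" .
qed

lemma dim_supp_on:
  assumes "finite S"
  shows "fv.dim (supp_on S :: ('x \<Rightarrow> 'k::field) set) = card S"
proof -
  have inj: "inj_on (unit_fun :: 'x \<Rightarrow> 'x \<Rightarrow> 'k) S"
    by (auto simp: inj_on_def unit_fun_def fun_eq_iff split: if_splits)
  have "fv.independent (unit_fun ` S :: ('x \<Rightarrow> 'k) set)"
  proof (rule fv.independent_if_scalars_zero)
    show "finite (unit_fun ` S :: ('x \<Rightarrow> 'k) set)" using assms by simp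
    fix g :: "('x \<Rightarrow> 'k) \<Rightarrow> 'k" and u :: "'x \<Rightarrow> 'k"
    assume g: "(\<Sum>v\<in>unit_fun ` S. fscale (g v) v) = 0" and u: "u \<in> unit_fun ` S"
    obtain x where x: "x \<in> S" "u = unit_fun x" using u by auto
    have "(\<Sum>v\<in>unit_fun ` S. fscale (g v) v) x = (\<Sum>v\<in>unit_fun ` S. g v * v x)"
      by (simp add: sum_fun_apply)
    also have "\<dots> = (\<Sum>y\<in>S. g (unit_fun y) * unit_fun y x)"
      by (subst sum.reindex[OF inj]) simp
    also have "\<dots> = (\<Sum>y\<in>S. if y = x then g u else 0)"
      using x by (intro sum.cong) (auto simp: unit_fun_def)
    finally show "g u = 0" using g x assms by simp
  qed
  moreover have "unit_fun ` S \<subseteq> (supp_on S :: ('x \<Rightarrow> 'k) set)"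
    by (auto simp: unit_fun_def supp_on_def)
  ultimately have "card (unit_fun ` S :: ('x \<Rightarrow> 'k) set) = fv.dim (supp_on S :: ('x \<Rightarrow> 'k) set)"
    using supp_on_subset_span[OF assms] by (intro fv.basis_card_eq_dim)
  then show ?thesis using card_image[OF inj] by simp
qed

lemma dim_zero_fun: "fv.dim {0} = 0"
  using fv.dim_span_eq_card_independent[of "{}"] fv.independent_empty by simp

lemma dim_le_card_supp_on:
  assumes "finite S" "Z \<subseteq> supp_on S"
  shows "fv.dim Z \<le> card S"
proof -
  have "fv.dim Z \<le> card (unit_fun ` S :: ('a \<Rightarrow> 'b) set)"
    using assms supp_on_subset_span by (intro fv.dim_le_card) blast+
  also have "\<dots> \<le> card S" using assms card_image_le by blast
  finally show ?thesis .
qed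

lemma mat_op_supp_on: "mat_op T A S f \<in> supp_on T"
  by (simp add: mat_op_def supp_on_def)

lemma mat_op_add: "mat_op T A S (f + g) = mat_op T A S f + mat_op T A S g"
  by (auto simp: mat_op_def fun_eq_iff algebra_simps sum.distrib)

lemma mat_op_scale: "mat_op T A S (fscale a f) = fscale a (mat_op T A S f)"
  by (auto simp: mat_op_def fun_eq_iff sum_distrib_left mult.left_commute)

lemma mat_op_zero [simp]: "mat_op T A S 0 = 0"
  by (auto simp: mat_op_def fun_eq_iff)

lemma subspace_mat_op_image: "fv.subspace (mat_op T A S ` supp_on R)"
proof (rule fv.subspaceI)
  show "0 \<in> mat_op T A S ` supp_on R"
    using fv.subspace_0[OF subspace_supp_on] by (auto intro!: image_eqI[of _ _ 0])
  show "x + y \<in> mat_op T A S ` supp_on R"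
    if "x \<in> mat_op T A S ` supp_on R" "y \<in> mat_op T A S ` supp_on R" for x y
    using that fv.subspace_add[OF subspace_supp_on] mat_op_add[symmetric] by fast
  show "fscale c x \<in> mat_op T A S ` supp_on R" if "x \<in> mat_op T A S ` supp_on R" for c x
    using that fv.subspace_scale[OF subspace_supp_on] mat_op_scale[symmetric] by fast
qed

lemma subspace_mat_op_kernel: "fv.subspace {f \<in> supp_on R. mat_op T A S f = 0}"
  using fv.subspace_0[OF subspace_supp_on] fv.subspace_add[OF subspace_supp_on]
    fv.subspace_scale[OF subspace_supp_on]
  by (intro fv.subspaceI) (auto simp: mat_op_add mat_op_scale fv.scale_zero_right)

text \<open>The image is measured twice by \<open>vs_dim_image\<close>: as an image of
  \<open>supp_on S\<close>, and through the identity, whose kernel is trivial.\<close>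

lemma dim_mat_op_kernel:
  fixes A :: "'t \<Rightarrow> 's \<Rightarrow> 'k::field"
  assumes "finite S" "finite T"
  shows "fv.dim {f \<in> supp_on S. mat_op T A S f = 0} = card S - fv.dim (mat_op T A S ` supp_on S)"
proof -
  define Q :: "('k, 't \<Rightarrow> 'k) module" where
    "Q = \<lparr>carrier = mat_op T A S ` supp_on S, mult = undefined, one = undefined, zero = 0,
      add = (+), smult = fscale\<rparr>"
  have [simp]: "carrier Q = mat_op T A S ` supp_on S" "\<zero>\<^bsub>Q\<^esub> = 0" "add Q = (+)" "smult Q = fscale"
    by (simp_all add: Q_def)
  have "vs_dim Q = enat (fv.dim (supp_on S :: ('s \<Rightarrow> 'k) set) -
      fv.dim {f \<in> supp_on S. mat_op T A S f = \<zero>\<^bsub>Q\<^esub>})"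
    by (rule fv.vs_dim_image[OF subspace_supp_on _ supp_on_subset_span[OF assms(1)]])
      (use assms(1) in \<open>auto simp: mat_op_add mat_op_scale\<close>)
  moreover have "vs_dim Q = enat (fv.dim (mat_op T A S ` supp_on S) -
      fv.dim {f \<in> mat_op T A S ` supp_on S. id f = \<zero>\<^bsub>Q\<^esub>})"
  proof (rule fv.vs_dim_image[OF subspace_mat_op_image])
    show "finite (unit_fun ` T :: ('t \<Rightarrow> 'k) set)" using assms by simp
    show "mat_op T A S ` supp_on S \<subseteq> fv.span (unit_fun ` T)"
      using supp_on_subset_span[OF assms(2)] mat_op_supp_on by fastforce
  qed auto
  moreover have "{f \<in> mat_op T A S ` supp_on S. id f = 0} = {0}"
    using fv.subspace_0[OF subspace_mat_op_image] by auto
  ultimately have "fv.dim (mat_op T A S ` supp_on S) =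
      card S - fv.dim {f \<in> supp_on S. mat_op T A S f = 0}"
    using assms by (simp add: dim_supp_on dim_zero_fun)
  \<comment> \<open>Subtraction of naturals truncates, so solving for the dimension of the kernel
    needs this bound.\<close>
  moreover have "fv.dim {f \<in> supp_on S. mat_op T A S f = 0} \<le> card S"
    using assms(1) by (intro dim_le_card_supp_on) auto
  ultimately show ?thesis by simp
qed

text \<open>
  Writing the rows of \<open>A\<close> in terms of a basis of the row space factors \<open>A\<close> through a space of
  dimension the row rank.
\<close>
lemma rank_transpose_le:
  assumes "finite S" "finite T"
  shows "fv.dim (mat_op T A S ` supp_on S) \<le> fv.dim (mat_op S (\<lambda>s t. A t s) T ` supp_on T)"
proof -
  let ?U = "mat_op S (\<lambda>s t. A t s) T ` supp_on T"
  obtain B where B: "B \<subseteq> ?U" "fv.independent B" "?U \<subseteq> fv.span B" "card B = fv.dim ?U"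
    using fv.basis_exists by blast
  have "B \<subseteq> fv.span (unit_fun ` S)"
    using B(1) supp_on_subset_span[OF assms(1)] mat_op_supp_on by fastforce
  then have finB: "finite B" using fv.independent_span_bound[OF _ B(2)] assms by blast
  define row where "row t = (\<lambda>s. if s \<in> S then A t s else 0)" for t
  have "row t \<in> fv.span B" if "t \<in> T" for t
  proof -
    \<comment> \<open>Row \<open>t\<close> is the transposed matrix applied to the unit vector at
      \<open>t\<close>.\<close>
    have "row t = mat_op S (\<lambda>s t. A t s) T (unit_fun t)"
      using that assms by (auto simp: row_def mat_op_def unit_fun_def fun_eq_iff if_distrib cong:
          if_cong)
    moreover have "unit_fun t \<in> supp_on T" using that by (auto simp: unit_fun_def supp_on_def)
    ultimately show ?thesis using B(3) by blast
  qed
  then have "\<forall>t\<in>T. \<exists>c. row t = (\<Sum>b\<in>B. fscale (c b) b)"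
    using fv.span_finite[OF finB] by (simp add: image_iff)
  then obtain c where c: "\<And>t. t \<in> T \<Longrightarrow> row t = (\<Sum>b\<in>B. fscale (c t b) b)" by metis
  define col where "col b = (\<lambda>t. if t \<in> T then c t b else 0)" for b
  have "mat_op T A S f \<in> fv.span (col ` B)" for f
  proof -
    \<comment> \<open>The coefficient of \<open>col b\<close> is the pairing of \<open>f\<close>
      with the basis vector \<open>b\<close> of the row space.\<close>
    have "mat_op T A S f = (\<Sum>b\<in>B. fscale (\<Sum>s\<in>S. b s * f s) (col b))"
    proof
      fix t
      show "mat_op T A S f t = (\<Sum>b\<in>B. fscale (\<Sum>s\<in>S. b s * f s) (col b)) t"
      proof (cases "t \<in> T")
        case True
        have "(\<Sum>s\<in>S. A t s * f s) = (\<Sum>s\<in>S. row t s * f s)"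
          by (intro sum.cong) (auto simp: row_def)
        also have "\<dots> = (\<Sum>s\<in>S. \<Sum>b\<in>B. c t b * b s * f s)"
          using c[OF True] by (simp add: sum_fun_apply sum_distrib_right)
        also have "\<dots> = (\<Sum>b\<in>B. \<Sum>s\<in>S. c t b * b s * f s)" by (rule sum.swap)
        also have "\<dots> = (\<Sum>b\<in>B. (\<Sum>s\<in>S. b s * f s) * c t b)"
          by (simp add: sum_distrib_left mult_ac)
        finally show ?thesis using True by (simp add: mat_op_def sum_fun_apply col_def)
      qed (simp add: mat_op_def sum_fun_apply col_def)
    qed
    also have "\<dots> \<in> fv.span (col ` B)"
      by (intro fv.span_sum fv.span_scale fv.span_base) auto
    finally show ?thesis .
  qed
  then have "fv.dim (mat_op T A S ` supp_on S) \<le> card (col ` B)"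
    using finB by (intro fv.dim_le_card) auto
  also have "\<dots> \<le> card B" using finB by (rule card_image_le)
  finally show ?thesis using B(4) by simp
qed

lemma rank_transpose:
  assumes "finite S" "finite T"
  shows "fv.dim (mat_op T A S ` supp_on S) = fv.dim (mat_op S (\<lambda>s t. A t s) T ` supp_on T)"
  using rank_transpose_le[OF assms, of A] rank_transpose_le[OF assms(2,1), of "\<lambda>s t. A t s"]
  by simp

text \<open>Both sides are \<open>card S\<close> minus the ranks of \<open>A\<close> and
  \<open>B\<close>, subtracted in opposite orders: a kernel has dimension \<open>card S\<close>
  minus the rank, and transposition preserves ranks.\<close>

lemma dim_cohomology_eq_homology:
  assumes "finite R" "finite S" "finite T"
  shows "fv.dim {f \<in> supp_on S. mat_op T A S f = 0} - fv.dim (mat_op S B R ` supp_on R) =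
    fv.dim {f \<in> supp_on S. mat_op R (\<lambda>r s. B s r) S f = 0} -
      fv.dim (mat_op S (\<lambda>s t. A t s) T ` supp_on T)"
  using assms rank_transpose[of S T A] rank_transpose[of R S B]
  by (simp add: dim_mat_op_kernel)

section \<open>Quotient modules and simplicial (co)homology\<close>

text \<open>Restricting the carrier to \<open>Z\<close> changes neither the addition nor the cosets
  of \<open>N\<close>, so the coset laws of the whole group \<open>G\<close> carry over.\<close>

lemma quot_module_add:
  fixes G :: "('r, 'a) module" (structure)
  assumes "abelian_group G" "additive_subgroup N G" "x \<in> carrier G" "y \<in> carrier G"
  shows "(N +> x) \<oplus>\<^bsub>quot_module (G\<lparr>carrier := Z\<rparr>) N\<^esub> (N +> y) = N +> (x \<oplus> y)"
proof -
  interpret abelian_subgroup N G using assms(2,1) by (rule abelian_subgroupI3)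
  show ?thesis using a_rcos_sum[OF assms(3,4)] by (simp add: quot_module_def set_add_def
      set_mult_def)
qed

lemma quot_module_coset_zero:
  fixes G :: "('r, 'a) module" (structure)
  assumes "abelian_group G" "additive_subgroup N G" "x \<in> carrier G"
  shows "N +> x = \<zero>\<^bsub>quot_module (G\<lparr>carrier := Z\<rparr>) N\<^esub> \<longleftrightarrow> x \<in> N"
proof -
  interpret abelian_subgroup N G using assms(2,1) by (rule abelian_subgroupI3)
  show ?thesis using a_rcos_self[OF assms(3)] a_rcos_const by (auto simp: quot_module_def)
qed

text \<open>The quotient scales a coset by uniting the cosets of all scaled members; as scaling by
  \<open>r\<close> is additive and preserves \<open>N\<close>, these cosets coincide.\<close>

lemma quot_module_smult:
  fixes G :: "('r, 'a) module" (structure)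
  assumes G: "abelian_group G" and N: "additive_subgroup N G" and x: "x \<in> carrier G"
    and closed: "\<And>y. y \<in> carrier G \<Longrightarrow> r \<odot>\<^bsub>G\<^esub> y \<in> carrier G" "\<And>y. y \<in> N \<Longrightarrow> r \<odot>\<^bsub>G\<^esub> y \<in> N"
    and distr: "\<And>y z. y \<in> carrier G \<Longrightarrow> z \<in> carrier G \<Longrightarrow>
      r \<odot>\<^bsub>G\<^esub> (y \<oplus> z) = r \<odot>\<^bsub>G\<^esub> y \<oplus> r \<odot>\<^bsub>G\<^esub> z"
  shows "r \<odot>\<^bsub>quot_module (G\<lparr>carrier := Z\<rparr>) N\<^esub> (N +> x) = N +> (r \<odot>\<^bsub>G\<^esub> x)"
proof -
  interpret abelian_subgroup N G using N G by (rule abelian_subgroupI3)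
  have "N +> (r \<odot>\<^bsub>G\<^esub> z) = N +> (r \<odot>\<^bsub>G\<^esub> x)" if "z \<in> N +> x" for z
  proof -
    obtain y where y: "y \<in> N" "z = y \<oplus> x" using \<open>z \<in> N +> x\<close> by (auto simp: a_r_coset_def')
    then have "r \<odot>\<^bsub>G\<^esub> z = r \<odot>\<^bsub>G\<^esub> y \<oplus> r \<odot>\<^bsub>G\<^esub> x" using distr x by simp
    then have "r \<odot>\<^bsub>G\<^esub> z \<in> N +> (r \<odot>\<^bsub>G\<^esub> x)" using closed(2)[OF y(1)] by (auto simp: a_r_coset_def')
    then show ?thesis using a_repr_independence'[OF _ closed(1)[OF x]] by simp
  qed
  then have "(\<Union>z\<in>N +> x. N +> (r \<odot>\<^bsub>G\<^esub> z)) = (\<Union>z\<in>N +> x. N +> (r \<odot>\<^bsub>G\<^esub> x))"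
    by (rule SUP_cong[OF refl])
  also have "\<dots> = N +> (r \<odot>\<^bsub>G\<^esub> x)" using a_rcos_self[OF x] by blast
  finally show ?thesis unfolding quot_module_def a_r_coset_def r_coset_def by simp
qed

lemma additive_subgroup_closedI:
  fixes G :: "('a, 'b) ring_scheme" (structure)
  assumes "abelian_group G" "N \<subseteq> carrier G" "N \<noteq> {}"
    and "\<And>x. x \<in> N \<Longrightarrow> \<ominus> x \<in> N" "\<And>x y. x \<in> N \<Longrightarrow> y \<in> N \<Longrightarrow> x \<oplus> y \<in> N"
  shows "additive_subgroup N G"
proof -
  interpret group "add_monoid G" using assms(1) by (rule abelian_group.a_group)
  show ?thesis
    using assms by (intro additive_subgroup.intro subgroupI) (auto simp: a_inv_def)
qed

lemma carrier_quot_module: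
  "carrier (quot_module (G\<lparr>carrier := Z\<rparr>) N) = (\<lambda>x. N +>\<^bsub>G\<^esub> x) ` Z"
  by (auto simp: quot_module_def A_RCOSETS_def RCOSETS_def a_r_coset_def r_coset_def)

section \<open>Incidence signs\<close>

definition sgn_at :: "'v::linorder set \<Rightarrow> 'v \<Rightarrow> 'k::field" where
  "sgn_at s v = (- 1) ^ card {u \<in> s. u < v}"

text \<open>The entry of the boundary matrix at \<open>s\<close> and \<open>t\<close>. At most one
  summand is nonzero, since \<open>s - {v}\<close> determines \<open>v\<close>; the form as a sum
  allows exchanging summations and yields \<open>0\<close> when \<open>t\<close> is not a facet of
  \<open>s\<close>.\<close>

definition incidence :: "'v::linorder set \<Rightarrow> 'v set \<Rightarrow> 'k::field" where
  "incidence s t = (\<Sum>v\<in>s. if s - {v} = t then sgn_at s v else 0)"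

text \<open>Indexed by cardinality, which is one more than the dimension: the empty face has index
  \<open>0\<close>, and chains of degree \<open>k\<close> live on index \<open>k + 1\<close>.
  Negative indices give no faces.\<close>

definition faces :: "'v set set \<Rightarrow> int \<Rightarrow> 'v set set" where
  "faces \<Gamma> c = {s \<in> \<Gamma>. int (card s) = c}"

lemma sgn_at_square: "sgn_at s v * sgn_at s v = 1"
  by (simp add: sgn_at_def flip: power_add)

lemma sgn_at_remove:
  assumes "finite s" "v \<in> s"
  shows "sgn_at (s - {v}) w = (if v < w then - sgn_at s w else sgn_at s w)"
proof (cases "v < w")
  case True
  then have "{u \<in> s. u < w} = insert v {u \<in> s - {v}. u < w}" using assms by auto
  then have "card {u \<in> s. u < w} = Suc (card {u \<in> s - {v}. u < w})" using assms by simp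
  then show ?thesis using True by (simp add: sgn_at_def)
next
  case False
  then have "{u \<in> s - {v}. u < w} = {u \<in> s. u < w}" by auto
  then show ?thesis using False by (simp add: sgn_at_def)
qed

text \<open>Deleting the smaller vertex first flips the sign of the larger one; in the other order
  nothing changes.\<close>

lemma sgn_at_swap:
  assumes "finite s" "v \<in> s" "w \<in> s" "v \<noteq> w"
  shows "sgn_at s v * sgn_at (s - {v}) w = - (sgn_at s w * sgn_at (s - {w}) v)"
  using assms by (auto simp: sgn_at_remove)

text \<open>The terms at \<open>(v, w)\<close> and \<open>(w, v)\<close> cancel in pairs. Splitting
  the sum by the order makes this valid in characteristic two, where a sum equal to its negative
  need not vanish.\<close>

lemma sum_antisymmetric:
  fixes F :: "'v::linorder \<Rightarrow> 'v \<Rightarrow> 'k::ab_group_add"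
  assumes "finite s" "\<And>v w. v \<in> s \<Longrightarrow> w \<in> s \<Longrightarrow> v \<noteq> w \<Longrightarrow> F v w = - F w v"
  shows "(\<Sum>v\<in>s. \<Sum>w\<in>s - {v}. F v w) = 0"
proof -
  have "(\<Sum>v\<in>s. \<Sum>w\<in>s. if w < v then F v w else 0) = (\<Sum>w\<in>s. \<Sum>v\<in>s. if w < v then F v w else 0)"
    by (rule sum.swap)
  also have "\<dots> = (\<Sum>w\<in>s. \<Sum>v\<in>s. - (if w < v then F w v else 0))"
  proof (intro sum.cong refl)
    fix v w assume "v \<in> s" "w \<in> s"
    then show "(if w < v then F v w else 0) = - (if w < v then F w v else 0)"
      using assms(2)[of v w] by (cases "w < v") auto
  qed
  finally have swap: "(\<Sum>v\<in>s. \<Sum>w\<in>s. if w < v then F v w else 0) =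
      (\<Sum>w\<in>s. \<Sum>v\<in>s. - (if w < v then F w v else 0))" .
  have "(\<Sum>v\<in>s. \<Sum>w\<in>s - {v}. F v w) =
    (\<Sum>v\<in>s. (\<Sum>w\<in>s. if v < w then F v w else 0) + (\<Sum>w\<in>s. if w < v then F v w else 0))"
  proof (rule sum.cong)
    fix v assume "v \<in> s"
    have "(\<Sum>w\<in>s - {v}. F v w) = (\<Sum>w\<in>s - {v}. (if v < w then F v w else 0) + (if w < v then F v w
        else 0))"
      by (intro sum.cong) auto
    also have "\<dots> = (\<Sum>w\<in>s. (if v < w then F v w else 0) + (if w < v then F v w else 0))"
      using assms(1) by (intro sum.mono_neutral_left) auto
    finally show "(\<Sum>w\<in>s - {v}. F v w) =
        (\<Sum>w\<in>s. if v < w then F v w else 0) + (\<Sum>w\<in>s. if w < v then F v w else 0)"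
      by (simp add: sum.distrib)
  qed simp
  also have "\<dots> = (\<Sum>v\<in>s. \<Sum>w\<in>s. if v < w then F v w else 0) +
      (\<Sum>v\<in>s. \<Sum>w\<in>s. if w < v then F v w else 0)"
    by (rule sum.distrib)
  also have "\<dots> = 0" by (simp add: swap sum_negf)
  finally show ?thesis .
qed

section \<open>Cohomology and homology of a finite simplicial complex\<close>

locale finite_complex =
  fixes \<Gamma> :: "'v::linorder set set"
  assumes finite_complex: "finite \<Gamma>" and finite_face: "\<And>s. s \<in> \<Gamma> \<Longrightarrow> finite s"
    and remove_face: "\<And>s v. s \<in> \<Gamma> \<Longrightarrow> s - {v} \<in> \<Gamma>"
begin

lemma finite_faces: "finite (faces \<Gamma> c)"
  using finite_complex by (simp add: faces_def)

lemma remove_faces: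
  assumes "s \<in> faces \<Gamma> (c + 1)" "v \<in> s"
  shows "s - {v} \<in> faces \<Gamma> c"
proof -
  have "s \<in> \<Gamma>" "finite s" "int (card s) = c + 1" using assms finite_face by (auto simp: faces_def)
  moreover from this have "card s = Suc (card (s - {v}))" using assms(2) by (intro card.remove)
  then have "int (card (s - {v})) = c" using \<open>int (card s) = c + 1\<close> by linarith
  ultimately show ?thesis using remove_face unfolding faces_def by blast
qed

abbreviation cobd :: "int \<Rightarrow> ('v set \<Rightarrow> 'k::field) \<Rightarrow> 'v set \<Rightarrow> 'k" where
  "cobd c \<equiv> mat_op (faces \<Gamma> (c + 1)) incidence (faces \<Gamma> c)"

abbreviation bd :: "int \<Rightarrow> ('v set \<Rightarrow> 'k::field) \<Rightarrow> 'v set \<Rightarrow> 'k" where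
  "bd c \<equiv> mat_op (faces \<Gamma> c) (\<lambda>t s. incidence s t) (faces \<Gamma> (c + 1))"

lemma cobd_apply:
  assumes "s \<in> faces \<Gamma> (c + 1)"
  shows "cobd c f s = (\<Sum>v\<in>s. sgn_at s v * f (s - {v}))"
proof -
  have "cobd c f s = (\<Sum>t\<in>faces \<Gamma> c. \<Sum>v\<in>s. if s - {v} = t then sgn_at s v * f t else 0)"
    using assms by (simp add: mat_op_def incidence_def sum_distrib_right if_distrib[of "\<lambda>x. x * _"]
      cong: if_cong)
  also have "\<dots> = (\<Sum>v\<in>s. \<Sum>t\<in>faces \<Gamma> c. if s - {v} = t then sgn_at s v * f t else 0)"
    by (rule sum.swap)
  also have "\<dots> = (\<Sum>v\<in>s. sgn_at s v * f (s - {v}))"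
  proof (rule sum.cong)
    fix v assume "v \<in> s"
    then show "(\<Sum>t\<in>faces \<Gamma> c. if s - {v} = t then sgn_at s v * f t else 0) =
        sgn_at s v * f (s - {v})"
      using remove_faces[OF assms] finite_faces by (simp add: sum.delta')
  qed simp
  finally show ?thesis .
qed

text \<open>Each way of reaching \<open>r\<close> from \<open>s\<close> by deleting two vertices
  occurs in both orders with opposite signs. The form with matrix entries serves
  \<open>cobd_cobd\<close> and its transpose \<open>bd_bd\<close> alike.\<close>

lemma incidence_inc:
  assumes "s \<in> faces \<Gamma> (c + 1 + 1)"
  shows "(\<Sum>t\<in>faces \<Gamma> (c + 1). incidence s t * incidence t r) = (0::'k::field)"
proof -
  have fin: "finite s" using finite_face assms unfolding faces_def by blast
  \<comment> \<open>For fixed \<open>r\<close> the sum over \<open>t\<close> is the coboundary of a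
    column, which \<open>cobd_apply\<close> expands over the vertices of \<open>s\<close>.\<close>
  have "(\<Sum>t\<in>faces \<Gamma> (c + 1). incidence s t * incidence t r) =
      cobd (c + 1) (\<lambda>t. incidence t r) s" using assms by (simp add: mat_op_def)
  also have "\<dots> = (\<Sum>v\<in>s. \<Sum>w\<in>s - {v}.
      if s - {v} - {w} = r then sgn_at s v * sgn_at (s - {v}) w else 0)"
    unfolding cobd_apply[OF assms] incidence_def sum_distrib_left by (intro sum.cong refl) simp
  also have "\<dots> = (0::'k)"
  proof (rule sum_antisymmetric[OF fin])
    fix v w assume "v \<in> s" "w \<in> s" "v \<noteq> w"
    then have "sgn_at s v * sgn_at (s - {v}) w = - (sgn_at s w * sgn_at (s - {w}) v :: 'k)"
      by (rule sgn_at_swap[OF fin])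
    moreover have "s - {v} - {w} = s - {w} - {v}" by blast
    ultimately show "(if s - {v} - {w} = r then sgn_at s v * sgn_at (s - {v}) w else 0) =
        - (if s - {w} - {v} = r then sgn_at s w * sgn_at (s - {w}) v else (0::'k))"
      by (simp only: if_distrib[of uminus] neg_0_equal_iff_equal minus_zero)
  qed
  finally show ?thesis .
qed

lemma cobd_cobd: "cobd (c + 1) (cobd c f) = 0"
proof
  fix s
  show "cobd (c + 1) (cobd c f) s = 0 s"
  proof (cases "s \<in> faces \<Gamma> (c + 1 + 1)")
    case True
    have "cobd (c + 1) (cobd c f) s =
        (\<Sum>t\<in>faces \<Gamma> (c + 1). \<Sum>r\<in>faces \<Gamma> c. incidence s t * incidence t r * f r)"
      using True by (auto simp: mat_op_def sum_distrib_left mult.assoc intro!: sum.cong)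
    also have "\<dots> = (\<Sum>r\<in>faces \<Gamma> c. (\<Sum>t\<in>faces \<Gamma> (c + 1). incidence s t * incidence t r) * f r)"
      by (subst sum.swap) (simp add: sum_distrib_right)
    also have "\<dots> = 0" by (simp only: incidence_inc[OF True] mult_zero_left sum.neutral_const)
    finally show ?thesis by simp
  qed (simp add: mat_op_def)
qed

lemma bd_bd: "bd c (bd (c + 1) f) = 0"
proof
  fix r
  show "bd c (bd (c + 1) f) r = 0 r"
  proof (cases "r \<in> faces \<Gamma> c")
    case True
    have "bd c (bd (c + 1) f) r =
        (\<Sum>t\<in>faces \<Gamma> (c + 1). \<Sum>s\<in>faces \<Gamma> (c + 1 + 1). incidence s t * incidence t r * f s)"
      using True by (auto simp: mat_op_def sum_distrib_left mult_ac intro!: sum.cong)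
    also have "\<dots> = (\<Sum>s\<in>faces \<Gamma> (c + 1 + 1). (\<Sum>t\<in>faces \<Gamma> (c + 1). incidence s t * incidence t r) *
        f s)"
      by (subst sum.swap) (simp add: sum_distrib_right)
    also have "\<dots> = 0" by (intro sum.neutral ballI) (simp only: incidence_inc mult_zero_left)
    finally show ?thesis by simp
  qed (simp add: mat_op_def)
qed

text \<open>The dimension of reduced cohomology in simplicial degree \<open>c\<close>; the cocycles
  live on faces with \<open>c + 1\<close> vertices.\<close>

definition coh_dim :: "'k::field itself \<Rightarrow> int \<Rightarrow> nat" where
  "coh_dim _ c = fv.dim {f \<in> supp_on (faces \<Gamma> (c + 1)). cobd (c + 1) f = (0 :: 'v set \<Rightarrow> 'k)} -
     fv.dim (cobd c ` (supp_on (faces \<Gamma> c) :: ('v set \<Rightarrow> 'k) set))"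

text \<open>Joining with the apex \<open>w\<close> is a contracting homotopy: a cocycle
  \<open>f\<close> is the coboundary of the cochain that evaluates \<open>f\<close>, up to sign,
  after adding \<open>w\<close>. The void complex satisfies the condition vacuously.\<close>

lemma coh_dim_cone:
  assumes "\<And>s. s \<in> \<Gamma> \<Longrightarrow> insert w s \<in> \<Gamma>"
  shows "coh_dim TYPE('k::field) c = 0"
proof -
  have "{f \<in> supp_on (faces \<Gamma> (c + 1)). cobd (c + 1) f = (0 :: 'v set \<Rightarrow> 'k)} \<subseteq>
      cobd c ` (supp_on (faces \<Gamma> c) :: ('v set \<Rightarrow> 'k) set)"
  proof safe
    fix f :: "'v set \<Rightarrow> 'k"
    assume f: "f \<in> supp_on (faces \<Gamma> (c + 1))" "cobd (c + 1) f = 0"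
    define h where "h t = (if w \<in> t \<or> t \<notin> faces \<Gamma> c then 0 else sgn_at (insert w t) w * f (insert
        w t))" for t
    have "cobd c h s = f s" for s
    proof (cases "s \<in> faces \<Gamma> (c + 1)")
      case False
      then show ?thesis using f(1) by (simp add: mat_op_def supp_on_def)
    next
      case True
      have fin: "finite s" using finite_face True unfolding faces_def by blast
      show ?thesis
      proof (cases "w \<in> s")
        case w: True
        \<comment> \<open>Only the deletion of \<open>w\<close> leaves a face without
          \<open>w\<close>, so one summand survives, and its two equal signs cancel.\<close>
        have "cobd c h s = (\<Sum>v\<in>s. if v = w then f s else 0)"
          unfolding cobd_apply[OF True] using remove_faces[OF True] w
          by (intro sum.cong) (auto simp: h_def insert_absorb sgn_at_square simp flip: mult.assoc)
        then show ?thesis using w fin by simp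
      next
        case w: False
        define S where "S = insert w s"
        have S: "s = S - {w}" "finite S" "w \<in> S" using w fin by (auto simp: S_def)
        have SF: "S \<in> faces \<Gamma> (c + 1 + 1)"
          using True assms fin w by (auto simp: S_def faces_def)
        \<comment> \<open>The cocycle condition at the face enlarged by \<open>w\<close> expresses
          \<open>f s\<close> through faces that contain \<open>w\<close>, on which \<open>h\<close>
          draws.\<close>
        have "0 = cobd (c + 1) f S" using f(2) by simp
        also have "\<dots> = sgn_at S w * f s + (\<Sum>v\<in>s. sgn_at S v * f (S - {v}))"
          unfolding cobd_apply[OF SF] using S by (simp add: sum.remove[of S w])
        finally have eq: "(\<Sum>v\<in>s. sgn_at S v * f (S - {v})) = - (sgn_at S w * f s)"
          by (simp add: eq_neg_iff_add_eq_0 add.commute)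
        have "cobd c h s = (\<Sum>v\<in>s. - sgn_at S w * (sgn_at S v * f (S - {v})))"
          unfolding cobd_apply[OF True]
        proof (rule sum.cong)
          fix v assume v: "v \<in> s"
          have vw: "insert w (s - {v}) = S - {v}" "v \<in> S" "v \<noteq> w" using v w S by auto
          have "sgn_at s v * h (s - {v}) = sgn_at (S - {w}) v * sgn_at (S - {v}) w * f (S - {v})"
            using remove_faces[OF True v] w vw S(1) by (simp add: h_def)
          \<comment> \<open>Of the two signs exactly one changes when the other vertex is deleted,
            namely that of the larger vertex.\<close>
          also have "sgn_at (S - {w}) v * sgn_at (S - {v}) w = - sgn_at S w * (sgn_at S v :: 'k)"
            using vw(3) by (cases v w rule: linorder_cases)
              (auto simp: sgn_at_remove[OF S(2,3)] sgn_at_remove[OF S(2) vw(2)] mult.commute)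
          finally show "sgn_at s v * h (s - {v}) = - sgn_at S w * (sgn_at S v * f (S - {v}))"
            by (simp add: mult.assoc)
        qed simp
        also have "\<dots> = - sgn_at S w * (\<Sum>v\<in>s. sgn_at S v * f (S - {v}))"
          by (rule sum_distrib_left[symmetric])
        also have "\<dots> = f s" unfolding eq by (simp add: sgn_at_square flip: mult.assoc)
        finally show ?thesis .
      qed
    qed
    then have "cobd c h = f" by auto
    moreover have "h \<in> supp_on (faces \<Gamma> c)" by (simp add: h_def supp_on_def)
    ultimately show "f \<in> cobd c ` supp_on (faces \<Gamma> c)" by blast
  qed
  moreover have "cobd c ` (supp_on (faces \<Gamma> c) :: ('v set \<Rightarrow> 'k) set) \<subseteq>
      {f \<in> supp_on (faces \<Gamma> (c + 1)). cobd (c + 1) f = 0}"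
    by (rule image_subsetI, rule CollectI, rule conjI[OF mat_op_supp_on cobd_cobd])
  ultimately have "{f \<in> supp_on (faces \<Gamma> (c + 1)). cobd (c + 1) f = (0 :: 'v set \<Rightarrow> 'k)} =
      cobd c ` supp_on (faces \<Gamma> c)"
    by (rule subset_antisym)
  then show ?thesis by (simp only: coh_dim_def diff_self_eq_0)
qed

text \<open>\<open>lookup\<close> identifies chains with functions supported on a finite set of
  faces and \<open>boundary\<close> with \<open>bd\<close>. This gives the dimension of homology
  through the matrices of \<open>bd\<close>, which are the transposes of those in
  \<open>coh_dim\<close>.\<close>

lemma vs_dim_reduced_homology:
  "vs_dim (reduced_homology TYPE('k::field) \<Gamma> c) = enat (coh_dim TYPE('k) c)"
proof -
  let ?C = "\<lambda>c. chains TYPE('k) \<Gamma> c"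
  define S where "S = faces \<Gamma> (c + 1)"
  define T where "T = faces \<Gamma> (c + 1 + 1)"
  define Z :: "('v set \<Rightarrow> 'k) set" where "Z = {f \<in> supp_on S. bd c f = 0}"
  define N where "N = boundary ` carrier (?C (c + 1))"
  define P :: "('v set \<Rightarrow> 'k) \<Rightarrow> ('v set \<Rightarrow>\<^sub>0 'k)" where "P f = Abs_poly_mapping f" for f
  have finS: "finite S" "finite T" using finite_faces by (auto simp: S_def T_def)
  have P: "Poly_Mapping.lookup (P f) = f" if "f \<in> supp_on S \<or> f \<in> supp_on T" for f
  proof -
    have "{x. f x \<noteq> 0} \<subseteq> S \<union> T" using that by (auto simp: supp_on_def)
    then have "finite {x. f x \<noteq> 0}" using finS finite_subset by blast
    then have "f \<in> {f. finite {x. f x \<noteq> 0}}" by simp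
    then show ?thesis unfolding P_def by (rule Abs_poly_mapping_inverse)
  qed
  have carrier: "q \<in> carrier (?C k) \<longleftrightarrow> Poly_Mapping.lookup q \<in> supp_on (faces \<Gamma> (k + 1))" for q k
    using finite_face by (auto simp: chains_def supp_on_def faces_def in_keys_iff)
  have carrierS: "q \<in> carrier (?C c) \<longleftrightarrow> Poly_Mapping.lookup q \<in> supp_on S" 
    and carrierT: "q \<in> carrier (?C (c + 1)) \<longleftrightarrow> Poly_Mapping.lookup q \<in> supp_on T" for q
    using carrier by (simp_all add: S_def T_def)
  have boundary: "Poly_Mapping.lookup (boundary q) = bd k (Poly_Mapping.lookup q)" if "q \<in> carrier
      (?C k)" for q k
  proof
    fix t
    have q: "Poly_Mapping.lookup q \<in> supp_on (faces \<Gamma> (k + 1))" using that carrier by simp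
    then have keys: "Poly_Mapping.keys q \<subseteq> faces \<Gamma> (k + 1)" by (auto simp: supp_on_def in_keys_iff)
    have "Poly_Mapping.lookup (boundary q) t =
        (\<Sum>s\<in>Poly_Mapping.keys q. \<Sum>v\<in>s. if s - {v} = t then sgn_at s v * Poly_Mapping.lookup q s
            else 0)"
      by (simp add: boundary_def lookup_sum lookup_single sgn_at_def when_def cong: if_cong)
    also have "\<dots> = (\<Sum>s\<in>Poly_Mapping.keys q. incidence s t * Poly_Mapping.lookup q s)"
      by (auto simp: incidence_def sum_distrib_right intro!: sum.cong)
    also have "\<dots> = (\<Sum>s\<in>faces \<Gamma> (k + 1). incidence s t * Poly_Mapping.lookup q s)"
      using keys finite_faces by (intro sum.mono_neutral_left) (auto simp: in_keys_iff)
    also have "\<dots> = bd k (Poly_Mapping.lookup q) t"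
    proof (cases "t \<in> faces \<Gamma> k")
      case False
      \<comment> \<open>Off \<open>faces \<Gamma> k\<close> the operator \<open>bd\<close> is
        \<open>0\<close> by definition; the boundary agrees there because facets of faces are
        faces.\<close>
      then have "incidence s t = (0::'k)" if "s \<in> faces \<Gamma> (k + 1)" for s
        using remove_faces[OF that] by (auto simp: incidence_def intro!: sum.neutral)
      then show ?thesis using False by (simp add: mat_op_def)
    qed (simp add: mat_op_def)
    finally show "Poly_Mapping.lookup (boundary q) t = bd k (Poly_Mapping.lookup q) t" .
  qed
  have scale: "Poly_Mapping.lookup (a \<odot>\<^bsub>?C k\<^esub> q) = fscale a (Poly_Mapping.lookup q)" for a q k
    by (auto simp: chains_def fun_eq_iff map.rep_eq when_def)
  have add: "Poly_Mapping.lookup (q \<oplus>\<^bsub>?C k\<^esub> r) = Poly_Mapping.lookup q + Poly_Mapping.lookup r"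
      for q r k
    by (auto simp: chains_def fun_eq_iff lookup_add)
  have group: "abelian_group (?C k)" for k
  proof (rule abelian_groupI)
    fix x assume "x \<in> carrier (?C k)"
    then show "\<exists>y\<in>carrier (?C k). y \<oplus>\<^bsub>?C k\<^esub> x = \<zero>\<^bsub>?C k\<^esub>"
      by (intro bexI[of _ "- x"]) (auto simp: chains_def)
  next
    show "x \<oplus>\<^bsub>?C k\<^esub> y \<in> carrier (?C k)" if "x \<in> carrier (?C k)" "y \<in> carrier (?C k)" for x y
      using that fv.subspace_add[OF subspace_supp_on] by (simp add: carrier add)
  qed (auto simp: chains_def add.assoc add.commute)
  interpret C: abelian_group "?C c" by (rule group)
  define D :: "('v set \<Rightarrow> 'k) \<Rightarrow> 'v set \<Rightarrow> 'k" where "D = bd (c + 1)"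
  have D_eq: "D = mat_op S (\<lambda>t s. incidence s t) T" by (simp only: D_def S_def T_def)
  have boundaryT: "Poly_Mapping.lookup (boundary q) = D (Poly_Mapping.lookup q)"
    if "q \<in> carrier (?C (c + 1))" for q
    unfolding D_def by (rule boundary[OF that])
  have subspace_D: "fv.subspace (D ` supp_on T)" unfolding D_eq by (rule subspace_mat_op_image)
  have bd_D: "bd c (D f) = 0" for f unfolding D_def by (rule bd_bd)
  have lookup_N: "q \<in> N \<longleftrightarrow> Poly_Mapping.lookup q \<in> D ` supp_on T" for q
  proof
    assume "q \<in> N"
    then show "Poly_Mapping.lookup q \<in> D ` supp_on T" using boundaryT carrierT by (auto simp: N_def)
  next
    assume "Poly_Mapping.lookup q \<in> D ` supp_on T"
    then obtain g where g: "g \<in> supp_on T" "Poly_Mapping.lookup q = D g" by auto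
    then have "P g \<in> carrier (?C (c + 1))" using P carrierT by simp
    moreover from this have "boundary (P g) = q"
      using boundaryT g P by (intro poly_mapping_eqI) simp
    ultimately show "q \<in> N" by (auto simp: N_def)
  qed
  have bdT: "D f \<in> supp_on S" for f unfolding D_eq by (rule mat_op_supp_on)
  have lookup_minus: "Poly_Mapping.lookup (- q) = - Poly_Mapping.lookup q" for q :: "'v set \<Rightarrow>\<^sub>0
      'k" by (simp add: fun_eq_iff)
  have minus: "\<ominus>\<^bsub>?C c\<^esub> q = - q" if "q \<in> carrier (?C c)" for q
    using that by (intro C.minus_equality) (auto simp: chains_def)
  have sub: "additive_subgroup N (?C c)"
  proof (rule additive_subgroup_closedI[OF group])
    show "N \<subseteq> carrier (?C c)" using bdT by (auto simp: carrierS lookup_N)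
    have "0 \<in> N" using fv.subspace_0[OF subspace_D] 
      unfolding lookup_N by (simp add: T_def zero_fun_def lookup_zero[abs_def])
    then show "N \<noteq> {}" by blast
    show "\<ominus>\<^bsub>?C c\<^esub> q \<in> N" if "q \<in> N" for q
      using that bdT minus[of q] fv.subspace_neg[OF subspace_D]
      by (auto simp: lookup_N carrierS lookup_minus T_def)
    show "q \<oplus>\<^bsub>?C c\<^esub> r \<in> N" if "q \<in> N" "r \<in> N" for q r
      using that fv.subspace_add[OF subspace_D] by (auto simp: lookup_N add)
  qed
  define Zc where "Zc = {q \<in> carrier (?C c). boundary q = 0}"
  have PZ: "Zc = P ` Z"
  proof (intro equalityI subsetI)
    fix q assume "q \<in> Zc"
    then have "Poly_Mapping.lookup q \<in> Z" using boundary[of q c] carrierS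
      by (auto simp: Zc_def Z_def fun_eq_iff)
    then show "q \<in> P ` Z" using P by (intro image_eqI[of _ _ "Poly_Mapping.lookup q"]) (auto simp:
        P_def)
  next
    fix q assume "q \<in> P ` Z"
    then obtain f where f: "f \<in> Z" "q = P f" by auto
    then have "q \<in> carrier (?C c)" "Poly_Mapping.lookup q = f" using P carrierS by (auto simp:
        Z_def)
    then show "q \<in> Zc" using boundary[of q c] f by (auto simp: Zc_def Z_def intro!:
        poly_mapping_eqI)
  qed
  have Zcar: "P f \<in> carrier (?C c)" if "f \<in> supp_on S" for f using that P carrierS by auto
  define Q where "Q = quot_module ((?C c)\<lparr>carrier := Zc\<rparr>) N"
  have Q: "reduced_homology TYPE('k) \<Gamma> c = Q" by (simp add: reduced_homology_def Q_def Zc_def N_def)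
  let ?\<Psi> = "\<lambda>f. N +>\<^bsub>?C c\<^esub> P f"
  have \<Psi>0: "?\<Psi> f = \<zero>\<^bsub>Q\<^esub> \<longleftrightarrow> f \<in> D ` supp_on T" if "f \<in> supp_on S" for f
    unfolding Q_def quot_module_coset_zero[OF group sub Zcar[OF that]] lookup_N using P that by simp
  have ZS: "Z \<subseteq> supp_on S" by (auto simp: Z_def)
  have "vs_dim Q = enat (fv.dim Z - fv.dim {f \<in> Z. ?\<Psi> f = \<zero>\<^bsub>Q\<^esub>})"
  proof (rule fv.vs_dim_image)
    show "fv.subspace Z" unfolding Z_def by (rule subspace_mat_op_kernel)
    show "finite (unit_fun ` S :: ('v set \<Rightarrow> 'k) set)" using finS by simp
    show "Z \<subseteq> fv.span (unit_fun ` S)" using supp_on_subset_span[OF finS(1)] ZS by blast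
    show "carrier Q = ?\<Psi> ` Z" by (simp add: Q_def carrier_quot_module PZ image_image)
    show "?\<Psi> 0 = \<zero>\<^bsub>Q\<^esub>"
      using \<Psi>0[of 0] fv.subspace_0[OF subspace_D] fv.subspace_0[OF subspace_supp_on] by blast
    show "?\<Psi> (f + g) = ?\<Psi> f \<oplus>\<^bsub>Q\<^esub> ?\<Psi> g" if "f \<in> Z" "g \<in> Z" for f g
    proof -
      have "P (f + g) = P f \<oplus>\<^bsub>?C c\<^esub> P g"
        using P[of f] P[of g] P[of "f + g"] subsetD[OF ZS that(1)] subsetD[OF ZS that(2)]
          fv.subspace_add[OF subspace_supp_on[of S], of f g]
        by (intro poly_mapping_eqI) (simp add: add)
      then show ?thesis unfolding Q_def using that ZS Zcar by (subst quot_module_add[OF group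
          sub]) auto
    qed
    show "?\<Psi> (fscale a f) = a \<odot>\<^bsub>Q\<^esub> ?\<Psi> f" if "f \<in> Z" for a f
    proof -
      have "P (fscale a f) = a \<odot>\<^bsub>?C c\<^esub> P f"
        using P[of f] P[of "fscale a f"] subsetD[OF ZS that]
          fv.subspace_scale[OF subspace_supp_on[of S], of f a]
        by (intro poly_mapping_eqI) (simp add: scale)
      moreover have "a \<odot>\<^bsub>Q\<^esub> ?\<Psi> f = N +>\<^bsub>?C c\<^esub> (a \<odot>\<^bsub>?C c\<^esub> P f)"
        unfolding Q_def
      proof (rule quot_module_smult[OF group sub])
        show "P f \<in> carrier (?C c)" using that ZS Zcar by auto
        show "a \<odot>\<^bsub>?C c\<^esub> q \<in> carrier (?C c)" if "q \<in> carrier (?C c)" for q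
          using that fv.subspace_scale[OF subspace_supp_on] by (simp add: carrierS scale)
        show "a \<odot>\<^bsub>?C c\<^esub> q \<in> N" if "q \<in> N" for q
          using that fv.subspace_scale[OF subspace_D] by (simp add: lookup_N scale)
        show "a \<odot>\<^bsub>?C c\<^esub> (q \<oplus>\<^bsub>?C c\<^esub> r) = a \<odot>\<^bsub>?C c\<^esub> q \<oplus>\<^bsub>?C c\<^esub> a \<odot>\<^bsub>?C c\<^esub> r" for q r
          by (intro poly_mapping_eqI) (simp add: scale add fv.scale_right_distrib)
      qed
      ultimately show ?thesis by simp
    qed
  qed
  also have "{f \<in> Z. ?\<Psi> f = \<zero>\<^bsub>Q\<^esub>} = D ` supp_on T"
    using \<Psi>0 ZS bdT bd_D by (auto simp: Z_def)
  \<comment> \<open>Kernel and image of the boundary are traded for those of the coboundary, which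
    is where the field is used through ranks.\<close>
  also have "fv.dim Z - fv.dim (D ` supp_on T) = coh_dim TYPE('k) c"
    unfolding coh_dim_def Z_def D_eq S_def T_def
    by (rule dim_cohomology_eq_homology[symmetric]) (rule finite_faces)+
  finally show ?thesis by (simp only: Q)
qed

end

section \<open>Localization and the Cech complex\<close>

locale mult_submonoid = cring R for R (structure) +
  fixes A
  assumes A_carrier: "A \<subseteq> carrier R" and A_one: "\<one> \<in> A"
    and A_mult: "\<And>s t. s \<in> A \<Longrightarrow> t \<in> A \<Longrightarrow> s \<otimes> t \<in> A"
begin

lemma A_closed [simp]: "s \<in> A \<Longrightarrow> s \<in> carrier R"
  using A_carrier by auto

lemma frac_rel_iff:
  assumes "r \<in> carrier R" "r' \<in> carrier R" "s \<in> A" "s' \<in> A"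
  shows "((r, s), (r', s')) \<in> frac_rel R A \<longleftrightarrow> (\<exists>t\<in>A. t \<otimes> (s' \<otimes> r) = t \<otimes> (s \<otimes> r'))"
proof -
  have "t \<otimes> (s' \<otimes> r \<ominus> s \<otimes> r') = \<zero> \<longleftrightarrow> t \<otimes> (s' \<otimes> r) = t \<otimes> (s \<otimes> r')" if "t \<in> A" for t
  proof -
    have "t \<otimes> (s' \<otimes> r \<ominus> s \<otimes> r') = t \<otimes> (s' \<otimes> r) \<ominus> t \<otimes> (s \<otimes> r')"
      using assms that by (simp add: minus_eq r_distr r_minus)
    then show ?thesis using assms that by (simp add: r_right_minus_eq)
  qed
  then show ?thesis using assms by (auto simp: frac_rel_def)
qed

lemma equiv_frac_rel: "equiv (carrier R \<times> A) (frac_rel R A)"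
proof (rule equivI)
  show "frac_rel R A \<subseteq> (carrier R \<times> A) \<times> carrier R \<times> A" by (auto simp: frac_rel_def)
  show "refl_on (carrier R \<times> A) (frac_rel R A)"
    using A_one by (auto simp: refl_on_def frac_rel_iff)
  show "sym (frac_rel R A)"
  proof (rule symI)
    fix p q assume pq: "(p, q) \<in> frac_rel R A"
    obtain r s r' s' where "p = (r, s)" "q = (r', s')" by (cases p, cases q)
    moreover from this pq have "r \<in> carrier R" "r' \<in> carrier R" "s \<in> A" "s' \<in> A"
      by (auto simp: frac_rel_def)
    ultimately show "(q, p) \<in> frac_rel R A" using pq frac_rel_iff by metis
  qed
  show "trans (frac_rel R A)"
  proof (rule transI)
    fix p q z assume pq: "(p, q) \<in> frac_rel R A" and qz: "(q, z) \<in> frac_rel R A"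
    obtain r s r' s' r'' s'' where eqs: "p = (r, s)" "q = (r', s')" "z = (r'', s'')"
      by (cases p, cases q, cases z)
    have mem: "r \<in> carrier R" "r' \<in> carrier R" "r'' \<in> carrier R" "s \<in> A" "s' \<in> A" "s'' \<in> A"
      using pq qz eqs by (auto simp: frac_rel_def)
    obtain t t' where t: "t \<in> A" "t \<otimes> (s' \<otimes> r) = t \<otimes> (s \<otimes> r')"
      and t': "t' \<in> A" "t' \<otimes> (s'' \<otimes> r') = t' \<otimes> (s' \<otimes> r'')"
      using pq qz eqs mem frac_rel_iff by metis
    \<comment> \<open>The middle denominator \<open>s'\<close> joins the multiplier: the two given
      relations can be chained only after scaling by it.\<close>
    have "(t \<otimes> t' \<otimes> s') \<otimes> (s'' \<otimes> r) = t' \<otimes> s'' \<otimes> (t \<otimes> (s' \<otimes> r))"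
      using t(1) t'(1) mem by (simp add: m_ac)
    also have "\<dots> = t \<otimes> s \<otimes> (t' \<otimes> (s'' \<otimes> r'))"
      unfolding t(2) using t(1) t'(1) mem by (simp add: m_ac)
    also have "\<dots> = (t \<otimes> t' \<otimes> s') \<otimes> (s \<otimes> r'')"
      unfolding t'(2) using t(1) t'(1) mem by (simp add: m_ac)
    finally have "(t \<otimes> t' \<otimes> s') \<otimes> (s'' \<otimes> r) = (t \<otimes> t' \<otimes> s') \<otimes> (s \<otimes> r'')" .
    moreover have "t \<otimes> t' \<otimes> s' \<in> A" using t(1) t'(1) mem A_mult by simp
    ultimately show "(p, z) \<in> frac_rel R A" using eqs mem frac_rel_iff by blast
  qed
qed

lemma frac_eq_iff:
  assumes "r \<in> carrier R" "r' \<in> carrier R" "s \<in> A" "s' \<in> A"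
  shows "frac R A r s = frac R A r' s' \<longleftrightarrow> (\<exists>t\<in>A. t \<otimes> (s' \<otimes> r) = t \<otimes> (s \<otimes> r'))"
  unfolding frac_def using assms eq_equiv_class_iff[OF equiv_frac_rel] frac_rel_iff by simp

lemma frac_eqI:
  assumes "r \<in> carrier R" "r' \<in> carrier R" "s \<in> A" "s' \<in> A" "s' \<otimes> r = s \<otimes> r'"
  shows "frac R A r s = frac R A r' s'"
  using assms A_one by (auto simp: frac_eq_iff)

text \<open>Denominators may be zero divisors or zero. This criterion is what makes fractions vanish
  when their support together with the inverted variables is not a face.\<close>

lemma frac_eq_zero_iff:
  assumes "r \<in> carrier R" "s \<in> A"
  shows "frac R A r s = frac R A \<zero> \<one> \<longleftrightarrow> (\<exists>t\<in>A. t \<otimes> r = \<zero>)"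
  using assms A_one by (simp add: frac_eq_iff)

lemma mem_frac:
  assumes "r \<in> carrier R" "s \<in> A" "p \<in> frac R A r s"
  obtains r' s' where "p = (r', s')" "r' \<in> carrier R" "s' \<in> A" "frac R A r' s' = frac R A r s"
proof -
  have p: "((r, s), p) \<in> frac_rel R A" using assms(3) by (simp add: frac_def)
  then obtain r' s' where "p = (r', s')" "r' \<in> carrier R" "s' \<in> A" by (auto simp: frac_rel_def)
  moreover from this have "frac R A r' s' = frac R A r s"
    using p equiv_class_eq[OF equiv_frac_rel] unfolding frac_def by metis
  ultimately show ?thesis using that by blast
qed

lemma frac_self: "r \<in> carrier R \<Longrightarrow> s \<in> A \<Longrightarrow> (r, s) \<in> frac R A r s"
  using equiv_class_self[OF equiv_frac_rel] by (simp add: frac_def)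

lemma frac_closed: "r \<in> carrier R \<Longrightarrow> s \<in> A \<Longrightarrow> frac R A r s \<in> carrier (localization R A)"
  by (auto simp: localization_def frac_def intro: quotientI)

lemma carrier_localizationE:
  assumes "x \<in> carrier (localization R A)"
  obtains r s where "r \<in> carrier R" "s \<in> A" "x = frac R A r s"
  using assms by (auto simp: localization_def frac_def elim!: quotientE)

lemma zero_localization: "\<zero>\<^bsub>localization R A\<^esub> = frac R A \<zero> \<one>"
  by (simp add: localization_def)

lemma frac_zero: "s \<in> A \<Longrightarrow> frac R A \<zero> s = \<zero>\<^bsub>localization R A\<^esub>"
  unfolding zero_localization using A_one by (intro frac_eqI) auto

text \<open>The scalar action is defined as a union over all representatives of a class;
  cross-multiplication shows that each contributes the same fraction.\<close>

lemma smult_frac: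
  assumes "a \<in> carrier R" "r \<in> carrier R" "s \<in> A"
  shows "a \<odot>\<^bsub>localization R A\<^esub> frac R A r s = frac R A (a \<otimes> r) s"
proof -
  have "(case p of (r', s') \<Rightarrow> frac R A (a \<otimes> r') s') = frac R A (a \<otimes> r) s"
    if p: "p \<in> frac R A r s" for p
  proof -
    obtain r' s' where p': "p = (r', s')" "r' \<in> carrier R" "s' \<in> A" "frac R A r' s' = frac R A r s"
      using mem_frac[OF assms(2,3) p] .
    then obtain t where t: "t \<in> A" "t \<otimes> (s \<otimes> r') = t \<otimes> (s' \<otimes> r)"
      using assms frac_eq_iff by metis
    have "t \<otimes> (s \<otimes> (a \<otimes> r')) = a \<otimes> (t \<otimes> (s \<otimes> r'))" using assms p' t(1) by (simp add: m_ac)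
    also have "\<dots> = t \<otimes> (s' \<otimes> (a \<otimes> r))" unfolding t(2) using assms p' t(1) by (simp add: m_ac)
    finally show ?thesis using assms p' t(1) by (auto simp: frac_eq_iff)
  qed
  then have "(\<Union>p\<in>frac R A r s. case p of (r', s') \<Rightarrow> frac R A (a \<otimes> r') s') = frac R A (a \<otimes> r) s"
    using frac_self[OF assms(2,3)] by blast
  then show ?thesis by (simp add: localization_def)
qed

lemma add_frac:
  assumes "r \<in> carrier R" "s \<in> A" "r' \<in> carrier R" "s' \<in> A"
  shows "frac R A r s \<oplus>\<^bsub>localization R A\<^esub> frac R A r' s' = frac R A (r \<otimes> s' \<oplus> r' \<otimes> s) (s \<otimes> s')"
proof -
  have "frac R A (r1 \<otimes> s2 \<oplus> r2 \<otimes> s1) (s1 \<otimes> s2) = frac R A (r \<otimes> s' \<oplus> r' \<otimes> s) (s \<otimes> s')"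
    if p: "(r1, s1) \<in> frac R A r s" and q: "(r2, s2) \<in> frac R A r' s'" for r1 s1 r2 s2
  proof -
    have p': "r1 \<in> carrier R" "s1 \<in> A" "frac R A r1 s1 = frac R A r s"
      using mem_frac[OF assms(1,2) p] by blast+
    have q': "r2 \<in> carrier R" "s2 \<in> A" "frac R A r2 s2 = frac R A r' s'"
      using mem_frac[OF assms(3,4) q] by blast+
    obtain t u where t: "t \<in> A" "t \<otimes> (s \<otimes> r1) = t \<otimes> (s1 \<otimes> r)"
      and u: "u \<in> A" "u \<otimes> (s' \<otimes> r2) = u \<otimes> (s2 \<otimes> r')"
      using assms p' q' frac_eq_iff by metis
    have "t \<otimes> u \<otimes> (s \<otimes> s' \<otimes> (r1 \<otimes> s2 \<oplus> r2 \<otimes> s1)) =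
        u \<otimes> s' \<otimes> s2 \<otimes> (t \<otimes> (s \<otimes> r1)) \<oplus> t \<otimes> s \<otimes> s1 \<otimes> (u \<otimes> (s' \<otimes> r2))"
      using assms p' q' t(1) u(1) by (simp add: r_distr m_ac)
    also have "\<dots> = t \<otimes> u \<otimes> (s1 \<otimes> s2 \<otimes> (r \<otimes> s' \<oplus> r' \<otimes> s))"
      unfolding t(2) u(2) using assms p' q' t(1) u(1) by (simp add: r_distr m_ac)
    finally show ?thesis
      using assms p' q' t(1) u(1) A_mult by (subst frac_eq_iff) auto
  qed
  then have "(\<Union>(r1, s1)\<in>frac R A r s. \<Union>(r2, s2)\<in>frac R A r' s'.
      frac R A (r1 \<otimes> s2 \<oplus> r2 \<otimes> s1) (s1 \<otimes> s2)) = frac R A (r \<otimes> s' \<oplus> r' \<otimes> s) (s \<otimes> s')"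
    using frac_self[OF assms(1,2)] frac_self[OF assms(3,4)] mem_frac[OF assms(1,2)] mem_frac[OF
        assms(3,4)]
    by fast
  then show ?thesis by (simp add: localization_def)
qed

lemma add_frac_same:
  assumes "r \<in> carrier R" "r' \<in> carrier R" "s \<in> A"
  shows "frac R A r s \<oplus>\<^bsub>localization R A\<^esub> frac R A r' s = frac R A (r \<oplus> r') s"
  unfolding add_frac[OF assms(1,3,2,3)] using assms A_mult
  by (intro frac_eqI) (auto simp: r_distr l_distr m_ac)

lemma abelian_group_localization: "abelian_group (localization R A)"
proof (rule abelian_groupI)
  show "\<zero>\<^bsub>localization R A\<^esub> \<in> carrier (localization R A)"
    unfolding zero_localization using A_one by (intro frac_closed) auto
next
  fix x y assume "x \<in> carrier (localization R A)" "y \<in> carrier (localization R A)"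
  then show "x \<oplus>\<^bsub>localization R A\<^esub> y \<in> carrier (localization R A)"
    using A_mult by (auto elim!: carrier_localizationE simp: add_frac intro!: frac_closed)
next
  fix x y z
  assume "x \<in> carrier (localization R A)" "y \<in> carrier (localization R A)"
    "z \<in> carrier (localization R A)"
  then show "x \<oplus>\<^bsub>localization R A\<^esub> y \<oplus>\<^bsub>localization R A\<^esub> z =
      x \<oplus>\<^bsub>localization R A\<^esub> (y \<oplus>\<^bsub>localization R A\<^esub> z)"
    using A_mult
    by (auto elim!: carrier_localizationE simp: add_frac r_distr l_distr m_ac a_ac intro!: frac_eqI)
next
  fix x y assume "x \<in> carrier (localization R A)" "y \<in> carrier (localization R A)"
  then show "x \<oplus>\<^bsub>localization R A\<^esub> y = y \<oplus>\<^bsub>localization R A\<^esub> x"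
    using A_mult by (auto elim!: carrier_localizationE simp: add_frac m_ac a_ac intro!: frac_eqI)
next
  fix x assume "x \<in> carrier (localization R A)"
  then show "\<zero>\<^bsub>localization R A\<^esub> \<oplus>\<^bsub>localization R A\<^esub> x = x"
    using A_one A_mult
    by (auto elim!: carrier_localizationE simp: zero_localization add_frac intro!: frac_eqI)
next
  fix x assume "x \<in> carrier (localization R A)"
  then obtain r s where x: "r \<in> carrier R" "s \<in> A" "x = frac R A r s"
    by (rule carrier_localizationE)
  then have "frac R A (\<ominus> r) s \<oplus>\<^bsub>localization R A\<^esub> x = \<zero>\<^bsub>localization R A\<^esub>"
    by (simp add: add_frac_same l_neg frac_zero)
  then show "\<exists>y\<in>carrier (localization R A). y \<oplus>\<^bsub>localization R A\<^esub> x = \<zero>\<^bsub>localization R A\<^esub>"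
    using x by (blast intro: frac_closed a_inv_closed)
qed

lemma module_localization: "module R (localization R A)"
proof (rule moduleI[OF is_cring abelian_group_localization])
  fix a b x assume ab: "a \<in> carrier R" "b \<in> carrier R" and x: "x \<in> carrier (localization R A)"
  obtain r s where "r \<in> carrier R" "s \<in> A" "x = frac R A r s"
    using x by (rule carrier_localizationE)
  then show "(a \<oplus> b) \<odot>\<^bsub>localization R A\<^esub> x =
      a \<odot>\<^bsub>localization R A\<^esub> x \<oplus>\<^bsub>localization R A\<^esub> b \<odot>\<^bsub>localization R A\<^esub> x"
    using ab by (simp add: smult_frac add_frac_same l_distr)
qed (auto elim!: carrier_localizationE intro!: frac_closed arg_cong2[of _ _ _ _ "frac R A"]
    simp: smult_frac add_frac A_mult r_distr m_ac)

end

lemma frac_rel_mono: "A \<subseteq> A' \<Longrightarrow> frac_rel R A \<subseteq> frac_rel R A'"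
  by (fastforce simp: frac_rel_def)

text \<open>Enlarging the set of denominators enlarges the relation, so by transitivity a class of
  the finer relation is carried to a single class of the coarser one.\<close>

lemma frac_rel_image_frac:
  assumes "mult_submonoid R A" "mult_submonoid R A'" "A \<subseteq> A'" "r \<in> carrier R" "s \<in> A"
  shows "frac_rel R A' `` frac R A r s = frac R A' r s"
proof -
  interpret A: mult_submonoid R A by fact
  interpret A': mult_submonoid R A' by fact
  have "frac_rel R A' `` frac R A r s \<subseteq> frac R A' r s"
    using frac_rel_mono[OF assms(3)] A'.equiv_frac_rel unfolding frac_def
    by (auto elim!: equivE dest: transD)
  moreover have "frac R A' r s \<subseteq> frac_rel R A' `` frac R A r s"
    using A.frac_self[OF assms(4,5)] by (auto simp: frac_def)
  ultimately show ?thesis by blast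
qed

section \<open>Linearity of the Cech differential and the submodule of coboundaries\<close>

locale cech_data = cring R for R (structure) +
  fixes y :: "nat \<Rightarrow> 'a" and n :: nat
  assumes y_closed: "\<And>j. j \<in> {1..n} \<Longrightarrow> y j \<in> carrier R"
begin

lemma mult_submonoid_denoms:
  assumes "J \<subseteq> {1..n}"
  shows "mult_submonoid R (denoms R y J)"
proof
  have y: "\<And>j a. j \<in> J \<Longrightarrow> y j [^] (a::nat) \<in> carrier R" using assms y_closed by blast
  show "denoms R y J \<subseteq> carrier R" using y by (auto simp: denoms_def intro!: finprod_closed)
  have "finprod R (\<lambda>j. y j [^] (0::nat)) J = \<one>" by (intro finprod_one_eqI) simp
  then show "\<one> \<in> denoms R y J" unfolding denoms_def by (intro CollectI exI[of _ "\<lambda>_. 0"]) simp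
  fix s t assume "s \<in> denoms R y J" "t \<in> denoms R y J"
  then obtain a b :: "nat \<Rightarrow> nat" where
    "s = finprod R (\<lambda>j. y j [^] a j) J" "t = finprod R (\<lambda>j. y j [^] b j) J"
    by (auto simp: denoms_def)
  then have "s \<otimes> t = finprod R (\<lambda>j. y j [^] a j \<otimes> y j [^] b j) J"
    using y by (simp add: finprod_multf Pi_def)
  also have "\<dots> = finprod R (\<lambda>j. y j [^] (a j + b j)) J"
    using assms y_closed by (intro finprod_cong') (auto simp: nat_pow_mult Pi_def)
  finally show "s \<otimes> t \<in> denoms R y J" unfolding denoms_def by (intro CollectI exI[of _ "\<lambda>j. a j +
      b j"]) simp
qed

lemma denoms_mono:
  assumes "J \<subseteq> L" "L \<subseteq> {1..n}"
  shows "denoms R y J \<subseteq> denoms R y L"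
proof
  fix s assume "s \<in> denoms R y J"
  then obtain a :: "nat \<Rightarrow> nat" where a: "s = finprod R (\<lambda>j. y j [^] a j) J"
    by (auto simp: denoms_def)
  have "finite L" using assms(2) finite_subset by blast
  then have "s = finprod R (\<lambda>j. y j [^] (if j \<in> J then a j else 0)) L"
    unfolding a using assms y_closed by (intro finprod_mono_neutral_cong_left) auto
  then show "s \<in> denoms R y L" by (auto simp: denoms_def)
qed

lemma module_loc: "J \<subseteq> {1..n} \<Longrightarrow> module R (loc_at R y J)"
  using mult_submonoid.module_localization[OF mult_submonoid_denoms] .

lemma abelian_group_loc: "J \<subseteq> {1..n} \<Longrightarrow> abelian_group (loc_at R y J)"
  using module_loc module.axioms(2) by blast

lemma loc_map_frac:
  assumes "J \<subseteq> L" "L \<subseteq> {1..n}" "r \<in> carrier R" "s \<in> denoms R y J"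
  shows "loc_map R y L (frac R (denoms R y J) r s) = frac R (denoms R y L) r s"
  unfolding loc_map_def using assms
  by (intro frac_rel_image_frac mult_submonoid_denoms denoms_mono) auto

lemma loc_map_add_smult:
  assumes "J \<subseteq> L" "L \<subseteq> {1..n}" "x \<in> carrier (loc_at R y J)" "z \<in> carrier (loc_at R y J)"
    "a \<in> carrier R"
  shows "loc_map R y L x \<in> carrier (loc_at R y L)"
    and "loc_map R y L (x \<oplus>\<^bsub>loc_at R y J\<^esub> z) = loc_map R y L x \<oplus>\<^bsub>loc_at R y L\<^esub> loc_map R y L z"
    and "loc_map R y L (a \<odot>\<^bsub>loc_at R y J\<^esub> x) = a \<odot>\<^bsub>loc_at R y L\<^esub> loc_map R y L x"
proof -
  have JL: "J \<subseteq> {1..n}" using assms by blast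
  interpret J: mult_submonoid R "denoms R y J" using mult_submonoid_denoms[OF JL] .
  interpret L: mult_submonoid R "denoms R y L" using mult_submonoid_denoms[OF assms(2)] .
  obtain r s where x: "r \<in> carrier R" "s \<in> denoms R y J" "x = frac R (denoms R y J) r s"
    using assms(3) by (rule J.carrier_localizationE)
  obtain r' s' where z: "r' \<in> carrier R" "s' \<in> denoms R y J" "z = frac R (denoms R y J) r' s'"
    using assms(4) by (rule J.carrier_localizationE)
  have ss: "s \<in> denoms R y L" "s' \<in> denoms R y L" using x z denoms_mono[OF assms(1,2)] by auto
  show "loc_map R y L x \<in> carrier (loc_at R y L)"
    using x ss by (simp add: loc_map_frac[OF assms(1,2)] L.frac_closed)
  show "loc_map R y L (x \<oplus>\<^bsub>loc_at R y J\<^esub> z) = loc_map R y L x \<oplus>\<^bsub>loc_at R y L\<^esub> loc_map R y L z"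
    using x z ss by (simp add: loc_map_frac[OF assms(1,2)] J.add_frac L.add_frac J.A_mult)
  show "loc_map R y L (a \<odot>\<^bsub>loc_at R y J\<^esub> x) = a \<odot>\<^bsub>loc_at R y L\<^esub> loc_map R y L x"
    using x ss assms(5) by (simp add: loc_map_frac[OF assms(1,2)] J.smult_frac L.smult_frac)
qed

lemma cech_indexD: "J \<in> cech_index n i \<Longrightarrow> J \<subseteq> {1..n}"
  by (simp add: cech_index_def)

lemma cech_index_remove:
  assumes "J \<in> cech_index n (i + 1)" "j \<in> J"
  shows "J - {j} \<in> cech_index n i"
proof -
  have J: "J \<subseteq> {1..n}" "int (card J) = i + 1" using assms by (auto simp: cech_index_def)
  then have "card J = Suc (card (J - {j}))"
    using assms(2) finite_subset by (intro card.remove) blast+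
  then have "int (card (J - {j})) = i" using J(2) by linarith
  then show ?thesis using J(1) by (auto simp: cech_index_def)
qed

lemma module_cech: "module R (cech R y n i)"
proof -
  let ?C = "cech R y n i"
  note m = module_loc[OF cech_indexD]
  note g = abelian_group_loc[OF cech_indexD]
  have group: "abelian_group ?C"
  proof (rule abelian_groupI)
    show "c \<oplus>\<^bsub>?C\<^esub> c' \<in> carrier ?C" if "c \<in> carrier ?C" "c' \<in> carrier ?C" for c c'
      using that abelian_monoid.a_closed[OF abelian_group.axioms(1)[OF g]]
      by (auto simp: cech_def PiE_def Pi_def)
    show "\<zero>\<^bsub>?C\<^esub> \<in> carrier ?C"
      using abelian_monoid.zero_closed[OF abelian_group.axioms(1)[OF g]] by (auto simp: cech_def)
    show "c \<oplus>\<^bsub>?C\<^esub> c' \<oplus>\<^bsub>?C\<^esub> c'' = c \<oplus>\<^bsub>?C\<^esub> (c' \<oplus>\<^bsub>?C\<^esub> c'')"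
      if "c \<in> carrier ?C" "c' \<in> carrier ?C" "c'' \<in> carrier ?C" for c c' c''
      using that abelian_monoid.a_assoc[OF abelian_group.axioms(1)[OF g]]
      by (auto simp: cech_def PiE_def Pi_def restrict_def fun_eq_iff)
    show "c \<oplus>\<^bsub>?C\<^esub> c' = c' \<oplus>\<^bsub>?C\<^esub> c" if "c \<in> carrier ?C" "c' \<in> carrier ?C" for c c'
      using that abelian_monoid.a_comm[OF abelian_group.axioms(1)[OF g]]
      by (auto simp: cech_def PiE_def Pi_def restrict_def fun_eq_iff)
    show "\<zero>\<^bsub>?C\<^esub> \<oplus>\<^bsub>?C\<^esub> c = c" if "c \<in> carrier ?C" for c
      using that abelian_monoid.l_zero[OF abelian_group.axioms(1)[OF g]]
      by (auto simp: cech_def PiE_def Pi_def extensional_def restrict_def fun_eq_iff)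
    show "\<exists>c'\<in>carrier ?C. c' \<oplus>\<^bsub>?C\<^esub> c = \<zero>\<^bsub>?C\<^esub>" if "c \<in> carrier ?C" for c
      using that abelian_group.l_neg[OF g] abelian_group.a_inv_closed[OF g]
      by (intro bexI[of _ "\<lambda>J\<in>cech_index n i. \<ominus>\<^bsub>loc_at R y J\<^esub> c J"])
        (auto simp: cech_def PiE_def Pi_def extensional_def restrict_def fun_eq_iff)
  qed
  show ?thesis
  proof (rule moduleI[OF is_cring group])
    show "a \<odot>\<^bsub>?C\<^esub> c \<in> carrier ?C" if "a \<in> carrier R" "c \<in> carrier ?C" for a c
      using that module.smult_closed[OF m] by (auto simp: cech_def PiE_def Pi_def)
    show "(a \<oplus> b) \<odot>\<^bsub>?C\<^esub> c = a \<odot>\<^bsub>?C\<^esub> c \<oplus>\<^bsub>?C\<^esub> b \<odot>\<^bsub>?C\<^esub> c"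
      if "a \<in> carrier R" "b \<in> carrier R" "c \<in> carrier ?C" for a b c
      using that module.smult_l_distr[OF m] by (auto simp: cech_def PiE_def Pi_def restrict_def
          fun_eq_iff)
    show "a \<odot>\<^bsub>?C\<^esub> (c \<oplus>\<^bsub>?C\<^esub> c') = a \<odot>\<^bsub>?C\<^esub> c \<oplus>\<^bsub>?C\<^esub> a \<odot>\<^bsub>?C\<^esub> c'"
      if "a \<in> carrier R" "c \<in> carrier ?C" "c' \<in> carrier ?C" for a c c'
      using that module.smult_r_distr[OF m] by (auto simp: cech_def PiE_def Pi_def restrict_def
          fun_eq_iff)
    show "(a \<otimes> b) \<odot>\<^bsub>?C\<^esub> c = a \<odot>\<^bsub>?C\<^esub> (b \<odot>\<^bsub>?C\<^esub> c)"
      if "a \<in> carrier R" "b \<in> carrier R" "c \<in> carrier ?C" for a b c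
      using that module.smult_assoc1[OF m] by (auto simp: cech_def PiE_def Pi_def restrict_def
          fun_eq_iff)
    show "\<one> \<odot>\<^bsub>?C\<^esub> c = c" if "c \<in> carrier ?C" for c
      using that module.smult_one[OF m]
      by (auto simp: cech_def PiE_def Pi_def extensional_def restrict_def fun_eq_iff)
  qed
qed

definition cech_sign :: "nat set \<Rightarrow> nat \<Rightarrow> 'a" where
  "cech_sign J j = (\<ominus> \<one>) [^] card {l\<in>J. l < j}"

lemma cech_sign_closed: "cech_sign J j \<in> carrier R"
  by (simp add: cech_sign_def)

lemma cech_diff_apply:
  assumes "J \<in> cech_index n (i + 1)"
  shows "cech_diff R y n i c J =
    finsum (loc_at R y J) (\<lambda>j. cech_sign J j \<odot>\<^bsub>loc_at R y J\<^esub> loc_map R y J (c (J - {j}))) J"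
  using assms by (simp add: cech_diff_def cech_sign_def)

lemma carrier_cech_apply:
  "c \<in> carrier (cech R y n i) \<Longrightarrow> J \<in> cech_index n i \<Longrightarrow> c J \<in> carrier (loc_at R y J)"
  by (auto simp: cech_def)

lemma cech_summand_closed:
  assumes "J \<in> cech_index n (i + 1)" "c \<in> carrier (cech R y n i)" "j \<in> J"
  shows "loc_map R y J (c (J - {j})) \<in> carrier (loc_at R y J)"
    and "cech_sign J j \<odot>\<^bsub>loc_at R y J\<^esub> loc_map R y J (c (J - {j})) \<in> carrier (loc_at R y J)"
proof -
  show *: "loc_map R y J (c (J - {j})) \<in> carrier (loc_at R y J)"
    using carrier_cech_apply[OF assms(2) cech_index_remove[OF assms(1,3)]] cech_indexD[OF assms(1)]
    by (intro loc_map_add_smult(1)[of "J - {j}" J _ _ \<zero>]) auto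
  show "cech_sign J j \<odot>\<^bsub>loc_at R y J\<^esub> loc_map R y J (c (J - {j})) \<in> carrier (loc_at R y J)"
    using module.smult_closed[OF module_loc[OF cech_indexD[OF assms(1)]] cech_sign_closed *] .
qed

lemma cech_diff_closed:
  assumes "c \<in> carrier (cech R y n i)"
  shows "cech_diff R y n i c \<in> carrier (cech R y n (i + 1))"
proof -
  have "cech_diff R y n i c J \<in> carrier (loc_at R y J)" if J: "J \<in> cech_index n (i + 1)" for J
  proof -
    interpret module R "loc_at R y J" using module_loc[OF cech_indexD[OF J]] .
    show ?thesis unfolding cech_diff_apply[OF J]
      using cech_summand_closed(2)[OF J assms] by (intro finsum_closed) auto
  qed
  then show ?thesis by (auto simp: cech_def cech_diff_def)
qed

lemma cech_diff_add:
  assumes "c \<in> carrier (cech R y n i)" "c' \<in> carrier (cech R y n i)"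
  shows "cech_diff R y n i (c \<oplus>\<^bsub>cech R y n i\<^esub> c') =
    cech_diff R y n i c \<oplus>\<^bsub>cech R y n (i + 1)\<^esub> cech_diff R y n i c'"
proof
  fix J
  show "cech_diff R y n i (c \<oplus>\<^bsub>cech R y n i\<^esub> c') J =
    (cech_diff R y n i c \<oplus>\<^bsub>cech R y n (i + 1)\<^esub> cech_diff R y n i c') J"
  proof (cases "J \<in> cech_index n (i + 1)")
    case True
    have J: "J \<subseteq> {1..n}" using cech_indexD[OF True] .
    interpret M: module R "loc_at R y J" using module_loc[OF J] .
    have "cech_diff R y n i (c \<oplus>\<^bsub>cech R y n i\<^esub> c') J =
        finsum (loc_at R y J) (\<lambda>j. cech_sign J j \<odot>\<^bsub>loc_at R y J\<^esub> loc_map R y J (c (J - {j}))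
          \<oplus>\<^bsub>loc_at R y J\<^esub> cech_sign J j \<odot>\<^bsub>loc_at R y J\<^esub> loc_map R y J (c' (J - {j}))) J"
      unfolding cech_diff_apply[OF True]
    proof (rule M.finsum_cong')
      fix j assume j: "j \<in> J"
      note mem = carrier_cech_apply[OF assms(1) cech_index_remove[OF True j]]
        carrier_cech_apply[OF assms(2) cech_index_remove[OF True j]]
      have "(c \<oplus>\<^bsub>cech R y n i\<^esub> c') (J - {j}) =
          c (J - {j}) \<oplus>\<^bsub>loc_at R y (J - {j})\<^esub> c' (J - {j})"
        using cech_index_remove[OF True j] by (simp add: cech_def)
      then show "cech_sign J j \<odot>\<^bsub>loc_at R y J\<^esub> loc_map R y J ((c \<oplus>\<^bsub>cech R y n i\<^esub> c') (J - {j})) =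
          cech_sign J j \<odot>\<^bsub>loc_at R y J\<^esub> loc_map R y J (c (J - {j})) \<oplus>\<^bsub>loc_at R y J\<^esub>
          cech_sign J j \<odot>\<^bsub>loc_at R y J\<^esub> loc_map R y J (c' (J - {j}))"
        using loc_map_add_smult(2)[OF Diff_subset J mem, of \<zero>]
          cech_summand_closed(1)[OF True assms(1) j] cech_summand_closed(1)[OF True assms(2) j]
        by (simp add: M.smult_r_distr cech_sign_closed)
    qed (use cech_summand_closed[OF True] assms in auto)
    also have "\<dots> = cech_diff R y n i c J \<oplus>\<^bsub>loc_at R y J\<^esub> cech_diff R y n i c' J"
      unfolding cech_diff_apply[OF True] using cech_summand_closed[OF True] assms
      by (intro M.finsum_addf) auto
    finally show ?thesis using True by (simp add: cech_def)
  qed (simp add: cech_diff_def cech_def)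
qed

lemma cech_diff_smult:
  assumes "c \<in> carrier (cech R y n i)" "a \<in> carrier R"
  shows "cech_diff R y n i (a \<odot>\<^bsub>cech R y n i\<^esub> c) = a \<odot>\<^bsub>cech R y n (i + 1)\<^esub> cech_diff R y n i c"
proof
  fix J
  show "cech_diff R y n i (a \<odot>\<^bsub>cech R y n i\<^esub> c) J =
      (a \<odot>\<^bsub>cech R y n (i + 1)\<^esub> cech_diff R y n i c) J"
  proof (cases "J \<in> cech_index n (i + 1)")
    case True
    have J: "J \<subseteq> {1..n}" using cech_indexD[OF True] .
    have fin: "finite J" using J finite_subset by blast
    interpret M: module R "loc_at R y J" using module_loc[OF J] .
    have "cech_diff R y n i (a \<odot>\<^bsub>cech R y n i\<^esub> c) J = finsum (loc_at R y J)
        (\<lambda>j. a \<odot>\<^bsub>loc_at R y J\<^esub> (cech_sign J j \<odot>\<^bsub>loc_at R y J\<^esub> loc_map R y J (c (J - {j})))) J"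
      unfolding cech_diff_apply[OF True]
    proof (rule M.finsum_cong')
      fix j assume j: "j \<in> J"
      note mem = carrier_cech_apply[OF assms(1) cech_index_remove[OF True j]]
      have "(a \<odot>\<^bsub>cech R y n i\<^esub> c) (J - {j}) = a \<odot>\<^bsub>loc_at R y (J - {j})\<^esub> c (J - {j})"
        using cech_index_remove[OF True j] by (simp add: cech_def)
      then show "cech_sign J j \<odot>\<^bsub>loc_at R y J\<^esub> loc_map R y J ((a \<odot>\<^bsub>cech R y n i\<^esub> c) (J - {j})) =
          a \<odot>\<^bsub>loc_at R y J\<^esub> (cech_sign J j \<odot>\<^bsub>loc_at R y J\<^esub> loc_map R y J (c (J - {j})))"
        using loc_map_add_smult(3)[OF Diff_subset J mem mem assms(2)] assms(2)
          cech_summand_closed(1)[OF True assms(1) j]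
        by (simp add: cech_sign_closed m_comm flip: M.smult_assoc1)
    qed (use cech_summand_closed[OF True] assms in auto)
    also have "\<dots> = a \<odot>\<^bsub>loc_at R y J\<^esub> cech_diff R y n i c J"
      unfolding cech_diff_apply[OF True] using cech_summand_closed[OF True] assms fin
      by (intro M.finsum_smult_ldistr[symmetric]) auto
    finally show ?thesis using True by (simp add: cech_def)
  qed (simp add: cech_diff_def cech_def)
qed

lemma coboundaries_subset: "cech_coboundaries R y n i \<subseteq> carrier (cech R y n i)"
  using cech_diff_closed[of _ "i - 1"] by (auto simp: cech_coboundaries_def)

lemma coboundaries_smult:
  assumes "c \<in> cech_coboundaries R y n i" "a \<in> carrier R"
  shows "a \<odot>\<^bsub>cech R y n i\<^esub> c \<in> cech_coboundaries R y n i"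
proof -
  obtain b where b: "b \<in> carrier (cech R y n (i - 1))" "c = cech_diff R y n (i - 1) b"
    using assms(1) by (auto simp: cech_coboundaries_def)
  then have "a \<odot>\<^bsub>cech R y n i\<^esub> c = cech_diff R y n (i - 1) (a \<odot>\<^bsub>cech R y n (i - 1)\<^esub> b)"
    using cech_diff_smult[OF b(1) assms(2)] by simp
  then show ?thesis
    using module.smult_closed[OF module_cech assms(2) b(1)] by (simp add: cech_coboundaries_def)
qed

lemma additive_subgroup_coboundaries:
  "additive_subgroup (cech_coboundaries R y n i) (cech R y n i)"
proof (rule additive_subgroup_closedI)
  interpret M: module R "cech R y n i" by (rule module_cech)
  interpret N: module R "cech R y n (i - 1)" by (rule module_cech)
  show "abelian_group (cech R y n i)" ..
  show "cech_coboundaries R y n i \<subseteq> carrier (cech R y n i)" by (rule coboundaries_subset)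
  show "cech_coboundaries R y n i \<noteq> {}" using N.zero_closed by (auto simp: cech_coboundaries_def)
  show "\<ominus>\<^bsub>cech R y n i\<^esub> c \<in> cech_coboundaries R y n i" if "c \<in> cech_coboundaries R y n i" for c
    using coboundaries_smult[OF that, of "\<ominus> \<one>"] subsetD[OF coboundaries_subset that]
      M.smult_l_minus[of \<one> c] by simp
  show "c \<oplus>\<^bsub>cech R y n i\<^esub> c' \<in> cech_coboundaries R y n i"
    if cc: "c \<in> cech_coboundaries R y n i" "c' \<in> cech_coboundaries R y n i" for c c'
  proof -
    obtain b where b: "b \<in> carrier (cech R y n (i - 1))" "c = cech_diff R y n (i - 1) b"
      using cc(1) unfolding cech_coboundaries_def by (rule imageE)
    obtain b' where b': "b' \<in> carrier (cech R y n (i - 1))" "c' = cech_diff R y n (i - 1) b'"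
      using cc(2) unfolding cech_coboundaries_def by (rule imageE)
    have "c \<oplus>\<^bsub>cech R y n i\<^esub> c' = cech_diff R y n (i - 1) (b \<oplus>\<^bsub>cech R y n (i - 1)\<^esub> b')"
      using cech_diff_add[OF b(1) b'(1)] unfolding b(2) b'(2) by simp
    then show ?thesis using N.a_closed[OF b(1) b'(1)] unfolding cech_coboundaries_def by (rule
        image_eqI)
  qed
qed

end

section \<open>Squarefree monomial ideals\<close>

text \<open>Multiplying by a monomial shifts coefficients; cancellation of exponents leaves only one
  contribution.\<close>

lemma lookup_single_times:
  fixes p :: "('b::cancel_comm_monoid_add) \<Rightarrow>\<^sub>0 'k::comm_semiring_1"
  shows "Poly_Mapping.lookup (Poly_Mapping.single c a * p) (c + u) = a * Poly_Mapping.lookup p u"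
proof -
  have "Poly_Mapping.lookup (Poly_Mapping.single c a * p) (c + u) =
      (\<Sum>l. (a * (\<Sum>q. Poly_Mapping.lookup p q when c + u = l + q)) when l = c)"
    unfolding lookup_mult lookup_single by (intro Sum_any.cong) (auto simp: when_def)
  also have "\<dots> = a * (\<Sum>q. Poly_Mapping.lookup p q when q = u)"
    by (auto simp: when_def intro!: arg_cong[of _ _ "(*) a"] Sum_any.cong)
  finally show ?thesis by simp
qed

lemma lookup_single_times_not:
  fixes p :: "('b::cancel_comm_monoid_add) \<Rightarrow>\<^sub>0 'k::comm_semiring_1"
  assumes "\<And>u. k \<noteq> c + u"
  shows "Poly_Mapping.lookup (Poly_Mapping.single c a * p) k = 0"
proof -
  have "k \<notin> Poly_Mapping.keys (Poly_Mapping.single c a * p)"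
    using keys_mult[of "Poly_Mapping.single c a" p] assms by (auto split: if_splits)
  then show ?thesis by (simp add: in_keys_iff)
qed

lemma keys_add_nat:
  "Poly_Mapping.keys (u + v :: 'v \<Rightarrow>\<^sub>0 nat) = Poly_Mapping.keys u \<union> Poly_Mapping.keys v"
  by (auto simp: in_keys_iff lookup_add)

lemma mpol_eq_sum_monomials:
  "f = (\<Sum>u\<in>Poly_Mapping.keys f. Poly_Mapping.single u (Poly_Mapping.lookup f u))"
  by (rule poly_mapping_eqI)
    (auto simp: lookup_sum lookup_single when_def in_keys_iff sum.delta' finite_keys)

definition unit_exp :: "'v set \<Rightarrow> 'v \<Rightarrow>\<^sub>0 nat" where
  "unit_exp F = (\<Sum>v\<in>F. Poly_Mapping.single v 1)"

lemma lookup_unit_exp: "finite F \<Longrightarrow> Poly_Mapping.lookup (unit_exp F) v = (if v \<in> F then 1 else 0)"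
  by (simp add: unit_exp_def lookup_sum lookup_single when_def)

lemma keys_unit_exp: "finite F \<Longrightarrow> Poly_Mapping.keys (unit_exp F) = F"
  by (auto simp: in_keys_iff lookup_unit_exp split: if_splits)

lemma sqfree_monom_eq: "finite F \<Longrightarrow> sqfree_monom F = Poly_Mapping.single (unit_exp F) 1"
  by (induction F rule: finite_induct)
    (auto simp: sqfree_monom_def indet_def unit_exp_def mult_single)

lemma exponent_factor:
  assumes "finite F" "F \<subseteq> Poly_Mapping.keys u"
  obtains w where "u = w + unit_exp F"
proof
  \<comment> \<open>The subtraction of exponents truncates, but it is exact here because
    \<open>u\<close> is positive on \<open>F\<close>.\<close>
  show "u = (u - unit_exp F) + unit_exp F"
    using assms by (intro poly_mapping_eqI)
      (auto simp: lookup_add lookup_minus lookup_unit_exp in_keys_iff subset_iff)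
qed

lemma poly_ring_simps [simp]:
  "f \<in> carrier (poly_ring TYPE('k::field) m n) \<longleftrightarrow>
     (\<forall>u\<in>Poly_Mapping.keys f. Poly_Mapping.keys u \<subseteq> Vset m \<union> Wset n)"
  "f \<otimes>\<^bsub>poly_ring TYPE('k) m n\<^esub> g = f * g"
  "f \<oplus>\<^bsub>poly_ring TYPE('k) m n\<^esub> g = f + g"
  "\<zero>\<^bsub>poly_ring TYPE('k) m n\<^esub> = 0"
  "\<one>\<^bsub>poly_ring TYPE('k) m n\<^esub> = 1"
  by (simp_all add: poly_ring_def)

lemma poly_ring_add_closed:
  assumes "f \<in> carrier (poly_ring TYPE('k::field) m n)" "g \<in> carrier (poly_ring TYPE('k) m n)"
  shows "f + g \<in> carrier (poly_ring TYPE('k) m n)"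
  using assms keys_add[of f g] unfolding poly_ring_simps by blast

lemma poly_ring_mult_closed:
  assumes "f \<in> carrier (poly_ring TYPE('k::field) m n)" "g \<in> carrier (poly_ring TYPE('k) m n)"
  shows "f * g \<in> carrier (poly_ring TYPE('k) m n)"
  unfolding poly_ring_simps
proof
  fix u assume "u \<in> Poly_Mapping.keys (f * g)"
  then obtain v w where "v \<in> Poly_Mapping.keys f" "w \<in> Poly_Mapping.keys g" "u = v + w"
    using keys_mult[of f g] by blast
  then show "Poly_Mapping.keys u \<subseteq> Vset m \<union> Wset n"
    using assms unfolding poly_ring_simps by (simp add: keys_add_nat)
qed

lemma cring_poly_ring: "cring (poly_ring TYPE('k::field) m n)"
proof (rule cringI)
  show "abelian_group (poly_ring TYPE('k) m n)"
  proof (rule abelian_groupI)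
    fix f assume "f \<in> carrier (poly_ring TYPE('k) m n)"
    then show "\<exists>g\<in>carrier (poly_ring TYPE('k) m n).
        g \<oplus>\<^bsub>poly_ring TYPE('k) m n\<^esub> f = \<zero>\<^bsub>poly_ring TYPE('k) m n\<^esub>"
      by (intro bexI[of _ "- f"]) auto
  next
    fix f g :: "'k mpol"
    assume "f \<in> carrier (poly_ring TYPE('k) m n)" "g \<in> carrier (poly_ring TYPE('k) m n)"
    then show "f \<oplus>\<^bsub>poly_ring TYPE('k) m n\<^esub> g \<in> carrier (poly_ring TYPE('k) m n)"
      using poly_ring_add_closed by (simp only: poly_ring_simps(3))
  qed (simp_all add: add.assoc add.commute)
  show "comm_monoid (poly_ring TYPE('k) m n)"
  proof (rule comm_monoidI)
    fix f g :: "'k mpol"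
    assume "f \<in> carrier (poly_ring TYPE('k) m n)" "g \<in> carrier (poly_ring TYPE('k) m n)"
    then show "f \<otimes>\<^bsub>poly_ring TYPE('k) m n\<^esub> g \<in> carrier (poly_ring TYPE('k) m n)"
      using poly_ring_mult_closed by (simp only: poly_ring_simps(2))
  qed (simp_all add: mult.assoc mult.commute)
qed (simp add: distrib_right)

lemma a_minus_poly_ring:
  fixes f g :: "'k::field mpol"
  assumes "f \<in> carrier (poly_ring TYPE('k) m n)" "g \<in> carrier (poly_ring TYPE('k) m n)"
  shows "f \<ominus>\<^bsub>poly_ring TYPE('k) m n\<^esub> g = f - g"
proof -
  interpret cring "poly_ring TYPE('k) m n" by (rule cring_poly_ring)
  have "\<ominus>\<^bsub>poly_ring TYPE('k) m n\<^esub> g = - g"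
    using assms(2) by (intro minus_equality) auto
  then show ?thesis by (simp add: a_minus_def)
qed

text \<open>Polynomials all of whose monomials are divisible by a generator form an ideal that
  contains the generators, which gives one inclusion. Conversely, each term of such a polynomial is
  a multiple of a generator.\<close>

lemma ideal_mem_iff_monomials:
  fixes \<F> :: "var set set" and m n
  assumes \<F>: "\<F> \<subseteq> Pow (Vset m \<union> Wset n)"
  defines "P \<equiv> poly_ring TYPE('k::field) m n"
  shows "f \<in> Idl\<^bsub>P\<^esub> (sqfree_monom ` \<F>) \<longleftrightarrow>
    f \<in> carrier P \<and> (\<forall>u\<in>Poly_Mapping.keys f. \<exists>F\<in>\<F>. F \<subseteq> Poly_Mapping.keys u)"
proof -
  interpret cring P unfolding P_def by (rule cring_poly_ring)
  define E where "E = {f \<in> carrier P. \<forall>u\<in>Poly_Mapping.keys f. \<exists>F\<in>\<F>. F \<subseteq> Poly_Mapping.keys u}"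
  have fin: "finite F" if "F \<in> \<F>" for F
    using \<F> that finite_subset[of F "Vset m \<union> Wset n"] by (auto simp: Vset_def Wset_def)
  have gen: "sqfree_monom ` \<F> \<subseteq> carrier P"
    using \<F> fin by (auto simp: P_def sqfree_monom_eq keys_unit_exp)
  have E_add: "f + g \<in> E" if "f \<in> E" "g \<in> E" for f g
    using that keys_add[of f g] poly_ring_add_closed[of f m n g] unfolding E_def P_def by blast
  have E_mult: "f * g \<in> E" if "f \<in> E" "g \<in> carrier P" for f g
  proof -
    have "\<exists>F\<in>\<F>. F \<subseteq> Poly_Mapping.keys u" if "u \<in> Poly_Mapping.keys (f * g)" for u
    proof -
      obtain v w where "v \<in> Poly_Mapping.keys f" "u = v + w"
        using keys_mult[of f g] \<open>u \<in> Poly_Mapping.keys (f * g)\<close> by blast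
      moreover from this obtain F where "F \<in> \<F>" "F \<subseteq> Poly_Mapping.keys v"
        using \<open>f \<in> E\<close> unfolding E_def by blast
      ultimately show ?thesis by (auto simp: keys_add_nat)
    qed
    then show ?thesis using that poly_ring_mult_closed[of f m n g] unfolding E_def P_def by blast
  qed
  have "ideal E P"
  proof (rule idealI)
    show "ring P" ..
    show "subgroup E (add_monoid P)"
    proof (rule additive_subgroup.a_subgroup, rule additive_subgroup_closedI)
      show "abelian_group P" ..
      show "E \<subseteq> carrier P" by (auto simp: E_def)
      have "0 \<in> E" by (auto simp: E_def P_def)
      then show "E \<noteq> {}" by blast
      show "\<ominus>\<^bsub>P\<^esub> f \<in> E" if "f \<in> E" for f
      proof -
        have "\<ominus>\<^bsub>P\<^esub> f = - f" using that by (intro minus_equality) (auto simp: E_def P_def)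
        then show ?thesis using that by (auto simp: E_def P_def)
      qed
      show "f \<oplus>\<^bsub>P\<^esub> g \<in> E" if "f \<in> E" "g \<in> E" for f g
        using E_add[OF that] by (simp add: P_def)
    qed
    show "g \<otimes>\<^bsub>P\<^esub> f \<in> E" if "f \<in> E" "g \<in> carrier P" for f g
      using E_mult[OF that] by (simp add: P_def mult.commute)
    show "f \<otimes>\<^bsub>P\<^esub> g \<in> E" if "f \<in> E" "g \<in> carrier P" for f g
      using E_mult[OF that] by (simp add: P_def)
  qed
  moreover have "sqfree_monom ` \<F> \<subseteq> E"
    using gen fin by (auto simp: E_def sqfree_monom_eq keys_unit_exp)
  ultimately have "Idl\<^bsub>P\<^esub> (sqfree_monom ` \<F>) \<subseteq> E" by (rule genideal_minimal)
  moreover have "E \<subseteq> Idl\<^bsub>P\<^esub> (sqfree_monom ` \<F>)"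
  proof
    fix f assume f: "f \<in> E"
    interpret I: ideal "Idl\<^bsub>P\<^esub> (sqfree_monom ` \<F>)" P by (rule genideal_ideal[OF gen])
    have "Poly_Mapping.single u (Poly_Mapping.lookup f u) \<in> Idl\<^bsub>P\<^esub> (sqfree_monom ` \<F>)"
      if u: "u \<in> Poly_Mapping.keys f" for u
    proof -
      obtain F where F: "F \<in> \<F>" "F \<subseteq> Poly_Mapping.keys u" using f u by (auto simp: E_def)
      obtain w where w: "u = w + unit_exp F" using exponent_factor[OF fin[OF F(1)] F(2)] .
      have "Poly_Mapping.keys u \<subseteq> Vset m \<union> Wset n"
        using f u unfolding E_def P_def poly_ring_simps by blast
      then have "Poly_Mapping.keys w \<subseteq> Vset m \<union> Wset n" by (simp add: w keys_add_nat)
      then have "Poly_Mapping.single w (Poly_Mapping.lookup f u) \<in> carrier P" by (simp add: P_def)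
      moreover have "sqfree_monom F \<in> Idl\<^bsub>P\<^esub> (sqfree_monom ` \<F>)"
        using genideal_self[OF gen] F(1) by blast
      ultimately have "Poly_Mapping.single w (Poly_Mapping.lookup f u) \<otimes>\<^bsub>P\<^esub> sqfree_monom F
          \<in> Idl\<^bsub>P\<^esub> (sqfree_monom ` \<F>)"
        by (rule I.I_l_closed[rotated])
      then show ?thesis using fin[OF F(1)] by (simp add: P_def sqfree_monom_eq mult_single w)
    qed
    moreover have "sum h B \<in> Idl\<^bsub>P\<^esub> (sqfree_monom ` \<F>)"
      if "finite B" "\<And>u. u \<in> B \<Longrightarrow> h u \<in> Idl\<^bsub>P\<^esub> (sqfree_monom ` \<F>)" for B :: "(var \<Rightarrow>\<^sub>0 nat) set" and h
      using that
    proof (induction B rule: finite_induct)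
      case empty
      then show ?case using I.zero_closed by (simp add: P_def)
    next
      case (insert u B)
      then show ?case using I.a_closed[of "h u" "sum h B"] by (simp add: P_def)
    qed
    ultimately show "f \<in> Idl\<^bsub>P\<^esub> (sqfree_monom ` \<F>)"
      using finite_keys mpol_eq_sum_monomials[of f] by metis
  qed
  ultimately show ?thesis by (auto simp: E_def)
qed

text \<open>Divisibility by a squarefree monomial depends only on supports, so a monomial lies in
  \<open>I\<close> exactly when its support is not a face. The second claim is the bridge from ring
  computations to the complex.\<close>

lemma squarefree_monomial_ideal_properties:
  fixes I :: "'k::field mpol set"
  assumes "squarefree_monomial_ideal m n I"
  shows "ideal I (poly_ring TYPE('k) m n)"
    and "f \<in> I \<longleftrightarrow> f \<in> carrier (poly_ring TYPE('k) m n) \<and>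
      (\<forall>u\<in>Poly_Mapping.keys f. Poly_Mapping.keys u \<notin> sr_complex m n I)"
    and "sr_complex m n I \<subseteq> Pow (Vset m \<union> Wset n)"
    and "s \<in> sr_complex m n I \<Longrightarrow> t \<subseteq> s \<Longrightarrow> t \<in> sr_complex m n I"
proof -
  obtain \<F> where \<F>: "\<F> \<subseteq> Pow (Vset m \<union> Wset n)"
    and I: "I = Idl\<^bsub>poly_ring TYPE('k) m n\<^esub> (sqfree_monom ` \<F>)"
    using assms by (auto simp: squarefree_monomial_ideal_def)
  interpret cring "poly_ring TYPE('k) m n" by (rule cring_poly_ring)
  have fin: "finite F" if "F \<subseteq> Vset m \<union> Wset n" for F
    using that finite_subset[of F "Vset m \<union> Wset n"] by (auto simp: Vset_def Wset_def)
  have "sqfree_monom ` \<F> \<subseteq> carrier (poly_ring TYPE('k) m n)"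
    using \<F> fin by (auto simp: sqfree_monom_eq keys_unit_exp)
  then show "ideal I (poly_ring TYPE('k) m n)" unfolding I by (rule genideal_ideal)
  have \<Delta>: "F \<in> sr_complex m n I \<longleftrightarrow> F \<subseteq> Vset m \<union> Wset n \<and> (\<forall>F'\<in>\<F>. \<not> F' \<subseteq> F)" for F
    using fin unfolding I sr_complex_def ideal_mem_iff_monomials[OF \<F>]
    by (auto simp: sqfree_monom_eq keys_unit_exp)
  show "f \<in> I \<longleftrightarrow> f \<in> carrier (poly_ring TYPE('k) m n) \<and>
      (\<forall>u\<in>Poly_Mapping.keys f. Poly_Mapping.keys u \<notin> sr_complex m n I)"
    unfolding \<Delta> unfolding I ideal_mem_iff_monomials[OF \<F>] by auto
  show "sr_complex m n I \<subseteq> Pow (Vset m \<union> Wset n)" by (auto simp: sr_complex_def)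
  show "t \<in> sr_complex m n I" if "s \<in> sr_complex m n I" "t \<subseteq> s"
    using that unfolding \<Delta> by blast
qed

section \<open>Graded components of the Cech complex\<close>

definition pos_part :: "('v \<Rightarrow>\<^sub>0 int) \<Rightarrow> 'v \<Rightarrow>\<^sub>0 nat" where
  "pos_part d = Poly_Mapping.map nat d"

definition neg_part :: "('v \<Rightarrow>\<^sub>0 int) \<Rightarrow> 'v \<Rightarrow>\<^sub>0 nat" where
  "neg_part d = Poly_Mapping.map (\<lambda>x. nat (- x)) d"

lemma lookup_pos_part: "Poly_Mapping.lookup (pos_part d) v = nat (Poly_Mapping.lookup d v)"
  by (simp add: pos_part_def map.rep_eq when_def)

lemma lookup_neg_part: "Poly_Mapping.lookup (neg_part d) v = nat (- Poly_Mapping.lookup d v)"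
  by (simp add: neg_part_def map.rep_eq when_def)

lemma lookup_map_int: "Poly_Mapping.lookup (Poly_Mapping.map int u) v = int (Poly_Mapping.lookup u
    v)"
  by (simp add: map.rep_eq when_def)

lemma keys_pos_part: "Poly_Mapping.keys (pos_part d) = {v. Poly_Mapping.lookup d v > 0}"
  by (auto simp: in_keys_iff lookup_pos_part)

lemma keys_neg_part: "Poly_Mapping.keys (neg_part d) = {v. Poly_Mapping.lookup d v < 0}"
  by (auto simp: in_keys_iff lookup_neg_part)

lemma keys_pos_neg_disjoint: "Poly_Mapping.keys (pos_part d) \<inter> Poly_Mapping.keys (neg_part d) = {}"
  by (auto simp: keys_pos_part keys_neg_part)

text \<open>Moving the negative part to the other side replaces an equation of integer degrees by
  one of exponents, which monomials can realize.\<close>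

lemma degree_shift_iff:
  "Poly_Mapping.map int e = d + Poly_Mapping.map int b \<longleftrightarrow> neg_part d + e = pos_part d + b"
proof -
  have "int (Poly_Mapping.lookup e v) = Poly_Mapping.lookup d v + int (Poly_Mapping.lookup b v) \<longleftrightarrow>
      nat (- Poly_Mapping.lookup d v) + Poly_Mapping.lookup e v =
      nat (Poly_Mapping.lookup d v) + Poly_Mapping.lookup b v" for v
    by linarith
  then show ?thesis
    by (simp add: poly_mapping_eq_iff fun_eq_iff lookup_add lookup_map_int lookup_pos_part
        lookup_neg_part)
qed

section \<open>Fractions over a Stanley-Reisner ring\<close>

locale stanley_reisner =
  fixes m n :: nat and I :: "'k::field mpol set"
  assumes sqfree: "squarefree_monomial_ideal m n I"
begin

abbreviation P where "P \<equiv> poly_ring TYPE('k) m n"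
abbreviation \<Delta> where "\<Delta> \<equiv> sr_complex m n I"
abbreviation R where "R \<equiv> sr_ring m n I"
abbreviation res where "res \<equiv> residue m n I"
abbreviation y where "y \<equiv> (\<lambda>q. residue m n I (indet (Yv q)))"
abbreviation mon :: "(var \<Rightarrow>\<^sub>0 nat) \<Rightarrow> 'k mpol" where "mon u \<equiv> Poly_Mapping.single u 1"

lemmas ideal_I = squarefree_monomial_ideal_properties(1)[OF sqfree]
  and mem_I_iff = squarefree_monomial_ideal_properties(2)[OF sqfree]
  and \<Delta>_subset = squarefree_monomial_ideal_properties(3)[OF sqfree]
  and \<Delta>_subset_closed = squarefree_monomial_ideal_properties(4)[OF sqfree]

lemma cring_R: "cring R"
  unfolding sr_ring_def using ideal.quotient_is_cring[OF ideal_I cring_poly_ring] .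

lemma res_hom: "res \<in> ring_hom P R"
  using ideal.rcos_ring_hom[OF ideal_I] unfolding sr_ring_def residue_def .

lemma res_closed: "f \<in> carrier P \<Longrightarrow> res f \<in> carrier R"
  by (rule ring_hom_closed[OF res_hom])

lemma res_add: "f \<in> carrier P \<Longrightarrow> g \<in> carrier P \<Longrightarrow> res (f + g) = res f \<oplus>\<^bsub>R\<^esub> res g"
  using ring_hom_add[OF res_hom, of f g] by simp

lemma res_mult: "f \<in> carrier P \<Longrightarrow> g \<in> carrier P \<Longrightarrow> res (f * g) = res f \<otimes>\<^bsub>R\<^esub> res g"
  using ring_hom_mult[OF res_hom, of f g] by simp

lemma res_one: "res 1 = \<one>\<^bsub>R\<^esub>"
  using ring_hom_one[OF res_hom] by simp

lemma res_zero: "res 0 = \<zero>\<^bsub>R\<^esub>"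
  using ring_hom_zero[OF res_hom cring.axioms(1)[OF cring_poly_ring] cring.axioms(1)[OF cring_R]]
      by simp

lemma carrier_RE:
  assumes "x \<in> carrier R"
  obtains f where "f \<in> carrier P" "x = res f"
  using assms by (auto simp: sr_ring_def FactRing_def A_RCOSETS_def' residue_def a_r_coset_def')

lemma res_eq_iff:
  assumes "f \<in> carrier P" "g \<in> carrier P"
  shows "res f = res g \<longleftrightarrow> f - g \<in> I"
  using ring.quotient_eq_iff_same_a_r_cos[OF cring.axioms(1)[OF cring_poly_ring] ideal_I assms]
    a_minus_poly_ring[OF assms] by (simp add: residue_def)

lemma single_closed: "Poly_Mapping.keys u \<subseteq> Vset m \<union> Wset n \<Longrightarrow> Poly_Mapping.single u k \<in> carrier P"
  by simp

lemma mon_closed: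
  "J \<subseteq> {1..n} \<Longrightarrow> Poly_Mapping.keys b \<subseteq> Yv ` J \<Longrightarrow> Poly_Mapping.single b k \<in> carrier P"
  by (auto simp: Wset_def)

sublocale cech_data R y n
proof (rule cech_data.intro[OF cring_R], unfold_locales)
  fix j assume "j \<in> {1..n}"
  then show "res (indet (Yv j)) \<in> carrier R"
    by (intro res_closed) (auto simp: indet_def Wset_def)
qed

lemma y_pow:
  assumes "j \<in> {1..n}"
  shows "y j [^]\<^bsub>R\<^esub> (k::nat) = res (mon (Poly_Mapping.single (Yv j) k))"
proof (induction k)
  case 0
  then show ?case using res_one by simp
next
  case (Suc k)
  have mem: "mon (Poly_Mapping.single (Yv j) l) \<in> carrier P" for l :: nat
    using assms by (auto simp: Wset_def)
  have "y j [^]\<^bsub>R\<^esub> (Suc k) = res (mon (Poly_Mapping.single (Yv j) k)) \<otimes>\<^bsub>R\<^esub> res (mon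
      (Poly_Mapping.single (Yv j) 1))"
    using Suc by (simp add: indet_def)
  also have "\<dots> = res (mon (Poly_Mapping.single (Yv j) k) * mon (Poly_Mapping.single (Yv j) 1))"
    by (rule res_mult[symmetric, OF mem mem])
  also have "mon (Poly_Mapping.single (Yv j) k) * mon (Poly_Mapping.single (Yv j) 1) = mon
      (Poly_Mapping.single (Yv j) (Suc k))"
    by (simp add: mult_single flip: single_add)
  finally show ?case .
qed

lemma finprod_y_pow:
  fixes a :: "nat \<Rightarrow> nat"
  assumes "J \<subseteq> {1..n}"
  shows "finprod R (\<lambda>j. y j [^]\<^bsub>R\<^esub> a j) J = res (mon (\<Sum>j\<in>J. Poly_Mapping.single (Yv j) (a j)))"
proof -
  have "finite J" using assms finite_subset by blast
  then show ?thesis using assms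
  proof (induction J rule: finite_induct)
    case empty
    then show ?case using res_one by simp
  next
    case (insert j J)
    have mem: "mon (Poly_Mapping.single (Yv j) (a j)) \<in> carrier P"
      "mon (\<Sum>j\<in>J. Poly_Mapping.single (Yv j) (a j)) \<in> carrier P"
      using insert.prems keys_sum[of "\<lambda>j. Poly_Mapping.single (Yv j) (a j)" J]
      by (auto simp: Wset_def split: if_splits)
    have "finprod R (\<lambda>j. y j [^]\<^bsub>R\<^esub> a j) (insert j J) =
        y j [^]\<^bsub>R\<^esub> a j \<otimes>\<^bsub>R\<^esub> finprod R (\<lambda>j. y j [^]\<^bsub>R\<^esub> a j) J"
      using insert.hyps insert.prems y_closed by (intro finprod_insert) (auto simp: subset_iff)
    also have "\<dots> = res (mon (Poly_Mapping.single (Yv j) (a j)) * mon (\<Sum>j\<in>J. Poly_Mapping.single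
        (Yv j) (a j)))"
      using insert y_pow[of j] res_mult[OF mem] by simp
    finally show ?case using insert.hyps by (simp add: mult_single)
  qed
qed

lemma denoms_eq:
  assumes "J \<subseteq> {1..n}"
  shows "denoms R y J = {res (mon b) |b. Poly_Mapping.keys b \<subseteq> Yv ` J}"
proof (intro equalityI subsetI)
  fix s assume "s \<in> denoms R y J"
  then obtain a :: "nat \<Rightarrow> nat" where "s = finprod R (\<lambda>j. y j [^]\<^bsub>R\<^esub> a j) J" by (auto simp:
      denoms_def)
  then have "s = res (mon (\<Sum>j\<in>J. Poly_Mapping.single (Yv j) (a j)))" using finprod_y_pow[OF assms]
      by simp
  moreover have "Poly_Mapping.keys (\<Sum>j\<in>J. Poly_Mapping.single (Yv j) (a j)) \<subseteq> Yv ` J"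
    using keys_sum[of "\<lambda>j. Poly_Mapping.single (Yv j) (a j)" J] by (auto split: if_splits)
  ultimately show "s \<in> {res (mon b) |b. Poly_Mapping.keys b \<subseteq> Yv ` J}" by blast
next
  fix s assume "s \<in> {res (mon b) |b. Poly_Mapping.keys b \<subseteq> Yv ` J}"
  then obtain b where b: "s = res (mon b)" "Poly_Mapping.keys b \<subseteq> Yv ` J" by auto
  have fin: "finite J" using assms finite_subset by blast
  have "b = (\<Sum>j\<in>J. Poly_Mapping.single (Yv j) (Poly_Mapping.lookup b (Yv j)))"
  proof (rule poly_mapping_eqI)
    fix v
    have "(\<Sum>j\<in>J. Poly_Mapping.lookup b (Yv j) when Yv j = v) = Poly_Mapping.lookup b v"
    proof (cases "v \<in> Yv ` J")
      case True
      then obtain l where "v = Yv l" "l \<in> J" by auto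
      then show ?thesis using fin by (simp add: when_def)
    next
      case False
      then have "Poly_Mapping.lookup b v = 0" using b(2) by (auto simp: in_keys_iff)
      then show ?thesis using False by (auto simp: when_def intro!: sum.neutral)
    qed
    then show "Poly_Mapping.lookup b v =
        Poly_Mapping.lookup (\<Sum>j\<in>J. Poly_Mapping.single (Yv j) (Poly_Mapping.lookup b (Yv j))) v"
      by (simp add: lookup_sum lookup_single)
  qed
  then have "s = finprod R (\<lambda>j. y j [^]\<^bsub>R\<^esub> (Poly_Mapping.lookup b (Yv j))) J"
    using b(1) finprod_y_pow[OF assms, of "\<lambda>j. Poly_Mapping.lookup b (Yv j)"] by simp
  then show "s \<in> denoms R y J"
    unfolding denoms_def by (intro CollectI exI[of _ "\<lambda>j. Poly_Mapping.lookup b (Yv j)"]) simp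
qed

lemma mon_denoms: "J \<subseteq> {1..n} \<Longrightarrow> Poly_Mapping.keys b \<subseteq> Yv ` J \<Longrightarrow> res (mon b) \<in> denoms R y J"
  by (auto simp: denoms_eq)

abbreviation mfrac where "mfrac J f b \<equiv> frac R (denoms R y J) (res f) (res (mon b))"

lemma mfrac_closed:
  assumes "J \<subseteq> {1..n}" "f \<in> carrier P" "Poly_Mapping.keys b \<subseteq> Yv ` J"
  shows "mfrac J f b \<in> carrier (loc_at R y J)"
  using assms mult_submonoid.frac_closed[OF mult_submonoid_denoms] res_closed mon_denoms by blast

text \<open>Equality of fractions is lifted to polynomials, where membership in \<open>I\<close> can
  be tested monomial by monomial.\<close>

lemma mfrac_eqD:
  assumes J: "J \<subseteq> {1..n}" and f: "f \<in> carrier P" "g \<in> carrier P"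
    and b: "Poly_Mapping.keys b \<subseteq> Yv ` J" "Poly_Mapping.keys c \<subseteq> Yv ` J"
    and eq: "mfrac J f b = mfrac J g c"
  obtains t where "Poly_Mapping.keys t \<subseteq> Yv ` J" "mon t * (mon c * f) - mon t * (mon b * g) \<in> I"
proof -
  obtain s where s: "s \<in> denoms R y J" "s \<otimes>\<^bsub>R\<^esub> (res (mon c) \<otimes>\<^bsub>R\<^esub> res f) = s \<otimes>\<^bsub>R\<^esub> (res (mon b) \<otimes>\<^bsub>R\<^esub>
      res g)"
    using mult_submonoid.frac_eq_iff[OF mult_submonoid_denoms[OF J] res_closed[OF f(1)]
        res_closed[OF f(2)]
        mon_denoms[OF J b(1)] mon_denoms[OF J b(2)]] eq by blast
  obtain t where t: "s = res (mon t)" "Poly_Mapping.keys t \<subseteq> Yv ` J" using s(1) denoms_eq[OF J] by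
      auto
  note mem = mon_closed[OF J b(1)] mon_closed[OF J b(2)] mon_closed[OF J t(2)]
    f poly_ring_mult_closed[OF mon_closed[OF J b(2)] f(1)] poly_ring_mult_closed[OF mon_closed[OF
        J b(1)] f(2)]
  have "res (mon t * (mon c * f)) = res (mon t * (mon b * g))"
    using s(2) unfolding t(1) by (simp only: res_mult mem)
  then have "mon t * (mon c * f) - mon t * (mon b * g) \<in> I"
    using res_eq_iff[OF poly_ring_mult_closed[OF mem(3,6)] poly_ring_mult_closed[OF mem(3,7)]] by
        blast
  then show ?thesis using that t(2) by blast
qed

lemma mfrac_eqI:
  assumes J: "J \<subseteq> {1..n}" and f: "f \<in> carrier P" "g \<in> carrier P"
    and b: "Poly_Mapping.keys b \<subseteq> Yv ` J" "Poly_Mapping.keys c \<subseteq> Yv ` J"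
    and eq: "mon c * f = mon b * g"
  shows "mfrac J f b = mfrac J g c"
proof -
  have "res (mon c) \<otimes>\<^bsub>R\<^esub> res f = res (mon b) \<otimes>\<^bsub>R\<^esub> res g"
    using eq res_mult[OF mon_closed[OF J b(2)] f(1), of 1] res_mult[OF mon_closed[OF J b(1)] f(2),
        of 1] by simp
  then show ?thesis
    using mult_submonoid.frac_eqI[OF mult_submonoid_denoms[OF J] res_closed[OF f(1)] res_closed[OF
        f(2)]
        mon_denoms[OF J b(1)] mon_denoms[OF J b(2)]] by blast
qed

text \<open>The product of all \<open>y j\<close> with \<open>j \<in> J\<close> is a denominator,
  and it multiplies \<open>u\<close> to a monomial whose support is not a face, hence into
  \<open>I\<close>.\<close>

lemma mfrac_zeroI:
  assumes J: "J \<subseteq> {1..n}" and u: "Poly_Mapping.keys u \<subseteq> Vset m \<union> Wset n"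
    and b: "Poly_Mapping.keys b \<subseteq> Yv ` J" and \<Delta>: "Yv ` J \<union> Poly_Mapping.keys u \<notin> \<Delta>"
  shows "mfrac J (Poly_Mapping.single u k) b = \<zero>\<^bsub>loc_at R y J\<^esub>"
proof -
  interpret mult_submonoid R "denoms R y J" by (rule mult_submonoid_denoms[OF J])
  have "finite (Yv ` J)" using J finite_subset by blast
  then have t: "Poly_Mapping.keys (unit_exp (Yv ` J)) = Yv ` J" by (rule keys_unit_exp)
  let ?t = "mon (unit_exp (Yv ` J))"
  have tP: "?t \<in> carrier P" using mon_closed[OF J, of "unit_exp (Yv ` J)"] t by blast
  have "?t * Poly_Mapping.single u k \<in> I"
    unfolding mem_I_iff
  proof
    show "?t * Poly_Mapping.single u k \<in> carrier P"
      using poly_ring_mult_closed[OF tP single_closed[OF u]] .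
    show "\<forall>w\<in>Poly_Mapping.keys (?t * Poly_Mapping.single u k). Poly_Mapping.keys w \<notin> \<Delta>"
      using \<Delta> by (simp add: mult_single keys_add_nat t)
  qed
  then have "res (?t * Poly_Mapping.single u k) = res 0"
    using res_eq_iff poly_ring_mult_closed[OF tP single_closed[OF u]] by simp
  then have "res ?t \<otimes>\<^bsub>R\<^esub> res (Poly_Mapping.single u k) = \<zero>\<^bsub>R\<^esub>"
    using res_mult[OF tP single_closed[OF u]] res_zero by simp
  moreover have "res ?t \<in> denoms R y J" using mon_denoms[OF J, of "unit_exp (Yv ` J)"] t by blast
  ultimately show ?thesis
    using frac_eq_zero_iff[OF res_closed[OF single_closed[OF u]] mon_denoms[OF J b]]
    unfolding zero_localization by blast
qed

lemma mfrac_zero: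
  assumes "J \<subseteq> {1..n}" "Poly_Mapping.keys b \<subseteq> Yv ` J"
  shows "mfrac J 0 b = \<zero>\<^bsub>loc_at R y J\<^esub>"
  using mult_submonoid.frac_zero[OF mult_submonoid_denoms[OF assms(1)] mon_denoms[OF assms]]
      res_zero by simp

lemma carrier_locE:
  assumes J: "J \<subseteq> {1..n}" and x: "x \<in> carrier (loc_at R y J)"
  obtains f b where "f \<in> carrier P" "Poly_Mapping.keys b \<subseteq> Yv ` J" "x = mfrac J f b"
proof -
  obtain r s where r: "r \<in> carrier R" "s \<in> denoms R y J" "x = frac R (denoms R y J) r s"
    using mult_submonoid.carrier_localizationE[OF mult_submonoid_denoms[OF J] x] .
  obtain f where "f \<in> carrier P" "r = res f" using carrier_RE[OF r(1)] .
  moreover obtain b where "Poly_Mapping.keys b \<subseteq> Yv ` J" "s = res (mon b)"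
    using r(2) denoms_eq[OF J] by auto
  ultimately show ?thesis using that r(3) by blast
qed

lemma mfrac_add:
  assumes J: "J \<subseteq> {1..n}" and f: "f \<in> carrier P" "g \<in> carrier P"
    and b: "Poly_Mapping.keys b \<subseteq> Yv ` J" "Poly_Mapping.keys c \<subseteq> Yv ` J"
  shows "mfrac J f b \<oplus>\<^bsub>loc_at R y J\<^esub> mfrac J g c = mfrac J (f * mon c + g * mon b) (b + c)"
proof -
  note mem = mon_closed[OF J b(1), of 1] mon_closed[OF J b(2), of 1]
  have "res (f * mon c + g * mon b) = res f \<otimes>\<^bsub>R\<^esub> res (mon c) \<oplus>\<^bsub>R\<^esub> res g \<otimes>\<^bsub>R\<^esub> res (mon b)"
    unfolding res_add[OF poly_ring_mult_closed[OF f(1) mem(2)] poly_ring_mult_closed[OF f(2)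
        mem(1)]]
      res_mult[OF f(1) mem(2)] res_mult[OF f(2) mem(1)] ..
  moreover have "res (mon (b + c)) = res (mon b) \<otimes>\<^bsub>R\<^esub> res (mon c)"
    using res_mult[OF mem] by (simp add: mult_single)
  ultimately show ?thesis
    using mult_submonoid.add_frac[OF mult_submonoid_denoms[OF J] res_closed[OF f(1)] mon_denoms[OF
        J b(1)]
        res_closed[OF f(2)] mon_denoms[OF J b(2)]] by simp
qed

lemma mfrac_add_same:
  assumes J: "J \<subseteq> {1..n}" and f: "f \<in> carrier P" "g \<in> carrier P" and b: "Poly_Mapping.keys b \<subseteq> Yv
      ` J"
  shows "mfrac J f b \<oplus>\<^bsub>loc_at R y J\<^esub> mfrac J g b = mfrac J (f + g) b"
  using mult_submonoid.add_frac_same[OF mult_submonoid_denoms[OF J] res_closed[OF f(1)]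
      res_closed[OF f(2)]
      mon_denoms[OF J b]] res_add[OF f] by simp

lemma mfrac_smult:
  assumes J: "J \<subseteq> {1..n}" and f: "h \<in> carrier P" "f \<in> carrier P" and b: "Poly_Mapping.keys b \<subseteq> Yv
      ` J"
  shows "res h \<odot>\<^bsub>loc_at R y J\<^esub> mfrac J f b = mfrac J (h * f) b"
  using mult_submonoid.smult_frac[OF mult_submonoid_denoms[OF J] res_closed[OF f(1)] res_closed[OF
      f(2)]
      mon_denoms[OF J b]] res_mult[OF f] by simp

lemma loc_map_mfrac:
  assumes "J \<subseteq> L" "L \<subseteq> {1..n}" "f \<in> carrier P" "Poly_Mapping.keys b \<subseteq> Yv ` J"
  shows "loc_map R y L (mfrac J f b) = mfrac L f b"
  using assms by (intro loc_map_frac res_closed mon_denoms) auto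

lemma res_const_closed: "res (Poly_Mapping.single 0 a) \<in> carrier R"
  by (intro res_closed) simp

text \<open>As residues of constants, the signs of the Cech differential act as scalars of the
  field.\<close>

lemma cech_sign_eq: "cech_sign J j = res (Poly_Mapping.single 0 ((- 1) ^ card {l \<in> J. l < j}))"
proof -
  have const: "Poly_Mapping.single 0 a \<in> carrier P" for a :: 'k by simp
  have "res (Poly_Mapping.single 0 (- 1)) \<oplus>\<^bsub>R\<^esub> res 1 = \<zero>\<^bsub>R\<^esub>"
    using res_add[OF const[of "- 1"] const[of 1]] res_zero unfolding single_add[symmetric] by simp
  then have "res (Poly_Mapping.single 0 (- 1)) = \<ominus>\<^bsub>R\<^esub> \<one>\<^bsub>R\<^esub>"
    using res_one minus_equality[of "res (Poly_Mapping.single 0 (- 1))" "\<one>\<^bsub>R\<^esub>"] res_const_closed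
        by simp
  moreover have "res (Poly_Mapping.single 0 (- 1)) [^]\<^bsub>R\<^esub> k = res (Poly_Mapping.single 0 ((- 1) ^
      k))" for k :: nat
  proof (induction k)
    case 0
    then show ?case using res_one by simp
  next
    case (Suc k)
    then show ?case using res_mult[OF const[of "(- 1) ^ k"] const[of "- 1"]] by (simp add:
        mult_single)
  qed
  ultimately show ?thesis by (simp add: cech_sign_def)
qed

end

section \<open>Homogeneous fractions of a fixed degree, and the coefficient of a fraction in that
  degree\<close>

locale stanley_reisner_degree = stanley_reisner m n I for m n and I :: "'k::field mpol set" +
  fixes d :: deg
begin

abbreviation pos_exp where "pos_exp \<equiv> pos_part d"
abbreviation neg_exp where "neg_exp \<equiv> neg_part d"
abbreviation neg_supp where "neg_supp \<equiv> Poly_Mapping.keys (neg_part d)"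

definition admissible :: "nat set \<Rightarrow> bool" where
  "admissible J \<longleftrightarrow> J \<subseteq> {1..n} \<and> neg_supp \<subseteq> Yv ` J \<and> Yv ` J \<union> Poly_Mapping.keys pos_exp \<in> \<Delta>"

text \<open>
  The degree \<open>d\<close> part of the localization at \<open>J\<close> is the line spanned by \<open>pos_exp / neg_exp\<close> when
  \<open>J\<close> is admissible, and zero otherwise.
\<close>
definition graded_frac :: "nat set \<Rightarrow> 'k \<Rightarrow> ('k mpol set \<times> 'k mpol set) set" where
  "graded_frac J k = (if admissible J then mfrac J (Poly_Mapping.single pos_exp k) neg_exp else
      \<zero>\<^bsub>loc_at R y J\<^esub>)"

text \<open>
  The coefficient of \<open>f / b\<close> in degree \<open>d\<close> is that of \<open>f\<close> at the exponent \<open>d + b\<close>, which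
  may have negative entries; multiplying \<open>f\<close> by \<open>neg_exp\<close> first avoids them.
\<close>
definition shifted_coeff :: "'k mpol \<Rightarrow> (var \<Rightarrow>\<^sub>0 nat) \<Rightarrow> 'k" where
  "shifted_coeff f b = Poly_Mapping.lookup (mon neg_exp * f) (pos_exp + b)"

text \<open>
  This is independent of the representing fraction only if the index set together with the support
  of \<open>pos_exp\<close> is a face.
\<close>
definition graded_coeff :: "nat set \<Rightarrow> ('k mpol set \<times> 'k mpol set) set \<Rightarrow> 'k" where
  "graded_coeff J x = (SOME k. \<exists>f b. f \<in> carrier P \<and> Poly_Mapping.keys b \<subseteq> Yv ` J \<and> x = mfrac J f
      b \<and> k = shifted_coeff f b)"

lemma admissible_subset: "admissible J \<Longrightarrow> J \<subseteq> {1..n}"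
  by (simp add: admissible_def)

lemma pos_exp_closed:
  assumes "Yv ` J \<union> Poly_Mapping.keys pos_exp \<in> \<Delta>"
  shows "Poly_Mapping.keys pos_exp \<subseteq> Vset m \<union> Wset n" "Poly_Mapping.single pos_exp k \<in> carrier P"
proof -
  show "Poly_Mapping.keys pos_exp \<subseteq> Vset m \<union> Wset n" using assms \<Delta>_subset by blast
  then show "Poly_Mapping.single pos_exp k \<in> carrier P" by (rule single_closed)
qed

text \<open>If the coefficients differed, the difference of the cross-multiplied numerators, an
  element of \<open>I\<close>, would contain a monomial supported on the given face; but monomials
  of \<open>I\<close> have supports outside \<open>\<Delta>\<close>.\<close>

lemma shifted_coeff_well_defined:
  assumes J: "J \<subseteq> {1..n}" and \<Delta>: "Yv ` J \<union> Poly_Mapping.keys pos_exp \<in> \<Delta>"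
    and f: "f \<in> carrier P" "g \<in> carrier P"
    and b: "Poly_Mapping.keys b \<subseteq> Yv ` J" "Poly_Mapping.keys c \<subseteq> Yv ` J"
    and eq: "mfrac J f b = mfrac J g c"
  shows "shifted_coeff f b = shifted_coeff g c"
proof (rule ccontr)
  assume neq: "shifted_coeff f b \<noteq> shifted_coeff g c"
  obtain t where t: "Poly_Mapping.keys t \<subseteq> Yv ` J" "mon t * (mon c * f) - mon t * (mon b * g) \<in> I"
    using mfrac_eqD[OF J f b eq] .
  define D where "D = mon t * (mon c * f) - mon t * (mon b * g)"
  \<comment> \<open>The exponent at which the two cross terms of \<open>mon neg_exp * D\<close>
    carry the shifted coefficients of \<open>f\<close> and of \<open>g\<close>.\<close>
  define e where "e = t + (c + (pos_exp + b))"
  have e': "e = t + (b + (pos_exp + c))" by (simp add: e_def add_ac)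
  have "mon neg_exp * D = mon t * (mon c * (mon neg_exp * f)) - mon t * (mon b * (mon neg_exp * g))"
    by (simp add: D_def algebra_simps)
  then have "Poly_Mapping.lookup (mon neg_exp * D) e =
      Poly_Mapping.lookup (mon t * (mon c * (mon neg_exp * f))) (t + (c + (pos_exp + b))) -
      Poly_Mapping.lookup (mon t * (mon b * (mon neg_exp * g))) (t + (b + (pos_exp + c)))"
    by (simp add: lookup_minus flip: e' e_def)
  also have "\<dots> = shifted_coeff f b - shifted_coeff g c" by (simp only: lookup_single_times
      shifted_coeff_def mult_1)
  finally have "Poly_Mapping.lookup (mon neg_exp * D) e \<noteq> 0" using neq by simp
  then have "e \<in> Poly_Mapping.keys (mon neg_exp * D)" by (simp add: in_keys_iff)
  then obtain w where w: "w \<in> Poly_Mapping.keys D" "e = neg_exp + w"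
    using keys_mult[of "mon neg_exp" D] by auto
  have "Poly_Mapping.keys w \<notin> \<Delta>" using t(2) w(1) mem_I_iff unfolding D_def by blast
  moreover have "Poly_Mapping.keys w \<subseteq> Poly_Mapping.keys e" unfolding w(2) keys_add_nat by blast
  then have "Poly_Mapping.keys w \<subseteq> Yv ` J \<union> Poly_Mapping.keys pos_exp"
    using t(1) b unfolding e_def keys_add_nat by blast
  ultimately show False using \<Delta>_subset_closed[OF \<Delta>] by blast
qed

lemma graded_coeff_mfrac:
  assumes "J \<subseteq> {1..n}" "Yv ` J \<union> Poly_Mapping.keys pos_exp \<in> \<Delta>" "f \<in> carrier P"
    "Poly_Mapping.keys b \<subseteq> Yv ` J"
  shows "graded_coeff J (mfrac J f b) = shifted_coeff f b"
  unfolding graded_coeff_def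
proof (rule some_equality)
  show "\<exists>g c. g \<in> carrier P \<and> Poly_Mapping.keys c \<subseteq> Yv ` J \<and> mfrac J f b = mfrac J g c \<and>
      shifted_coeff f b = shifted_coeff g c"
    using assms by blast
  fix k assume "\<exists>g c. g \<in> carrier P \<and> Poly_Mapping.keys c \<subseteq> Yv ` J \<and> mfrac J f b = mfrac J g c \<and> k
      = shifted_coeff g c"
  then obtain g c where "g \<in> carrier P" "Poly_Mapping.keys c \<subseteq> Yv ` J" "mfrac J f b = mfrac J g c"
      "k = shifted_coeff g c"
    by (elim exE conjE)
  then show "k = shifted_coeff f b" using shifted_coeff_well_defined[OF assms(1,2,3) _ assms(4)]
      by metis
qed

lemma graded_coeff_add:
  assumes J: "J \<subseteq> {1..n}" and \<Delta>: "Yv ` J \<union> Poly_Mapping.keys pos_exp \<in> \<Delta>"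
    and x: "x \<in> carrier (loc_at R y J)" "z \<in> carrier (loc_at R y J)"
  shows "graded_coeff J (x \<oplus>\<^bsub>loc_at R y J\<^esub> z) = graded_coeff J x + graded_coeff J z"
proof -
  obtain f b where f: "f \<in> carrier P" "Poly_Mapping.keys b \<subseteq> Yv ` J" "x = mfrac J f b"
    using carrier_locE[OF J x(1)] .
  obtain g c where g: "g \<in> carrier P" "Poly_Mapping.keys c \<subseteq> Yv ` J" "z = mfrac J g c"
    using carrier_locE[OF J x(2)] .
  have mem: "f * mon c + g * mon b \<in> carrier P"
    using poly_ring_add_closed[OF poly_ring_mult_closed[OF f(1) mon_closed[OF J g(2)]]
        poly_ring_mult_closed[OF g(1) mon_closed[OF J f(2)]]] .
  have "graded_coeff J (x \<oplus>\<^bsub>loc_at R y J\<^esub> z) = shifted_coeff (f * mon c + g * mon b) (b + c)"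
    unfolding f(3) g(3) mfrac_add[OF J f(1) g(1) f(2) g(2)]
    using f(2) g(2) by (intro graded_coeff_mfrac[OF J \<Delta> mem]) (simp add: keys_add_nat)
  also have "\<dots> = Poly_Mapping.lookup (mon c * (mon neg_exp * f)) (c + (pos_exp + b)) +
      Poly_Mapping.lookup (mon b * (mon neg_exp * g)) (b + (pos_exp + c))"
    unfolding shifted_coeff_def lookup_add[symmetric]
    by (simp add: lookup_add algebra_simps)
  also have "\<dots> = shifted_coeff f b + shifted_coeff g c" by (simp only: lookup_single_times
      shifted_coeff_def mult_1)
  finally show ?thesis using f g graded_coeff_mfrac[OF J \<Delta>] by simp
qed

lemma graded_coeff_zero:
  assumes J: "J \<subseteq> {1..n}" and \<Delta>: "Yv ` J \<union> Poly_Mapping.keys pos_exp \<in> \<Delta>"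
  shows "graded_coeff J \<zero>\<^bsub>loc_at R y J\<^esub> = 0"
  using graded_coeff_mfrac[OF J \<Delta>, of 0 0] mfrac_zero[OF J, of 0] by (simp add: shifted_coeff_def)

lemma graded_coeff_smult:
  assumes J: "J \<subseteq> {1..n}" and \<Delta>: "Yv ` J \<union> Poly_Mapping.keys pos_exp \<in> \<Delta>"
    and x: "x \<in> carrier (loc_at R y J)"
  shows "graded_coeff J (res (Poly_Mapping.single 0 a) \<odot>\<^bsub>loc_at R y J\<^esub> x) = a * graded_coeff J x"
proof -
  obtain f b where f: "f \<in> carrier P" "Poly_Mapping.keys b \<subseteq> Yv ` J" "x = mfrac J f b"
    using carrier_locE[OF J x] .
  have const: "Poly_Mapping.single 0 a \<in> carrier P" by simp
  have "graded_coeff J (res (Poly_Mapping.single 0 a) \<odot>\<^bsub>loc_at R y J\<^esub> x) = shifted_coeff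
      (Poly_Mapping.single 0 a * f) b"
    unfolding f(3) mfrac_smult[OF J const f(1,2)]
    by (rule graded_coeff_mfrac[OF J \<Delta> poly_ring_mult_closed[OF const f(1)] f(2)])
  also have "\<dots> = Poly_Mapping.lookup (Poly_Mapping.single 0 a * (mon neg_exp * f)) (0 + (pos_exp +
      b))"
    by (simp add: shifted_coeff_def mult.left_commute)
  also have "\<dots> = a * shifted_coeff f b" by (simp only: lookup_single_times shifted_coeff_def)
  finally show ?thesis using f graded_coeff_mfrac[OF J \<Delta>] by simp
qed

lemma graded_coeff_finsum:
  assumes J: "J \<subseteq> {1..n}" and \<Delta>: "Yv ` J \<union> Poly_Mapping.keys pos_exp \<in> \<Delta>"
    and "finite A" "\<And>j. j \<in> A \<Longrightarrow> h j \<in> carrier (loc_at R y J)"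
  shows "graded_coeff J (finsum (loc_at R y J) h A) = (\<Sum>j\<in>A. graded_coeff J (h j))"
proof -
  interpret loc: abelian_group "loc_at R y J" by (rule abelian_group_loc[OF J])
  show ?thesis using assms(3,4)
  proof (induction A rule: finite_induct)
    case empty
    then show ?case using graded_coeff_zero[OF J \<Delta>] by simp
  next
    case (insert j A)
    have "finsum (loc_at R y J) h A \<in> carrier (loc_at R y J)"
      using insert.prems by (intro loc.finsum_closed) auto
    then show ?case using insert graded_coeff_add[OF J \<Delta>]
      by (subst loc.finsum_insert) auto
  qed
qed

text \<open>The localization map keeps the representing fraction, hence its coefficient. If
  \<open>Yv j\<close> is in the negative support, no denominator at \<open>L - {j}\<close> supplies
  the negative power of \<open>y j\<close> that degree \<open>d\<close> demands.\<close>

lemma graded_coeff_loc_map: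
  assumes L: "L \<subseteq> {1..n}" and \<Delta>: "Yv ` L \<union> Poly_Mapping.keys pos_exp \<in> \<Delta>" and j: "j \<in> L"
    and x: "x \<in> carrier (loc_at R y (L - {j}))"
  shows "graded_coeff L (loc_map R y L x) = (if Yv j \<in> neg_supp then 0 else graded_coeff (L - {j})
      x)"
proof -
  have J: "L - {j} \<subseteq> {1..n}" "L - {j} \<subseteq> L" using L by auto
  have \<Delta>J: "Yv ` (L - {j}) \<union> Poly_Mapping.keys pos_exp \<in> \<Delta>" by (rule \<Delta>_subset_closed[OF \<Delta>]) blast
  obtain f b where f: "f \<in> carrier P" "Poly_Mapping.keys b \<subseteq> Yv ` (L - {j})" "x = mfrac (L - {j})
      f b"
    using carrier_locE[OF J(1) x] .
  have b: "Poly_Mapping.keys b \<subseteq> Yv ` L" using f(2) by blast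
  have "graded_coeff L (loc_map R y L x) = shifted_coeff f b"
    unfolding f(3) loc_map_mfrac[OF J(2) L f(1,2)] by (rule graded_coeff_mfrac[OF L \<Delta> f(1) b])
  moreover have "shifted_coeff f b = 0" if "Yv j \<in> neg_supp"
  proof -
    \<comment> \<open>Otherwise \<open>neg_exp\<close> would divide, and as the positive support
      avoids \<open>Yv j\<close>, the denominator would have to involve \<open>Yv j\<close>.\<close>
    have "pos_exp + b \<noteq> neg_exp + u" for u
    proof
      assume "pos_exp + b = neg_exp + u"
      then have "neg_supp \<subseteq> Poly_Mapping.keys pos_exp \<union> Poly_Mapping.keys b" by (metis
          keys_add_nat Un_upper1)
      then have "Yv j \<in> Poly_Mapping.keys b" using that keys_pos_neg_disjoint[of d] by blast
      then show False using f(2) by auto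
    qed
    then show ?thesis unfolding shifted_coeff_def by (rule lookup_single_times_not)
  qed
  moreover have "graded_coeff (L - {j}) x = shifted_coeff f b" unfolding f(3) by (rule
      graded_coeff_mfrac[OF J(1) \<Delta>J f(1,2)])
  ultimately show ?thesis by simp
qed

lemma graded_frac_closed: "J \<subseteq> {1..n} \<Longrightarrow> graded_frac J k \<in> carrier (loc_at R y J)"
  using abelian_monoid.zero_closed[OF abelian_group.axioms(1)[OF abelian_group_loc]]
  by (auto simp: graded_frac_def admissible_def intro!: mfrac_closed pos_exp_closed(2))

lemma graded_frac_zero: "J \<subseteq> {1..n} \<Longrightarrow> graded_frac J 0 = \<zero>\<^bsub>loc_at R y J\<^esub>"
  by (simp add: graded_frac_def admissible_def mfrac_zero)

lemma graded_frac_add: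
  assumes "J \<subseteq> {1..n}"
  shows "graded_frac J (k + l) = graded_frac J k \<oplus>\<^bsub>loc_at R y J\<^esub> graded_frac J l"
proof -
  interpret loc: abelian_group "loc_at R y J" by (rule abelian_group_loc[OF assms])
  show ?thesis
  proof (cases "admissible J")
    case True
    have "mfrac J (Poly_Mapping.single pos_exp k) neg_exp \<oplus>\<^bsub>loc_at R y J\<^esub> mfrac J
        (Poly_Mapping.single pos_exp l) neg_exp =
        mfrac J (Poly_Mapping.single pos_exp k + Poly_Mapping.single pos_exp l) neg_exp"
      using True unfolding admissible_def by (intro mfrac_add_same pos_exp_closed(2)) auto
    then show ?thesis using True by (simp add: graded_frac_def single_add)
  qed (simp add: graded_frac_def)
qed

lemma graded_frac_smult:
  assumes "J \<subseteq> {1..n}"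
  shows "res (Poly_Mapping.single 0 a) \<odot>\<^bsub>loc_at R y J\<^esub> graded_frac J k = graded_frac J (a * k)"
proof (cases "admissible J")
  case True
  have "res (Poly_Mapping.single 0 a) \<odot>\<^bsub>loc_at R y J\<^esub> mfrac J (Poly_Mapping.single pos_exp k)
      neg_exp =
      mfrac J (Poly_Mapping.single 0 a * Poly_Mapping.single pos_exp k) neg_exp"
    using True unfolding admissible_def by (intro mfrac_smult pos_exp_closed(2)) auto
  then show ?thesis using True by (simp add: graded_frac_def mult_single)
next
  case False
  then show ?thesis
    using module.smult_r_null[OF module_loc[OF assms] res_const_closed] by (simp add:
        graded_frac_def)
qed

lemma graded_frac_finsum:
  assumes "J \<subseteq> {1..n}" "finite A"
  shows "finsum (loc_at R y J) (\<lambda>x. graded_frac J (h x)) A = graded_frac J (\<Sum>x\<in>A. h x)"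
proof -
  interpret loc: abelian_group "loc_at R y J" by (rule abelian_group_loc[OF assms(1)])
  show ?thesis using assms(2)
    by (induction A rule: finite_induct) 
      (simp_all add: graded_frac_zero[OF assms(1)] graded_frac_add[OF assms(1)]
          graded_frac_closed[OF assms(1)])
qed

text \<open>Adding a negative index starts from the zero component. Adding another index keeps the
  fraction, which dies in the target by \<open>mfrac_zeroI\<close> if the face condition is lost;
  and if \<open>L\<close> is admissible, so is \<open>L - {j}\<close>.\<close>

lemma loc_map_graded_frac:
  assumes L: "L \<subseteq> {1..n}" and j: "j \<in> L"
  shows "loc_map R y L (graded_frac (L - {j}) k) = graded_frac L (if Yv j \<in> neg_supp then 0 else k)"
proof -
  have J: "L - {j} \<subseteq> {1..n}" "L - {j} \<subseteq> L" using L by auto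
  show ?thesis
  proof (cases "admissible (L - {j})")
    case True
    then have notin: "Yv j \<notin> neg_supp" and neg_supp: "neg_supp \<subseteq> Yv ` L" and NFJ: "neg_supp \<subseteq> Yv `
        (L - {j})"
      and \<Delta>: "Yv ` (L - {j}) \<union> Poly_Mapping.keys pos_exp \<in> \<Delta>" by (auto simp: admissible_def)
    have "loc_map R y L (graded_frac (L - {j}) k) = mfrac L (Poly_Mapping.single pos_exp k) neg_exp"
      using True NFJ pos_exp_closed(2)[OF \<Delta>] loc_map_mfrac[OF J(2) L] by (simp add: graded_frac_def)
    also have "\<dots> = graded_frac L k"
    proof (cases "admissible L")
      case False
      then have "Yv ` L \<union> Poly_Mapping.keys pos_exp \<notin> \<Delta>" using neg_supp L by (simp add:
          admissible_def)
      then show ?thesis using False mfrac_zeroI[OF L pos_exp_closed(1)[OF \<Delta>] neg_supp] by (simp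
          add: graded_frac_def)
    qed (simp add: graded_frac_def)
    finally show ?thesis using notin by simp
  next
    case False
    \<comment> \<open>The zero of the source is written as the fraction \<open>0 / 1\<close>, to
      which \<open>loc_map_mfrac\<close> applies.\<close>
    have "loc_map R y L (graded_frac (L - {j}) k) = loc_map R y L (mfrac (L - {j}) 0 0)"
      using False mfrac_zero[OF J(1), of 0] by (simp add: graded_frac_def)
    also have "\<dots> = \<zero>\<^bsub>loc_at R y L\<^esub>"
      using loc_map_mfrac[OF J(2) L, of 0 0] mfrac_zero[OF L, of 0] by simp
    also have "\<dots> = graded_frac L (if Yv j \<in> neg_supp then 0 else k)"
    proof (cases "Yv j \<in> neg_supp")
      case True
      then show ?thesis using graded_frac_zero[OF L] by simp
    next
      case notin: False
      have "\<not> admissible L"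
      proof
        assume "admissible L"
        then have "neg_supp \<subseteq> Yv ` L" "Yv ` L \<union> Poly_Mapping.keys pos_exp \<in> \<Delta>" by (auto simp:
            admissible_def)
        then have "neg_supp \<subseteq> Yv ` (L - {j})" "Yv ` (L - {j}) \<union> Poly_Mapping.keys pos_exp \<in> \<Delta>"
          using notin \<Delta>_subset_closed[of "Yv ` L \<union> Poly_Mapping.keys pos_exp"
              "Yv ` (L - {j}) \<union> Poly_Mapping.keys pos_exp"] by blast+
        then show False using \<open>\<not> admissible (L - {j})\<close> J(1) by (simp add: admissible_def)
      qed
      then show ?thesis by (simp add: graded_frac_def)
    qed
    finally show ?thesis .
  qed
qed

lemma graded_coeff_graded_frac: "admissible J \<Longrightarrow> graded_coeff J (graded_frac J k) = k"
  using graded_coeff_mfrac[of J "Poly_Mapping.single pos_exp k" neg_exp] pos_exp_closed(2)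
  by (auto simp: admissible_def graded_frac_def shifted_coeff_def mult_single add.commute)

text \<open>A nonzero monomial denominator determines its own degree, so all monomials of the
  numerator share one exponent. The fraction is thus a single term over a monomial, and it equals a
  multiple of \<open>pos_exp / neg_exp\<close> or vanishes.\<close>

lemma loc_component_iff:
  assumes J: "J \<subseteq> {1..n}"
  shows "x \<in> loc_component R (sr_component m n I) (denoms R y J) d \<longleftrightarrow> (\<exists>k. x = graded_frac J k)"
proof
  assume "\<exists>k. x = graded_frac J k"
  then obtain k where k: "x = graded_frac J k" ..
  show "x \<in> loc_component R (sr_component m n I) (denoms R y J) d"
  proof (cases "admissible J")
    case True
    then have neg_supp: "neg_supp \<subseteq> Yv ` J" and \<Delta>: "Yv ` J \<union> Poly_Mapping.keys pos_exp \<in> \<Delta>" by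
        (simp_all add: admissible_def)
    have u: "Poly_Mapping.single pos_exp k \<in> carrier P" by (rule pos_exp_closed(2)[OF \<Delta>])
    have "res (mon neg_exp) \<in> sr_component m n I (Poly_Mapping.map int neg_exp)"
      unfolding sr_component_def poly_component_def using mon_closed[OF J neg_supp, of 1] by auto
    moreover have "Poly_Mapping.map int pos_exp = d + Poly_Mapping.map int neg_exp"
      by (simp add: degree_shift_iff add.commute)
    then have "res (Poly_Mapping.single pos_exp k) \<in> sr_component m n I (d + Poly_Mapping.map int
        neg_exp)"
      unfolding sr_component_def poly_component_def using u by auto
    moreover have "x = mfrac J (Poly_Mapping.single pos_exp k) neg_exp" using True k by (simp add:
        graded_frac_def)
    ultimately show ?thesis unfolding loc_component_def using mon_denoms[OF J neg_supp] by blast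
  next
    case False
    then have "x = mfrac J 0 0" using k mfrac_zero[OF J, of 0] by (simp add: graded_frac_def)
    moreover have "res (mon 0) \<in> sr_component m n I 0"
      unfolding sr_component_def poly_component_def
      by (intro imageI) (auto intro!: poly_mapping_eqI simp: lookup_map_int)
    moreover have "res 0 \<in> sr_component m n I (d + 0)"
      unfolding sr_component_def poly_component_def by (intro imageI) auto
    moreover have "res (mon 0) \<in> denoms R y J" by (rule mon_denoms[OF J]) simp
    ultimately show ?thesis unfolding loc_component_def by blast
  qed
next
  assume "x \<in> loc_component R (sr_component m n I) (denoms R y J) d"
  then obtain r s e where x: "x = frac R (denoms R y J) r s" "s \<in> denoms R y J"
    "s \<in> sr_component m n I e" "r \<in> sr_component m n I (d + e)"
    unfolding loc_component_def by blast
  interpret loc: mult_submonoid R "denoms R y J" by (rule mult_submonoid_denoms[OF J])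
  obtain b where b: "s = res (mon b)" "Poly_Mapping.keys b \<subseteq> Yv ` J" using x(2) denoms_eq[OF J] by
      auto
  obtain g where g: "s = res g" "g \<in> carrier P" "\<forall>u\<in>Poly_Mapping.keys g. Poly_Mapping.map int u = e"
    using x(3) unfolding sr_component_def poly_component_def by blast
  obtain f where f: "r = res f" "f \<in> carrier P" "\<forall>u\<in>Poly_Mapping.keys f. Poly_Mapping.map int u =
      d + e"
    using x(4) unfolding sr_component_def poly_component_def by blast
  have bP: "mon b \<in> carrier P" by (rule mon_closed[OF J b(2)])
  show "\<exists>k. x = graded_frac J k"
  \<comment> \<open>The zero residue lies in every component, so it carries no information about
    degrees; the fraction vanishes in these cases.\<close>
  proof (cases "f = 0 \<or> s = \<zero>\<^bsub>R\<^esub>")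
    case True
    have "r \<in> carrier R" "s \<in> carrier R" unfolding f(1) b(1)
      by (rule res_closed[OF f(2)], rule res_closed[OF bP])
    moreover have "r = \<zero>\<^bsub>R\<^esub> \<or> s = \<zero>\<^bsub>R\<^esub>" using True res_zero f(1) by blast
    ultimately have "s \<otimes>\<^bsub>R\<^esub> r = \<zero>\<^bsub>R\<^esub>" by (elim disjE) (simp_all only: l_null r_null)
    then have "x = \<zero>\<^bsub>loc_at R y J\<^esub>"
      unfolding x(1) loc.zero_localization loc.frac_eq_zero_iff[OF \<open>r \<in> carrier R\<close> x(2)]
      using x(2) by blast
    then show ?thesis using graded_frac_zero[OF J] by metis
  next
    case False
    \<comment> \<open>The homogeneous representative \<open>g\<close> may differ from
      \<open>mon b\<close>, but only by an element of \<open>I\<close>; as the support of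
      \<open>b\<close> is a face, \<open>b\<close> has to occur in \<open>g\<close>, which fixes
      \<open>e\<close>.\<close>
    have "mon b - g \<in> I" using res_eq_iff[OF bP g(2)] b(1) g(1) by simp
    moreover have "mon b \<notin> I" using False res_eq_iff[OF bP, of 0] res_zero b(1) by simp
    then have "Poly_Mapping.keys b \<in> \<Delta>" using bP unfolding mem_I_iff by simp
    ultimately have "b \<notin> Poly_Mapping.keys (mon b - g)" unfolding mem_I_iff by blast
    then have "b \<in> Poly_Mapping.keys g" by (auto simp: in_keys_iff lookup_minus)
    then have e: "e = Poly_Mapping.map int b" using g(3) by simp
    have "Poly_Mapping.keys f \<noteq> {}" using False by simp
    then obtain u where u: "u \<in> Poly_Mapping.keys f" by blast
    have keys: "neg_exp + w = pos_exp + b" if "w \<in> Poly_Mapping.keys f" for w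
      using f(3) that unfolding e degree_shift_iff by blast
    then have "w = u" if "w \<in> Poly_Mapping.keys f" for w
      using that u by (metis add_left_cancel)
    then have "Poly_Mapping.keys f = {u}" using u by blast
    define k where "k = Poly_Mapping.lookup f u"
    have fk: "f = Poly_Mapping.single u k"
      using mpol_eq_sum_monomials[of f] \<open>Poly_Mapping.keys f = {u}\<close> by (simp add: k_def)
    have au: "neg_exp + u = pos_exp + b" using keys u by blast
    have keys_eq: "neg_supp \<union> Poly_Mapping.keys u = Poly_Mapping.keys pos_exp \<union> Poly_Mapping.keys b"
      using au by (metis keys_add_nat)
    \<comment> \<open>The positive part avoids \<open>neg_supp\<close>, so the negative part must be
      covered by the denominator.\<close>
    have neg_supp: "neg_supp \<subseteq> Yv ` J" using keys_eq keys_pos_neg_disjoint[of d] b(2) by blast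
    have uu: "Poly_Mapping.keys u \<subseteq> Vset m \<union> Wset n" using f(2) u unfolding poly_ring_simps by blast
    show ?thesis
    proof (cases "admissible J")
      case True
      have "mfrac J (Poly_Mapping.single u k) b = mfrac J (Poly_Mapping.single pos_exp k) neg_exp"
        using True b(2) au unfolding admissible_def
        by (intro mfrac_eqI[OF J] single_closed[OF uu] pos_exp_closed(2)) (auto simp: mult_single
            add.commute)
      then show ?thesis using True x(1) f(1) b(1) fk by (auto simp: graded_frac_def)
    next
      case False
      then have "Yv ` J \<union> Poly_Mapping.keys pos_exp \<notin> \<Delta>" using neg_supp J by (simp add:
          admissible_def)
      moreover have "Poly_Mapping.keys pos_exp \<subseteq> Poly_Mapping.keys u"
        using keys_eq keys_pos_neg_disjoint[of d] by blast
      ultimately have "Yv ` J \<union> Poly_Mapping.keys u \<notin> \<Delta>"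
        using \<Delta>_subset_closed[of "Yv ` J \<union> Poly_Mapping.keys u" "Yv ` J \<union> Poly_Mapping.keys
            pos_exp"] by blast
      then have "x = \<zero>\<^bsub>loc_at R y J\<^esub>"
        using mfrac_zeroI[OF J uu b(2)] x(1) f(1) b(1) fk by simp
      then show ?thesis using graded_frac_zero[OF J] by metis
    qed
  qed
qed

end

section \<open>Homogeneous Cech cochains as simplicial cochains\<close>

context stanley_reisner_degree
begin

text \<open>The admissible index sets with the negative support deleted. The condition
  \<open>neg_supp \<subseteq> Wset n\<close> makes the complex void in degrees that are negative at
  some \<open>Xv p\<close>.\<close>

definition deg_complex :: "var set set" where
  "deg_complex = {s. s \<subseteq> Wset n \<and> s \<inter> neg_supp = {} \<and> neg_supp \<subseteq> Wset n \<and> s \<union> neg_supp \<union>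
      Poly_Mapping.keys pos_exp \<in> \<Delta>}"

definition face :: "nat set \<Rightarrow> var set" where
  "face J = Yv ` J - neg_supp"

definition face_index :: "var set \<Rightarrow> nat set" where
  "face_index s = Yv -` (s \<union> neg_supp)"

text \<open>The sign of the shuffle that lists the vertices of \<open>face J\<close> before those of
  \<open>neg_supp\<close>: it counts pairs of a vertex of \<open>face J\<close> and a smaller one of
  \<open>neg_supp\<close>.\<close>

definition face_sign :: "nat set \<Rightarrow> 'k" where
  "face_sign J = (\<Prod>l\<in>{l \<in> J. Yv l \<notin> neg_supp}. (- 1) ^ card {u \<in> neg_supp. u < Yv l})"

sublocale deg_complex: finite_complex deg_complex
proof
  have "deg_complex \<subseteq> Pow (Wset n)" by (auto simp: deg_complex_def)
  moreover have "finite (Wset n)" by (simp add: Wset_def)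
  ultimately show "finite deg_complex" and "\<And>s. s \<in> deg_complex \<Longrightarrow> finite s"
    by (auto intro: finite_subset)
  show "s - {v} \<in> deg_complex" if "s \<in> deg_complex" for s v
    using that \<Delta>_subset_closed[of "s \<union> neg_supp \<union> Poly_Mapping.keys pos_exp" "s - {v} \<union> neg_supp \<union>
        Poly_Mapping.keys pos_exp"]
    unfolding deg_complex_def by blast
qed

lemma admissible_face:
  assumes "admissible J"
  shows "face J \<in> deg_complex" "face J \<union> neg_supp = Yv ` J" "int (card (face J)) = int (card J) -
      int (card neg_supp)"
    "face_index (face J) = J"
proof -
  have J: "J \<subseteq> {1..n}" "neg_supp \<subseteq> Yv ` J" "Yv ` J \<union> Poly_Mapping.keys pos_exp \<in> \<Delta>" using assms by
      (auto simp: admissible_def)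
  show un: "face J \<union> neg_supp = Yv ` J" using J(2) by (auto simp: face_def)
  have "Yv ` J \<subseteq> Wset n" unfolding Wset_def using J(1) by (rule image_mono)
  then show "face J \<in> deg_complex" using J un by (auto simp: deg_complex_def face_def)
  have "card (Yv ` J) = card J" by (intro card_image) (auto simp: inj_on_def)
  moreover have "finite (Yv ` J)" using J(1) finite_subset by blast
  then have "card (face J) = card (Yv ` J) - card neg_supp" "card neg_supp \<le> card (Yv ` J)"
    using J(2) by (auto simp: face_def card_Diff_subset card_mono)
  ultimately show "int (card (face J)) = int (card J) - int (card neg_supp)" by simp
  show "face_index (face J) = J" unfolding face_index_def un by (auto simp: inj_on_def)
qed

lemma deg_complex_face_index:
  assumes "s \<in> deg_complex"
  shows "admissible (face_index s)" "face (face_index s) = s"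
proof -
  have s: "s \<subseteq> Wset n" "s \<inter> neg_supp = {}" "neg_supp \<subseteq> Wset n" "s \<union> neg_supp \<union> Poly_Mapping.keys
      pos_exp \<in> \<Delta>"
    using assms by (auto simp: deg_complex_def)
  have eq: "Yv ` face_index s = s \<union> neg_supp" using s(1,3) by (auto simp: face_index_def Wset_def)
  show "face (face_index s) = s" unfolding face_def eq using s(2) by blast
  have "face_index s \<subseteq> {1..n}" using s(1,3) by (auto simp: face_index_def Wset_def)
  then show "admissible (face_index s)" using eq s(4) by (simp add: admissible_def)
qed

lemma admissible_remove:
  assumes "admissible J" "Yv j \<notin> neg_supp"
  shows "admissible (J - {j})" "face (J - {j}) = face J - {Yv j}"
proof -
  have J: "J \<subseteq> {1..n}" "neg_supp \<subseteq> Yv ` J" "Yv ` J \<union> Poly_Mapping.keys pos_exp \<in> \<Delta>" using assms by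
      (auto simp: admissible_def)
  have eq: "Yv ` (J - {j}) = Yv ` J - {Yv j}" by auto
  have "Yv ` (J - {j}) \<union> Poly_Mapping.keys pos_exp \<in> \<Delta>"
    by (rule \<Delta>_subset_closed[OF J(3)]) (use eq in blast)
  moreover have "neg_supp \<subseteq> Yv ` (J - {j})" unfolding eq using J(2) assms(2) by blast
  moreover have "J - {j} \<subseteq> {1..n}" using J(1) by blast
  ultimately show "admissible (J - {j})" by (simp only: admissible_def)
  show "face (J - {j}) = face J - {Yv j}" unfolding face_def eq by blast
qed

lemma face_sign_square: "face_sign J * face_sign J = 1"
  unfolding face_sign_def prod.distrib[symmetric] by (intro prod.neutral) (simp flip: power_add)

lemma face_sign_square_mult: "face_sign J * (face_sign J * x) = x"
  by (simp add: face_sign_square flip: mult.assoc)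

text \<open>
  Deleting the negative part from the index sets changes the signs of the Cech differential into
  those of the simplicial coboundary up to the coboundary of \<open>face_sign\<close>.
\<close>
lemma sign_face_sign:
  assumes "admissible J" "j \<in> J" "Yv j \<notin> neg_supp"
  shows "(- 1) ^ card {l \<in> J. l < j} * face_sign (J - {j}) = face_sign J * sgn_at (face J) (Yv j)"
proof -
  have J: "J \<subseteq> {1..n}" "neg_supp \<subseteq> Yv ` J" using assms by (auto simp: admissible_def)
  have fin: "finite J" using J finite_subset by blast
  have less: "Yv l < Yv j \<longleftrightarrow> l < j" for l by (auto simp: less_var_def)
  define a where "a = card {u \<in> neg_supp. u < Yv j}"
  have "card {l \<in> J. l < j} = card (Yv ` {l \<in> J. l < j})"
    by (intro card_image[symmetric]) (auto simp: inj_on_def)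
  also have "Yv ` {l \<in> J. l < j} = {u \<in> face J. u < Yv j} \<union> {u \<in> neg_supp. u < Yv j}"
    using J(2) less by (auto simp: face_def)
  also have "card \<dots> = card {u \<in> face J. u < Yv j} + a"
    unfolding a_def using deg_complex.finite_face[OF admissible_face(1)[OF assms(1)]]
    by (intro card_Un_disjoint) (auto simp: face_def)
  finally have card: "card {l \<in> J. l < j} = card {u \<in> face J. u < Yv j} + a" .
  have "{l \<in> J. Yv l \<notin> neg_supp} = insert j {l \<in> J - {j}. Yv l \<notin> neg_supp}" using assms by auto
  then have "face_sign J = (- 1) ^ a * face_sign (J - {j})" unfolding face_sign_def a_def using
      fin by simp
  then show ?thesis unfolding card by (simp add: sgn_at_def power_add mult_ac)
qed

text \<open>The Cech sum without its terms at negative indices is the simplicial coboundary twisted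
  by \<open>face_sign\<close>. It is applied to homogeneous cochains and to the coefficients of
  arbitrary ones.\<close>

lemma sum_sign_face_sign:
  assumes "admissible J"
  shows "(\<Sum>j\<in>J. if Yv j \<in> neg_supp then 0 else
      (- 1) ^ card {l \<in> J. l < j} * (face_sign (J - {j}) * g (face (J - {j})))) =
    face_sign J * (\<Sum>v\<in>face J. sgn_at (face J) v * g (face J - {v}))"
proof -
  have fin: "finite J" using admissible_subset[OF assms] finite_subset by blast
  have "(\<Sum>j\<in>J. if Yv j \<in> neg_supp then 0 else
      (- 1) ^ card {l \<in> J. l < j} * (face_sign (J - {j}) * g (face (J - {j})))) =
    (\<Sum>j\<in>{j \<in> J. Yv j \<notin> neg_supp}.
      (- 1) ^ card {l \<in> J. l < j} * (face_sign (J - {j}) * g (face (J - {j}))))"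
    using fin by (intro sum.mono_neutral_cong_right) auto
  also have "\<dots> = (\<Sum>j\<in>{j \<in> J. Yv j \<notin> neg_supp}. face_sign J * (sgn_at (face J) (Yv j) * g (face J -
      {Yv j})))"
  proof (rule sum.cong)
    fix j assume "j \<in> {j \<in> J. Yv j \<notin> neg_supp}"
    then have j: "j \<in> J" "Yv j \<notin> neg_supp" by auto
    show "(- 1) ^ card {l \<in> J. l < j} * (face_sign (J - {j}) * g (face (J - {j}))) =
        face_sign J * (sgn_at (face J) (Yv j) * g (face J - {Yv j}))"
      unfolding mult.assoc[symmetric] sign_face_sign[OF assms j] admissible_remove(2)[OF assms
          j(2)] ..
  qed simp
  also have "\<dots> = face_sign J * (\<Sum>j\<in>{j \<in> J. Yv j \<notin> neg_supp}. sgn_at (face J) (Yv j) * g (face J -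
      {Yv j}))"
    by (rule sum_distrib_left[symmetric])
  also have "(\<Sum>j\<in>{j \<in> J. Yv j \<notin> neg_supp}. sgn_at (face J) (Yv j) * g (face J - {Yv j})) =
      (\<Sum>v\<in>Yv ` {j \<in> J. Yv j \<notin> neg_supp}. sgn_at (face J) v * g (face J - {v}))"
    by (subst sum.reindex) (auto simp: inj_on_def)
  also have "Yv ` {j \<in> J. Yv j \<notin> neg_supp} = face J" by (auto simp: face_def)
  finally show ?thesis .
qed

abbreviation face_degree :: "int \<Rightarrow> int" where "face_degree i \<equiv> i - int (card neg_supp)"

lemma face_faces: "admissible J \<Longrightarrow> J \<in> cech_index n i \<Longrightarrow> face J \<in> faces deg_complex (face_degree i)"
  using admissible_face by (auto simp: faces_def cech_index_def)

lemma face_index_cech_index: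
  assumes "s \<in> faces deg_complex (face_degree i)"
  shows "face_index s \<in> cech_index n i"
proof -
  have s: "s \<in> deg_complex" "int (card s) = face_degree i" using assms by (auto simp: faces_def)
  show ?thesis
    using admissible_face(3)[OF deg_complex_face_index(1)[OF s(1)]] deg_complex_face_index(2)[OF
        s(1)] s(2) admissible_subset[OF deg_complex_face_index(1)[OF s(1)]]
    by (simp add: cech_index_def)
qed

text \<open>The factor \<open>face_sign\<close> is built in so that the Cech differential becomes
  the plain coboundary. At index sets that are not admissible the value is zero whatever
  \<open>g\<close> is.\<close>

definition graded_cochain :: "int \<Rightarrow> (var set \<Rightarrow> 'k) \<Rightarrow> nat set \<Rightarrow> ('k mpol set \<times> 'k mpol set) set"
    where
  "graded_cochain i g = (\<lambda>J\<in>cech_index n i. graded_frac J (face_sign J * g (face J)))"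

lemma graded_cochain_closed: "graded_cochain i g \<in> carrier (cech R y n i)"
  using graded_frac_closed[OF cech_indexD] by (auto simp: cech_def graded_cochain_def)

lemma graded_cochain_add: "graded_cochain i (g + h) = graded_cochain i g \<oplus>\<^bsub>cech R y n i\<^esub>
    graded_cochain i h"
proof
  fix J
  show "graded_cochain i (g + h) J = (graded_cochain i g \<oplus>\<^bsub>cech R y n i\<^esub> graded_cochain i h) J"
  proof (cases "J \<in> cech_index n i")
    case True
    then show ?thesis using graded_frac_add[OF cech_indexD[OF True]] by (simp add:
        graded_cochain_def cech_def distrib_left)
  qed (simp add: graded_cochain_def cech_def)
qed

lemma graded_cochain_scale: "graded_cochain i (fscale a g) = res (Poly_Mapping.single 0 a) \<odot>\<^bsub>cech
    R y n i\<^esub> graded_cochain i g"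
proof
  fix J
  show "graded_cochain i (fscale a g) J = (res (Poly_Mapping.single 0 a) \<odot>\<^bsub>cech R y n i\<^esub>
      graded_cochain i g) J"
  proof (cases "J \<in> cech_index n i")
    case True
    then show ?thesis
      using graded_frac_smult[OF cech_indexD[OF True]] by (simp add: graded_cochain_def cech_def
          mult.left_commute)
  qed (simp add: graded_cochain_def cech_def)
qed

lemma graded_cochain_zero: "graded_cochain i 0 = \<zero>\<^bsub>cech R y n i\<^esub>"
proof
  fix J
  show "graded_cochain i 0 J = \<zero>\<^bsub>cech R y n i\<^esub> J"
  proof (cases "J \<in> cech_index n i")
    case True
    then show ?thesis using graded_frac_zero[OF cech_indexD[OF True]] by (simp add:
        graded_cochain_def cech_def)
  qed (simp add: graded_cochain_def cech_def)
qed

lemma graded_cochain_apply: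
  assumes "s \<in> faces deg_complex (face_degree i)"
  shows "graded_coeff (face_index s) (graded_cochain i g (face_index s)) = face_sign (face_index
      s) * g s"
proof -
  have s: "s \<in> deg_complex" using assms by (simp add: faces_def)
  show ?thesis using graded_coeff_graded_frac[OF deg_complex_face_index(1)[OF s]]
      face_index_cech_index[OF assms] deg_complex_face_index(2)[OF s]
    by (simp add: graded_cochain_def)
qed

lemma graded_cochain_inj:
  assumes "g \<in> supp_on (faces deg_complex (face_degree i))" "h \<in> supp_on (faces deg_complex
      (face_degree i))" "graded_cochain i g = graded_cochain i h"
  shows "g = h"
proof
  fix s
  show "g s = h s"
  proof (cases "s \<in> faces deg_complex (face_degree i)")
    case True
    then have "face_sign (face_index s) * g s = face_sign (face_index s) * h s" using
        graded_cochain_apply assms(3) by metis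
    then have "face_sign (face_index s) * (face_sign (face_index s) * g s) = face_sign (face_index
        s) * (face_sign (face_index s) * h s)" by simp
    then show ?thesis by (simp add: face_sign_square_mult)
  next
    case False
    then show ?thesis using assms(1,2) by (simp add: supp_on_def)
  qed
qed

lemma cech_component_eq:
  "cech_component R (sr_component m n I) y n i d = graded_cochain i ` supp_on (faces deg_complex
      (face_degree i))"
proof (intro equalityI subsetI)
  fix c assume "c \<in> graded_cochain i ` supp_on (faces deg_complex (face_degree i))"
  then show "c \<in> cech_component R (sr_component m n I) y n i d"
    using loc_component_iff[OF cech_indexD] by (auto simp: cech_component_def graded_cochain_def)
next
  fix c assume c: "c \<in> cech_component R (sr_component m n I) y n i d"
  have "\<forall>J\<in>cech_index n i. \<exists>k. c J = graded_frac J k"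
    using PiE_mem[OF c[unfolded cech_component_def]] loc_component_iff[OF cech_indexD] by blast
  then obtain k where k: "\<And>J. J \<in> cech_index n i \<Longrightarrow> c J = graded_frac J (k J)" by metis
  \<comment> \<open>\<open>face_sign\<close> is its own inverse, so this factor undoes the twist in
    \<open>graded_cochain\<close>.\<close>
  define g where "g s = (if s \<in> faces deg_complex (face_degree i) then face_sign (face_index s) *
      k (face_index s) else 0)" for s
  have "c = graded_cochain i g"
  proof
    fix J
    show "c J = graded_cochain i g J"
    proof (cases "J \<in> cech_index n i")
      case True
      show ?thesis
      proof (cases "admissible J")
        case admissible: True
        then have "face_sign J * g (face J) = k J"
          using face_faces[OF admissible True] admissible_face(4)[OF admissible] by (simp add:
              g_def face_sign_square_mult)
        then show ?thesis using True k by (simp add: graded_cochain_def)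
      qed (use True k in \<open>simp add: graded_cochain_def graded_frac_def\<close>)
    next
      case False
      then show ?thesis using c by (auto simp: cech_component_def graded_cochain_def PiE_def
          extensional_def)
    qed
  qed
  moreover have "g \<in> supp_on (faces deg_complex (face_degree i))" by (simp add: g_def supp_on_def)
  ultimately show "c \<in> graded_cochain i ` supp_on (faces deg_complex (face_degree i))" by blast
qed

text \<open>The localization maps only suppress the terms at negative indices, and
  \<open>sum_sign_face_sign\<close> identifies what remains. At inadmissible \<open>J\<close> both
  sides are zero.\<close>

lemma cech_diff_graded_cochain: "cech_diff R y n i (graded_cochain i g) = graded_cochain (i + 1)
    (deg_complex.cobd (face_degree i) g)"
proof
  fix J
  show "cech_diff R y n i (graded_cochain i g) J = graded_cochain (i + 1) (deg_complex.cobd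
      (face_degree i) g) J"
  proof (cases "J \<in> cech_index n (i + 1)")
    case True
    have J: "J \<subseteq> {1..n}" using cech_indexD[OF True] .
    interpret loc: abelian_group "loc_at R y J" by (rule abelian_group_loc[OF J])
    let ?h = "\<lambda>j. if Yv j \<in> neg_supp then 0 else
      (- 1) ^ card {l \<in> J. l < j} * (face_sign (J - {j}) * g (face (J - {j})))"
    have "cech_diff R y n i (graded_cochain i g) J = finsum (loc_at R y J) (\<lambda>j. graded_frac J (?h
        j)) J"
      unfolding cech_diff_apply[OF True]
    proof (rule loc.finsum_cong')
      fix j assume j: "j \<in> J"
      have "graded_cochain i g (J - {j}) = graded_frac (J - {j}) (face_sign (J - {j}) * g (face (J
          - {j})))"
        using cech_index_remove[OF True j] by (simp add: graded_cochain_def)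
      then have "cech_sign J j \<odot>\<^bsub>loc_at R y J\<^esub> loc_map R y J (graded_cochain i g (J - {j})) =
          graded_frac J ((- 1) ^ card {l \<in> J. l < j} *
            (if Yv j \<in> neg_supp then 0 else face_sign (J - {j}) * g (face (J - {j}))))"
        unfolding cech_sign_eq by (simp only: loc_map_graded_frac[OF J j] graded_frac_smult[OF J])
      then show "cech_sign J j \<odot>\<^bsub>loc_at R y J\<^esub> loc_map R y J (graded_cochain i g (J - {j})) =
          graded_frac J (?h j)"
        by simp
    qed (use graded_frac_closed[OF J] in auto)
    also have "\<dots> = graded_frac J (\<Sum>j\<in>J. ?h j)"
      using J finite_subset by (intro graded_frac_finsum) auto
    also have "\<dots> = graded_frac J (face_sign J * deg_complex.cobd (face_degree i) g (face J))"
    proof (cases "admissible J")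
      case admissible: True
      have "face J \<in> faces deg_complex (face_degree i + 1)"
        using face_faces[OF admissible True] by (simp add: algebra_simps)
      then show ?thesis unfolding sum_sign_face_sign[OF admissible] by (simp add:
          deg_complex.cobd_apply)
    qed (simp add: graded_frac_def)
    finally show ?thesis using True by (simp add: graded_cochain_def)
  qed (simp add: graded_cochain_def cech_diff_def)
qed

text \<open>The primitive \<open>c\<close> may be inhomogeneous. Taking coefficients in degree
  \<open>d\<close> is additive and compatible with the localization maps, so the coefficients of
  \<open>c\<close>, untwisted by \<open>face_sign\<close>, form a simplicial primitive of
  \<open>g\<close>.\<close>

lemma graded_cochain_eq_cech_diff:
  assumes g: "g \<in> supp_on (faces deg_complex (face_degree i + 1))"
    and c: "c \<in> carrier (cech R y n i)" "graded_cochain (i + 1) g = cech_diff R y n i c"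
  shows "g \<in> deg_complex.cobd (face_degree i) ` supp_on (faces deg_complex (face_degree i))"
proof
  define h where "h t = (if t \<in> faces deg_complex (face_degree i) then face_sign (face_index t) *
      graded_coeff (face_index t) (c (face_index t)) else 0)" for t
  show "h \<in> supp_on (faces deg_complex (face_degree i))" by (simp add: h_def supp_on_def)
  show "g = deg_complex.cobd (face_degree i) h"
  proof
    fix s
    show "g s = deg_complex.cobd (face_degree i) h s"
    proof (cases "s \<in> faces deg_complex (face_degree i + 1)")
      case False
      then show ?thesis using g by (simp add: mat_op_def supp_on_def)
    next
      case True
      define J where "J = face_index s"
      have eq: "face_degree (i + 1) = face_degree i + 1" by simp
      have s: "s \<in> deg_complex" using True by (simp add: faces_def)
      have admissible: "admissible J" and face: "face J = s" unfolding J_def using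
          deg_complex_face_index[OF s] .
      have Ji: "J \<in> cech_index n (i + 1)" unfolding J_def by (rule face_index_cech_index) (simp
          only: eq True)
      have J: "J \<subseteq> {1..n}" using cech_indexD[OF Ji] .
      have \<Delta>: "Yv ` J \<union> Poly_Mapping.keys pos_exp \<in> \<Delta>" using admissible by (simp add:
          admissible_def)
      have "face_sign J * g s = graded_coeff J (cech_diff R y n i c J)"
        using graded_cochain_apply[of s "i + 1" g] True unfolding J_def eq c(2) by simp
      also have "\<dots> = (\<Sum>j\<in>J. graded_coeff J (cech_sign J j \<odot>\<^bsub>loc_at R y J\<^esub> loc_map R y J (c (J -
          {j}))))"
        unfolding cech_diff_apply[OF Ji] using J finite_subset
        by (intro graded_coeff_finsum[OF J \<Delta>] cech_summand_closed(2)[OF Ji c(1)]) auto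
      also have "\<dots> = (\<Sum>j\<in>J. if Yv j \<in> neg_supp then 0 else
          (- 1) ^ card {l \<in> J. l < j} * (face_sign (J - {j}) * h (face (J - {j}))))"
      proof (rule sum.cong)
        fix j assume j: "j \<in> J"
        have "graded_coeff J (cech_sign J j \<odot>\<^bsub>loc_at R y J\<^esub> loc_map R y J (c (J - {j}))) =
            (- 1) ^ card {l \<in> J. l < j} * graded_coeff J (loc_map R y J (c (J - {j})))"
          unfolding cech_sign_eq by (rule graded_coeff_smult[OF J \<Delta> cech_summand_closed(1)[OF Ji
              c(1) j]])
        also have "graded_coeff J (loc_map R y J (c (J - {j}))) = (if Yv j \<in> neg_supp then 0 else
            graded_coeff (J - {j}) (c (J - {j})))"
          by (rule graded_coeff_loc_map[OF J \<Delta> j carrier_cech_apply[OF c(1) cech_index_remove[OF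
              Ji j]]])
        finally have *: "graded_coeff J (cech_sign J j \<odot>\<^bsub>loc_at R y J\<^esub> loc_map R y J (c (J -
            {j}))) =
            (- 1) ^ card {l \<in> J. l < j} * (if Yv j \<in> neg_supp then 0 else graded_coeff (J - {j})
                (c (J - {j})))" .
        show "graded_coeff J (cech_sign J j \<odot>\<^bsub>loc_at R y J\<^esub> loc_map R y J (c (J - {j}))) =
            (if Yv j \<in> neg_supp then 0 else (- 1) ^ card {l \<in> J. l < j} * (face_sign (J - {j}) * h
                (face (J - {j}))))"
        proof (cases "Yv j \<in> neg_supp")
          case False
          have "face_sign (J - {j}) * h (face (J - {j})) = graded_coeff (J - {j}) (c (J - {j}))"
            using face_faces[OF admissible_remove(1)[OF admissible False] cech_index_remove[OF Ji
                j]]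
              admissible_face(4)[OF admissible_remove(1)[OF admissible False]] by (simp add: h_def
                  face_sign_square_mult)
          then show ?thesis using * False by simp
        qed (use * in simp)
      qed simp
      also have "\<dots> = face_sign J * deg_complex.cobd (face_degree i) h s"
        unfolding sum_sign_face_sign[OF admissible] face deg_complex.cobd_apply[OF True] ..
      finally have "face_sign J * (face_sign J * g s) = face_sign J * (face_sign J *
          deg_complex.cobd (face_degree i) h s)" by simp
      then show ?thesis by (simp add: face_sign_square_mult)
    qed
  qed
qed

text \<open>\<open>graded_cochain\<close> maps simplicial cocycles onto homogeneous Cech cocycles,
  and a cocycle represents the zero class exactly when it is a simplicial coboundary;
  \<open>vs_dim_image\<close> then counts.\<close>

lemma vs_dim_local_cohomology:
  "vs_dim (sr_local_cohomology m n I i d) = enat (deg_complex.coh_dim TYPE('k) (i - int (card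
      neg_supp) - 1))"
proof -
  \<comment> \<open>A simplicial degree: faces with \<open>c + 1\<close> vertices correspond to
    admissible index sets of size \<open>i\<close>, which contain \<open>neg_supp\<close> in
    addition.\<close>
  define c where "c = i - int (card neg_supp) - 1"
  have c: "c = face_degree (i - 1)" "c + 1 = face_degree i" "c + 1 + 1 = face_degree (i + 1)" by
      (simp_all add: c_def)
  let ?C = "cech R y n i"
  define N where "N = cech_coboundaries R y n i"
  define S where "S = faces deg_complex (c + 1)"
  define Z :: "(var set \<Rightarrow> 'k) set" where "Z = {f \<in> supp_on S. deg_complex.cobd (c + 1) f = 0}"
  define Q where "Q = sr_local_cohomology m n I i d"
  let ?\<Psi> = "\<lambda>f. N +>\<^bsub>?C\<^esub> graded_cochain i f"
  have group: "abelian_group ?C" using module_cech module.axioms(2) by blast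
  have sub: "additive_subgroup N ?C" unfolding N_def by (rule additive_subgroup_coboundaries)
  have ZS: "Z \<subseteq> supp_on S" by (auto simp: Z_def)
  have carrier: "carrier Q = (\<lambda>x. N +>\<^bsub>?C\<^esub> x) `
      (cech_cocycles R y n i \<inter> cech_component R (sr_component m n I) y n i d)"
    by (simp add: Q_def sr_local_cohomology_def Let_def local_cohomology_component_def N_def)
  have zero: "\<zero>\<^bsub>Q\<^esub> = \<zero>\<^bsub>local_cohomology R y n i\<^esub>"
    and add: "add Q = add (local_cohomology R y n i)"
    and smult: "\<And>a h. a \<odot>\<^bsub>Q\<^esub> h = res (Poly_Mapping.single 0 a) \<odot>\<^bsub>local_cohomology R y n i\<^esub> h"
    by (simp_all add: Q_def sr_local_cohomology_def Let_def)
  have H: "local_cohomology R y n i = quot_module (?C\<lparr>carrier := cech_cocycles R y n i\<rparr>) N"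
    by (simp add: local_cohomology_def N_def)
  have cocycle: "graded_cochain i f \<in> cech_cocycles R y n i \<longleftrightarrow> deg_complex.cobd (c + 1) f = 0" for
      f :: "var set \<Rightarrow> 'k"
  proof -
    have "graded_cochain i f \<in> cech_cocycles R y n i \<longleftrightarrow> graded_cochain (i + 1) (deg_complex.cobd
        (face_degree i) f) = graded_cochain (i + 1) 0"
      using graded_cochain_closed by (simp add: cech_cocycles_def cech_diff_graded_cochain
          graded_cochain_zero)
    also have "\<dots> \<longleftrightarrow> deg_complex.cobd (face_degree i) f = 0"
    proof
      assume "graded_cochain (i + 1) (deg_complex.cobd (face_degree i) f) = graded_cochain (i + 1)
          0"
      moreover have "deg_complex.cobd (face_degree i) f \<in> supp_on (faces deg_complex (face_degree
          (i + 1)))"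
        unfolding c(3)[symmetric] c(2)[symmetric] by (rule mat_op_supp_on)
      ultimately show "deg_complex.cobd (face_degree i) f = 0"
        using fv.subspace_0[OF subspace_supp_on] graded_cochain_inj by blast
    qed simp
    finally show ?thesis using c(2) by simp
  qed
  have image: "cech_cocycles R y n i \<inter> cech_component R (sr_component m n I) y n i d =
      graded_cochain i ` Z"
    unfolding cech_component_eq Z_def S_def c(2)[symmetric] using cocycle by blast
  have \<Psi>0: "?\<Psi> f = \<zero>\<^bsub>Q\<^esub> \<longleftrightarrow> f \<in> deg_complex.cobd c ` supp_on (faces deg_complex c)" if f: "f \<in>
      supp_on S" for f
  proof -
    have "?\<Psi> f = \<zero>\<^bsub>Q\<^esub> \<longleftrightarrow> graded_cochain i f \<in> N"
      unfolding zero H by (rule quot_module_coset_zero[OF group sub graded_cochain_closed])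
    also have "\<dots> \<longleftrightarrow> f \<in> deg_complex.cobd c ` supp_on (faces deg_complex c)"
    proof
      \<comment> \<open>\<open>N\<close> also contains coboundaries of inhomogeneous cochains, so
        the primitive \<open>b\<close> has to be replaced by its degree \<open>d\<close>
        coefficients.\<close>
      assume "graded_cochain i f \<in> N"
      then obtain b where "b \<in> carrier (cech R y n (i - 1))" "graded_cochain i f = cech_diff R y n
          (i - 1) b"
        unfolding N_def cech_coboundaries_def by (rule imageE)
      then show "f \<in> deg_complex.cobd c ` supp_on (faces deg_complex c)"
        using graded_cochain_eq_cech_diff[of f "i - 1" b] f c(1) by (simp add: S_def)
    next
      assume "f \<in> deg_complex.cobd c ` supp_on (faces deg_complex c)"
      then obtain g where "f = deg_complex.cobd c g" by blast
      then have "graded_cochain i f = cech_diff R y n (i - 1) (graded_cochain (i - 1) g)"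
        using cech_diff_graded_cochain[of "i - 1" g] c(1) by simp
      then show "graded_cochain i f \<in> N" unfolding N_def cech_coboundaries_def using
          graded_cochain_closed by (rule image_eqI)
    qed
    finally show ?thesis .
  qed
  have fin: "finite S" unfolding S_def by (rule deg_complex.finite_faces)
  have "vs_dim Q = enat (fv.dim Z - fv.dim {f \<in> Z. ?\<Psi> f = \<zero>\<^bsub>Q\<^esub>})"
  proof (rule fv.vs_dim_image)
    show "fv.subspace Z" unfolding Z_def by (rule subspace_mat_op_kernel)
    show "finite (unit_fun ` S :: (var set \<Rightarrow> 'k) set)" using fin by simp
    show "Z \<subseteq> fv.span (unit_fun ` S)" using supp_on_subset_span[OF fin] ZS by blast
    show "carrier Q = ?\<Psi> ` Z" by (simp add: carrier image image_image)
    show "?\<Psi> 0 = \<zero>\<^bsub>Q\<^esub>"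
      using \<Psi>0[of 0] fv.subspace_0[OF subspace_mat_op_image] fv.subspace_0[OF subspace_supp_on] by
          blast
    show "?\<Psi> (f + g) = ?\<Psi> f \<oplus>\<^bsub>Q\<^esub> ?\<Psi> g" for f g
      unfolding add H graded_cochain_add by (rule quot_module_add[OF group sub
          graded_cochain_closed graded_cochain_closed, symmetric])
    show "?\<Psi> (fscale a f) = a \<odot>\<^bsub>Q\<^esub> ?\<Psi> f" for a f
      unfolding smult H graded_cochain_scale
    proof (rule quot_module_smult[OF group sub graded_cochain_closed, symmetric])
      let ?a = "res (Poly_Mapping.single 0 a)"
      have a: "?a \<in> carrier R" by (rule res_const_closed)
      show "?a \<odot>\<^bsub>?C\<^esub> q \<in> carrier ?C" if "q \<in> carrier ?C" for q
        using module.smult_closed[OF module_cech a that] .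
      show "?a \<odot>\<^bsub>?C\<^esub> q \<in> N" if "q \<in> N" for q
        using coboundaries_smult[OF _ a] that unfolding N_def by blast
      show "?a \<odot>\<^bsub>?C\<^esub> (q \<oplus>\<^bsub>?C\<^esub> r) = ?a \<odot>\<^bsub>?C\<^esub> q \<oplus>\<^bsub>?C\<^esub> ?a \<odot>\<^bsub>?C\<^esub> r"
        if "q \<in> carrier ?C" "r \<in> carrier ?C" for q r
        using module.smult_r_distr[OF module_cech a that] .
    qed
  qed
  also have "{f \<in> Z. ?\<Psi> f = \<zero>\<^bsub>Q\<^esub>} = deg_complex.cobd c ` supp_on (faces deg_complex c)"
  proof (intro equalityI subsetI)
    fix f :: "var set \<Rightarrow> 'k" assume "f \<in> deg_complex.cobd c ` supp_on (faces deg_complex c)"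
    then obtain g where g: "f = deg_complex.cobd c g" "f \<in> deg_complex.cobd c ` supp_on (faces
        deg_complex c)" by blast
    have "f \<in> supp_on S" unfolding g(1) S_def by (rule mat_op_supp_on)
    moreover have "deg_complex.cobd (c + 1) f = 0" unfolding g(1) by (rule deg_complex.cobd_cobd)
    ultimately show "f \<in> {f \<in> Z. ?\<Psi> f = \<zero>\<^bsub>Q\<^esub>}" using \<Psi>0 g(2) by (simp add: Z_def)
  next
    fix f assume "f \<in> {f \<in> Z. ?\<Psi> f = \<zero>\<^bsub>Q\<^esub>}"
    then show "f \<in> deg_complex.cobd c ` supp_on (faces deg_complex c)" using \<Psi>0 ZS by blast
  qed
  finally show ?thesis unfolding Q_def deg_complex.coh_dim_def Z_def S_def c_def .
qed

end

section \<open>Hilbert series\<close>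

text \<open>\<open>Q\<close> describes the exponents that occur, \<open>k \<ge> 1\<close> or
  \<open>k \<le> - 1\<close>. A choice of one power per variable is determined by the sum of the
  exponents, and excluding \<open>0\<close> forces every variable of \<open>A\<close> to
  occur.\<close>

lemma series_prod_geometric:
  fixes Q :: "int \<Rightarrow> bool"
  assumes "finite A" "\<not> Q 0"
    and f: "\<And>v e. f v e = (if \<exists>k. Q k \<and> e = Poly_Mapping.single v k then 1 else 0)"
  shows "series_prod f A d =
    (if Poly_Mapping.keys d = A \<and> (\<forall>v\<in>A. Q (Poly_Mapping.lookup d v)) then 1 else 0)"
proof -
  define X where "X = {a \<in> A \<rightarrow>\<^sub>E UNIV. (\<Sum>v\<in>A. a v) = d \<and> (\<forall>v\<in>A. f v (a v) \<noteq> 0)}"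
  define a0 where "a0 = (\<lambda>v\<in>A. Poly_Mapping.single v (Poly_Mapping.lookup d v))"
  have X: "Poly_Mapping.keys d = A \<and> (\<forall>v\<in>A. Q (Poly_Mapping.lookup d v)) \<and> a = a0" if a: "a \<in> X"
      for a
  proof -
    have "\<forall>v\<in>A. \<exists>k. Q k \<and> a v = Poly_Mapping.single v k" using a f by (auto simp: X_def split:
        if_splits)
    then obtain k where k: "\<And>v. v \<in> A \<Longrightarrow> Q (k v) \<and> a v = Poly_Mapping.single v (k v)" by metis
    have "Poly_Mapping.lookup d w = (if w \<in> A then k w else 0)" for w
    proof -
      have "Poly_Mapping.lookup d w = (\<Sum>v\<in>A. Poly_Mapping.lookup (a v) w)"
        using a by (auto simp: X_def lookup_sum)
      also have "\<dots> = (\<Sum>v\<in>A. if v = w then k v else 0)"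
        using k by (intro sum.cong) (auto simp: lookup_single when_def)
      finally show ?thesis using assms(1) by simp
    qed
    moreover from this have "Poly_Mapping.keys d = A"
      using k assms(2) by (auto simp: in_keys_iff split: if_splits) metis
    moreover have "a \<in> extensional A" using a by (auto simp: X_def PiE_def)
    ultimately show ?thesis using k by (auto simp: a0_def extensional_def)
  qed
  show ?thesis
  proof (cases "Poly_Mapping.keys d = A \<and> (\<forall>v\<in>A. Q (Poly_Mapping.lookup d v))")
    case True
    have "(\<Sum>v\<in>A. a0 v) = d"
    proof (rule poly_mapping_eqI)
      fix w
      have "Poly_Mapping.lookup (\<Sum>v\<in>A. a0 v) w = (\<Sum>v\<in>A. if v = w then Poly_Mapping.lookup d v else
          0)"
        unfolding lookup_sum by (intro sum.cong) (auto simp: a0_def lookup_single when_def)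
      also have "\<dots> = Poly_Mapping.lookup d w"
        using True assms(1) by (auto simp: in_keys_iff)
      finally show "Poly_Mapping.lookup (\<Sum>v\<in>A. a0 v) w = Poly_Mapping.lookup d w" .
    qed
    moreover have fa0: "f v (a0 v) = 1" if "v \<in> A" for v
      using True that by (auto simp: f a0_def)
    ultimately have "a0 \<in> X" by (auto simp: X_def a0_def)
    then have "X = {a0}" using X by blast
    then have "series_prod f A d = (\<Prod>v\<in>A. f v (a0 v))" by (simp add: series_prod_def X_def)
    then show ?thesis using True fa0 by simp
  next
    case False
    then have "X = {}" using X by blast
    then have "series_prod f A d = 0" unfolding series_prod_def X_def by (simp only: sum.empty)
    then show ?thesis using False by simp
  qed
qed

lemma series_prod_geom_pos:
  assumes "finite A"
  shows "series_prod geom_pos A d =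
    (if Poly_Mapping.keys d = A \<and> (\<forall>v\<in>A. Poly_Mapping.lookup d v \<ge> 1) then 1 else 0)"
  by (rule series_prod_geometric[OF assms]) (auto simp: geom_pos_def)

lemma series_prod_geom_neg:
  assumes "finite A"
  shows "series_prod geom_neg A d =
    (if Poly_Mapping.keys d = A \<and> (\<forall>v\<in>A. Poly_Mapping.lookup d v \<le> - 1) then 1 else 0)"
proof (rule series_prod_geometric[OF assms])
  have "(\<exists>k\<ge>1. e = Poly_Mapping.single v (- k)) \<longleftrightarrow> (\<exists>k\<le>- 1. e = Poly_Mapping.single v k)"
    for v and e :: deg
    by (metis minus_minus neg_le_iff_le)
  then show "geom_neg v e = (if \<exists>k\<le>- 1. e = Poly_Mapping.single v k then 1 else 0)" for v e
    by (simp add: geom_neg_def)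
qed simp

text \<open>As \<open>F\<close> and \<open>G\<close> are disjoint, positive and negative exponents
  cannot cancel, so the only possible splitting of \<open>d\<close> is into its positive and
  negative parts.\<close>

lemma series_mult_geometric:
  assumes "finite F" "finite G" "F \<inter> G = {}"
  shows "series_mult (series_prod geom_pos G) (series_prod geom_neg F) d =
    (if Poly_Mapping.keys (pos_part d) = G \<and> Poly_Mapping.keys (neg_part d) = F then 1 else 0)"
proof -
  let ?f = "series_prod geom_pos G" and ?g = "series_prod geom_neg F"
  define a0 where "a0 = Poly_Mapping.map int (pos_part d)"
  define b0 where "b0 = - Poly_Mapping.map int (neg_part d)"
  have a0: "Poly_Mapping.lookup a0 v = (if Poly_Mapping.lookup d v > 0 then Poly_Mapping.lookup d
      v else 0)"
    and b0: "Poly_Mapping.lookup b0 v = (if Poly_Mapping.lookup d v < 0 then Poly_Mapping.lookup d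
        v else 0)" for v
    by (auto simp: a0_def b0_def lookup_map_int lookup_pos_part lookup_neg_part)
  define X where "X = {(a, b). a + b = d \<and> ?f a \<noteq> 0 \<and> ?g b \<noteq> 0}"
  have X: "Poly_Mapping.keys (pos_part d) = G \<and> Poly_Mapping.keys (neg_part d) = F \<and> a = a0 \<and> b =
      b0"
    if ab: "(a, b) \<in> X" for a b
  proof -
    have d: "Poly_Mapping.lookup d v = Poly_Mapping.lookup a v + Poly_Mapping.lookup b v" for v
      using ab by (auto simp: X_def lookup_add)
    have a: "Poly_Mapping.keys a = G" "\<And>v. v \<in> G \<Longrightarrow> Poly_Mapping.lookup a v \<ge> 1"
      using ab by (auto simp: X_def series_prod_geom_pos[OF assms(2)] split: if_splits)
    have b: "Poly_Mapping.keys b = F" "\<And>v. v \<in> F \<Longrightarrow> Poly_Mapping.lookup b v \<le> - 1"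
      using ab by (auto simp: X_def series_prod_geom_neg[OF assms(1)] split: if_splits)
    have G: "v \<in> G \<Longrightarrow> Poly_Mapping.lookup b v = 0 \<and> Poly_Mapping.lookup d v \<ge> 1"
      and F: "v \<in> F \<Longrightarrow> Poly_Mapping.lookup a v = 0 \<and> Poly_Mapping.lookup d v \<le> - 1"
      and N: "v \<notin> G \<Longrightarrow> v \<notin> F \<Longrightarrow> Poly_Mapping.lookup a v = 0 \<and> Poly_Mapping.lookup b v = 0"
      for v
    proof -
      show "Poly_Mapping.lookup b v = 0 \<and> Poly_Mapping.lookup d v \<ge> 1" if "v \<in> G"
        using that a(2)[OF that] assms(3) b(1) d[of v] by (auto simp: in_keys_iff)
      show "Poly_Mapping.lookup a v = 0 \<and> Poly_Mapping.lookup d v \<le> - 1" if "v \<in> F"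
        using that b(2)[OF that] assms(3) a(1) d[of v] by (auto simp: in_keys_iff)
      show "Poly_Mapping.lookup a v = 0 \<and> Poly_Mapping.lookup b v = 0" if "v \<notin> G" "v \<notin> F"
        using that a(1) b(1) by (auto simp: in_keys_iff)
    qed
    have iff: "v \<in> G \<longleftrightarrow> Poly_Mapping.lookup d v > 0" "v \<in> F \<longleftrightarrow> Poly_Mapping.lookup d v < 0" for v
      using G[of v] F[of v] N[of v] d[of v] by (cases "v \<in> G"; cases "v \<in> F"; force)+
    have "a = a0"
      using G F N d iff by (intro poly_mapping_eqI) (metis a0 add.right_neutral)
    moreover have "b = b0"
      using G F N d iff by (intro poly_mapping_eqI) (metis b0 add.left_neutral)
    ultimately show ?thesis using iff by (auto simp: keys_pos_part keys_neg_part)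
  qed
  show ?thesis
  proof (cases "Poly_Mapping.keys (pos_part d) = G \<and> Poly_Mapping.keys (neg_part d) = F")
    case True
    have "a0 + b0 = d" by (intro poly_mapping_eqI) (simp add: lookup_add a0 b0)
    moreover have "?f a0 = 1"
      using True by (auto simp: series_prod_geom_pos[OF assms(2)] keys_pos_part a0 in_keys_iff
          split: if_splits)
    moreover have "?g b0 = 1"
      using True by (auto simp: series_prod_geom_neg[OF assms(1)] keys_neg_part b0 in_keys_iff
          split: if_splits)
    ultimately have "X = {(a0, b0)}" using X by (auto simp: X_def)
    then have "series_mult ?f ?g d = ?f a0 * ?g b0" unfolding series_mult_def X_def[symmetric] by
        simp
    then show ?thesis using True \<open>?f a0 = 1\<close> \<open>?g b0 = 1\<close> by simp
  next
    case False
    then have "X = {}" using X by auto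
    then have "series_mult ?f ?g d = 0" unfolding series_mult_def X_def[symmetric] by simp
    then show ?thesis using False by simp
  qed
qed

text \<open>In \<open>enat\<close> a product with \<open>0\<close> is \<open>0\<close> even for an
  infinite factor, so the indicator selects one pair.\<close>

lemma sum_delta_enat:
  fixes x :: "'a \<Rightarrow> 'b \<Rightarrow> enat"
  assumes "finite A" "finite B"
  shows "(\<Sum>F\<in>A. \<Sum>G\<in>B. x F G * (if g = G \<and> f = F then 1 else 0)) = (if f \<in> A \<and> g \<in> B then x f g
      else 0)"
proof -
  have "(\<Sum>F\<in>A. \<Sum>G\<in>B. x F G * (if g = G \<and> f = F then 1 else 0)) =
      (\<Sum>F\<in>A. if f = F then (if g \<in> B then x F g else 0) else 0)"
  proof (rule sum.cong)
    fix F
    have "(\<Sum>G\<in>B. x F G * (if g = G \<and> f = F then 1 else 0)) =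
        (\<Sum>G\<in>B. if g = G then (if f = F then x F G else 0) else 0)"
      by (intro sum.cong) auto
    then show "(\<Sum>G\<in>B. x F G * (if g = G \<and> f = F then 1 else 0)) =
        (if f = F then (if g \<in> B then x F g else 0) else 0)"
      using assms(2) by simp
  qed simp
  then show ?thesis using assms(1) by simp
qed

section \<open>The complex of a degree as a restricted link\<close>

context stanley_reisner_degree
begin

text \<open>The link also demands disjointness from the positive support; this is automatic for
  subsets of \<open>Wset n\<close> when that support lies in \<open>Vset m\<close>.\<close>

lemma deg_complex_eq_link:
  assumes "neg_supp \<subseteq> Wset n" "Poly_Mapping.keys pos_exp \<subseteq> Vset m"
  shows "deg_complex = induced (lk \<Delta> (neg_supp \<union> Poly_Mapping.keys pos_exp)) (Wset n)"
proof -
  have "Vset m \<inter> Wset n = {}" by (auto simp: Vset_def Wset_def)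
  moreover have "s \<union> neg_supp \<union> Poly_Mapping.keys pos_exp = neg_supp \<union> Poly_Mapping.keys pos_exp \<union>
      s" for s by blast
  ultimately show ?thesis using assms unfolding deg_complex_def induced_def lk_def by auto
qed

text \<open>In these degrees the complex is void, or the positive support contains a vertex of
  \<open>Wset n\<close>. Adding such a vertex leaves the face condition unchanged, so it is the apex
  of a cone.\<close>

lemma coh_dim_deg_complex_eq_zero:
  assumes "\<not> (neg_supp \<in> induced \<Delta> (Wset n) \<and> Poly_Mapping.keys pos_exp \<subseteq> Vset m)"
  shows "deg_complex.coh_dim TYPE('k) c = 0"
proof (cases "deg_complex = {}")
  case True
  then show ?thesis by (intro deg_complex.coh_dim_cone) auto
next
  case False
  then obtain s where s: "neg_supp \<subseteq> Wset n" "s \<union> neg_supp \<union> Poly_Mapping.keys pos_exp \<in> \<Delta>"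
    by (auto simp: deg_complex_def)
  have "neg_supp \<in> \<Delta>" by (rule \<Delta>_subset_closed[OF s(2)]) blast
  then have "\<not> Poly_Mapping.keys pos_exp \<subseteq> Vset m" using assms s(1) by (simp add: induced_def)
  then obtain w where w: "w \<in> Poly_Mapping.keys pos_exp" "w \<in> Wset n"
    using s(2) \<Delta>_subset by blast
  have "insert w t \<in> deg_complex" if "t \<in> deg_complex" for t
  proof -
    have "insert w t \<union> neg_supp \<union> Poly_Mapping.keys pos_exp = t \<union> neg_supp \<union> Poly_Mapping.keys
        pos_exp" using w(1) by blast
    moreover have "w \<notin> neg_supp" using w(1) keys_pos_neg_disjoint[of d] by blast
    ultimately show ?thesis using that w(2) by (simp add: deg_complex_def)
  qed
  then show ?thesis by (rule deg_complex.coh_dim_cone)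
qed

end

theorem theorem1p3:
  fixes m n :: nat
    and I :: "'k::field mpol set"
    and i :: int
  assumes "squarefree_monomial_ideal m n I"
  shows "hilbert_series (sr_local_cohomology m n I i) =
    (\<lambda>d. \<Sum>F\<in>induced (sr_complex m n I) (Wset n). \<Sum>G\<in>Pow (Vset m).
       vs_dim (reduced_homology TYPE('k) (induced (lk (sr_complex m n I) (F \<union> G)) (Wset n))
                 (i - int (card F) - 1))
       * series_mult (series_prod geom_pos G) (series_prod geom_neg F) d)"
proof
  fix d
  interpret stanley_reisner_degree m n I d using assms by unfold_locales
  let ?h = "\<lambda>F G. vs_dim (reduced_homology TYPE('k) (induced (lk \<Delta> (F \<union> G)) (Wset n))
                 (i - int (card F) - 1))"
  have fin: "finite (induced \<Delta> (Wset n))" "finite (Pow (Vset m))"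
    by (auto simp: induced_def Wset_def Vset_def intro: finite_subset[of _ "Pow (Yv ` {1..n})"])
  have "(\<Sum>F\<in>induced \<Delta> (Wset n). \<Sum>G\<in>Pow (Vset m).
      ?h F G * series_mult (series_prod geom_pos G) (series_prod geom_neg F) d) =
    (\<Sum>F\<in>induced \<Delta> (Wset n). \<Sum>G\<in>Pow (Vset m).
      ?h F G * (if Poly_Mapping.keys pos_exp = G \<and> neg_supp = F then 1 else 0))"
  proof (intro sum.cong refl)
    fix F G assume "F \<in> induced \<Delta> (Wset n)" "G \<in> Pow (Vset m)"
    then have "F \<subseteq> Yv ` {1..n}" "G \<subseteq> Xv ` {1..m}" by (auto simp: induced_def Wset_def Vset_def)
    then have "finite F" "finite G" "F \<inter> G = {}" by (auto intro: finite_subset)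
    then show "?h F G * series_mult (series_prod geom_pos G) (series_prod geom_neg F) d =
        ?h F G * (if Poly_Mapping.keys pos_exp = G \<and> neg_supp = F then 1 else 0)"
      by (simp only: series_mult_geometric)
  qed
  also have "\<dots> = (if neg_supp \<in> induced \<Delta> (Wset n) \<and> Poly_Mapping.keys pos_exp \<in> Pow (Vset m)
      then ?h neg_supp (Poly_Mapping.keys pos_exp) else 0)"
    by (rule sum_delta_enat[OF fin])
  \<comment> \<open>If the supports of \<open>d\<close> are a pair over which the double sum runs,
    the complex of \<open>d\<close> is the restricted link of that pair; otherwise both sides are
    zero.\<close>
  also have "\<dots> = enat (deg_complex.coh_dim TYPE('k) (i - int (card neg_supp) - 1))"
  proof (cases "neg_supp \<in> induced \<Delta> (Wset n) \<and> Poly_Mapping.keys pos_exp \<subseteq> Vset m")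
    case True
    then have "deg_complex = induced (lk \<Delta> (neg_supp \<union> Poly_Mapping.keys pos_exp)) (Wset n)"
      by (intro deg_complex_eq_link) (auto simp: induced_def)
    then show ?thesis using True deg_complex.vs_dim_reduced_homology[of "i - int (card neg_supp) -
        1", where ?'k = 'k] by simp
  next
    case False
    then show ?thesis using coh_dim_deg_complex_eq_zero[OF False] by (auto simp: zero_enat_def)
  qed
  also have "\<dots> = hilbert_series (sr_local_cohomology m n I i) d"
    unfolding hilbert_series_def by (rule vs_dim_local_cohomology[symmetric])
  finally show "hilbert_series (sr_local_cohomology m n I i) d =
    (\<Sum>F\<in>induced \<Delta> (Wset n). \<Sum>G\<in>Pow (Vset m).
      ?h F G * series_mult (series_prod geom_pos G) (series_prod geom_neg F) d)" ..
qed

end
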